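(* Let $J\subsetneq S$ be a bigraded ideal and $R=S/J$. (i) For $s\gg0$, $t\in\mathbb N$ and $\tilde\Delta=(s,t)$ one has $\mathrm{reg}_x^{S_{\tilde\Delta}}(R_{\tilde\Delta})=0$; that is, there is $s_0$ such that this holds for all $s\ge s_0$ and all $t\in\mathbb N$. (ii) For $t\gg0$, $s\in\mathbb N$ and $\tilde\Delta=(s,t)$ one has $\mathrm{reg}_y^{S_{\tilde\Delta}}(R_{\tilde\Delta})=0$; that is, there is $t_0$ such that this holds for all $t\ge t_0$ and all $s\in\mathbb N$.
   Context: $K$ is an infinite field, $\mathbb N=\{0,1,2,\dots\}$, and $S=K[x_1,\dots,x_n,y_1,\dots,y_m]$ is the standard bigraded polynomial ring with $\deg x_i=(1,0)$, $\deg y_j=(0,1)$. For a bigraded algebra $R$ (a quotient of $S$ by a bigraded ideal) and $\tilde\Delta=(s,t)\in\mathbb N^2$, $(s,t)\neq(0,0)$, the bigraded Veronese algebra is $R_{\tilde\Delta}=\bigoplus_{(a,b)\in\mathbb N^2}R_{(as,bt)}$, a bigraded algebra whose component of bidegree $(a,b)$ is $R_{(as,bt)}$; $R_{\tilde\Delta}$ is a module over $S_{\tilde\Delta}$ via the natural map $S_{\tilde\Delta}\to R_{\tilde\Delta}$. For a bigraded algebra $A$ and a finitely generated bigraded $A$-module $M$, $\beta^A_{i,(a,b)}(M)=\dim_K\mathrm{Tor}^A_i(M,K)_{(a,b)}$, and $\mathrm{reg}_x^A(M)=\sup\{a\in\mathbb Z:\beta^A_{i,(a+i,b)}(M)\ne0\text{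 for some }i,b\in\mathbb Z\}$, $\mathrm{reg}_y^A(M)=\sup\{b\in\mathbb Z:\beta^A_{i,(a,b+i)}(M)\ne0\text{ for some }i,a\in\mathbb Z\}$. *)

theory Defs
  imports
    "HOL-Library.Poly_Mapping"
    "HOL-Library.Product_Plus"
    "HOL-Library.Extended_Real"
    "HOL-Algebra.QuotRing"
    "HOL-Algebra.Module"
begin

section \<open>The bigraded polynomial ring and its quotients\<close>

type_synonym bideg = "int \<times> int"

text \<open>The variable \<open>x\<^sub>i\<close> is \<open>Inl i\<close> and \<open>y\<^sub>j\<close> is \<open>Inr j\<close>; both are indexed from 0.\<close>

type_synonym mon = "(nat + nat) \<Rightarrow>\<^sub>0 nat"
type_synonym 'k pol = "mon \<Rightarrow>\<^sub>0 'k"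

definition bidegree :: "nat \<Rightarrow> nat \<Rightarrow> mon \<Rightarrow> bideg" where
  "bidegree n m \<mu> =
     (int (\<Sum>i<n. Poly_Mapping.lookup \<mu> (Inl i)), int (\<Sum>j<m. Poly_Mapping.lookup \<mu> (Inr j)))"

definition pol_set :: "nat \<Rightarrow> nat \<Rightarrow> 'k::field pol set" where
  "pol_set n m = {p. \<forall>\<mu>\<in>Poly_Mapping.keys p. Poly_Mapping.keys \<mu> \<subseteq> Inl ` {..<n} \<union> Inr ` {..<m}}"

definition pol_ring :: "nat \<Rightarrow> nat \<Rightarrow> 'k::field pol ring" where
  "pol_ring n m =
     \<lparr>carrier = pol_set n m, mult = (*), one = 1, zero = 0, add = (+)\<rparr>"

text \<open>Bidegrees range over \<open>\<int>\<^sup>2\<close>; a component is zero as soon as one coordinate is negative.\<close>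

definition pol_comp :: "nat \<Rightarrow> nat \<Rightarrow> bideg \<Rightarrow> 'k::field pol set" where
  "pol_comp n m d = {p \<in> pol_set n m. \<forall>\<mu>\<in>Poly_Mapping.keys p. bidegree n m \<mu> = d}"

definition bigraded_ideal :: "nat \<Rightarrow> nat \<Rightarrow> 'k::field pol set \<Rightarrow> bool" where
  "bigraded_ideal n m J \<longleftrightarrow>
     ideal J (pol_ring n m) \<and> J = Idl\<^bsub>pol_ring n m\<^esub> (\<Union>d. J \<inter> pol_comp n m d)"

definition quot_comp ::
    "nat \<Rightarrow> nat \<Rightarrow> 'k::field pol set \<Rightarrow> bideg \<Rightarrow> 'k pol set set" where
  "quot_comp n m J d = (\<lambda>p. J +>\<^bsub>pol_ring n m\<^esub> p) ` pol_comp n m d"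

definition quot_module ::
    "nat \<Rightarrow> nat \<Rightarrow> 'k::field pol set \<Rightarrow> ('k pol, 'k pol set) module" where
  "quot_module n m J =
     (let S = pol_ring n m; R = S Quot J in
      \<lparr>carrier = carrier R, mult = mult R, one = one R, zero = zero R, add = add R,
       smult = (\<lambda>p r. (J +>\<^bsub>S\<^esub> p) \<otimes>\<^bsub>R\<^esub> r)\<rparr>)"


section \<open>Bigraded algebras and modules\<close>

text \<open>
  Bigraded objects are external direct sums, given by the family of their components.
  The components of a bigraded \<open>K\<close>-algebra \<open>A\<close> are subsets of a commutative ring, which
  supplies the products \<open>A\<^sub>d \<times> A\<^sub>e \<rightarrow> A\<^sub>d\<^sub>+\<^sub>e\<close>; \<open>scal\<close> is the structure map of that ring as a
  \<open>K\<close>-algebra.  The components of a bigraded module are likewise subsets of an ambient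
  module, which supplies the actions \<open>A\<^sub>d \<times> M\<^sub>e \<rightarrow> M\<^sub>d\<^sub>+\<^sub>e\<close>.  Distinct components may overlap
  in the ambient object: they are distinct summands nevertheless.
\<close>

record ('k, 'a) bg_algebra =
  scal :: "'k \<Rightarrow> 'a"
  acomp :: "bideg \<Rightarrow> 'a set"

record ('a, 'b) bg_module =
  ambient :: "('a, 'b) module"
  mcomp :: "bideg \<Rightarrow> 'b set"

text \<open>
  The summands of the Veronese are indexed by \<open>(a, b) \<in> \<nat>\<^sup>2\<close> and not by the bidegrees
  \<open>(as, bt)\<close>.  So for \<open>t = 0\<close> the component \<open>G (as, 0)\<close> occurs once for every \<open>b \<ge> 0\<close>, and
  not for \<open>b < 0\<close>.
\<close>

definition veronese_comp :: "nat \<times> nat \<Rightarrow> 'b \<Rightarrow> (bideg \<Rightarrow> 'b set) \<Rightarrow> bideg \<Rightarrow> 'b set" where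
  "veronese_comp = (\<lambda>(s, t) z G (a, b).
     if 0 \<le> a \<and> 0 \<le> b then G (a * int s, b * int t) else {z})"

definition pol_veronese ::
    "nat \<Rightarrow> nat \<Rightarrow> nat \<times> nat \<Rightarrow> ('k::field, 'k pol) bg_algebra" where
  "pol_veronese n m \<Delta> =
     \<lparr>scal = Poly_Mapping.single 0, acomp = veronese_comp \<Delta> 0 (pol_comp n m)\<rparr>"

definition quot_veronese ::
    "nat \<Rightarrow> nat \<Rightarrow> 'k::field pol set \<Rightarrow> nat \<times> nat \<Rightarrow> ('k pol, 'k pol set) bg_module" where
  "quot_veronese n m J \<Delta> =
     \<lparr>ambient = quot_module n m J,
      mcomp = veronese_comp \<Delta> \<zero>\<^bsub>quot_module n m J\<^esub> (quot_comp n m J)\<rparr>"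


section \<open>Tor and the two regularities\<close>

text \<open>
  The free module \<open>A(-d\<^sub>0) \<oplus> \<dots> \<oplus> A(-d\<^sub>r\<^sub>-\<^sub>1)\<close> is represented by \<open>r\<close> and \<open>d\<close>; its elements
  are coordinate vectors over the ambient ring, and \<open>free_comp A r d e\<close> is its component of
  bidegree \<open>e\<close>.
\<close>

definition vsmult :: "'a::comm_ring_1 \<Rightarrow> (nat \<Rightarrow>\<^sub>0 'a) \<Rightarrow> (nat \<Rightarrow>\<^sub>0 'a)" where
  "vsmult c v = Poly_Mapping.map ((*) c) v"

definition free_comp ::
    "('k, 'a::comm_ring_1) bg_algebra \<Rightarrow> nat \<Rightarrow> (nat \<Rightarrow> bideg) \<Rightarrow> bideg \<Rightarrow> (nat \<Rightarrow>\<^sub>0 'a) set" where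
  "free_comp A r d e = {v. Poly_Mapping.keys v \<subseteq> {..<r} \<and> (\<forall>j<r. Poly_Mapping.lookup v j \<in> acomp A (e - d j))}"

text \<open>
  Data of an augmented complex \<open>\<dots> \<rightarrow> F\<^sub>1 \<rightarrow> F\<^sub>0 \<rightarrow> M\<close> of free modules of finite rank:
  \<open>rk i\<close> and \<open>dg i\<close> are the rank and the bidegrees of the basis of \<open>F\<^sub>i\<close>,
  \<open>dif i k \<in> F\<^sub>i\<^sub>-\<^sub>1\<close> is the image of the \<open>k\<close>-th basis element of \<open>F\<^sub>i\<close> for \<open>i \<ge> 1\<close>
  (\<open>dif 0\<close> is not used), and \<open>aug k \<in> M\<close> that of the \<open>k\<close>-th basis element of \<open>F\<^sub>0\<close>.
\<close>

record (overloaded) ('a, 'b) free_complex =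
  rk :: "nat \<Rightarrow> nat"
  dg :: "nat \<Rightarrow> nat \<Rightarrow> bideg"
  dif :: "nat \<Rightarrow> nat \<Rightarrow> (nat \<Rightarrow>\<^sub>0 'a)"
  aug :: "nat \<Rightarrow> 'b"

definition fcomp ::
    "('k, 'a::comm_ring_1) bg_algebra \<Rightarrow> ('a, 'b) free_complex \<Rightarrow> nat \<Rightarrow> bideg \<Rightarrow> (nat \<Rightarrow>\<^sub>0 'a) set" where
  "fcomp A F i e = free_comp A (rk F i) (dg F i) e"

definition diff_map ::
    "('a::comm_ring_1, 'b) free_complex \<Rightarrow> nat \<Rightarrow> (nat \<Rightarrow>\<^sub>0 'a) \<Rightarrow> (nat \<Rightarrow>\<^sub>0 'a)" where
  "diff_map F i v = (\<Sum>k<rk F i. vsmult (Poly_Mapping.lookup v k) (dif F i k))"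

definition aug_map ::
    "('a::comm_ring_1, 'b) bg_module \<Rightarrow> ('a, 'b) free_complex \<Rightarrow> (nat \<Rightarrow>\<^sub>0 'a) \<Rightarrow> 'b" where
  "aug_map M F v = (\<Oplus>\<^bsub>ambient M\<^esub>k\<in>{..<rk F 0}. Poly_Mapping.lookup v k \<odot>\<^bsub>ambient M\<^esub> aug F k)"

definition bigraded_free_resolution ::
    "('k, 'a::comm_ring_1) bg_algebra \<Rightarrow> ('a, 'b) bg_module \<Rightarrow> ('a, 'b) free_complex \<Rightarrow> bool" where
  "bigraded_free_resolution A M F \<longleftrightarrow>
     (\<forall>k<rk F 0. aug F k \<in> mcomp M (dg F 0 k)) \<and>
     (\<forall>i. \<forall>k<rk F (Suc i). dif F (Suc i) k \<in> fcomp A F i (dg F (Suc i) k)) \<and>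
     (\<forall>e. aug_map M F ` fcomp A F 0 e = mcomp M e) \<and>
     (\<forall>e. diff_map F 1 ` fcomp A F 1 e = {v \<in> fcomp A F 0 e. aug_map M F v = \<zero>\<^bsub>ambient M\<^esub>}) \<and>
     (\<forall>i e. diff_map F (Suc (Suc i)) ` fcomp A F (Suc (Suc i)) e =
              {v \<in> fcomp A F (Suc i) e. diff_map F (Suc i) v = 0})"

text \<open>
  With \<open>A\<^sub>+ = \<Oplus>\<^bsub>c \<noteq> 0\<^esub> A\<^sub>c\<close> and \<open>K = A/A\<^sub>+\<close> one has \<open>F \<otimes>\<^sub>A K = F/A\<^sub>+F\<close>; the component of
  \<open>A\<^sub>+F\<^sub>i\<close> of bidegree \<open>e\<close> is \<open>irr_comp A F i e\<close>.
\<close>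

definition kscale :: "('k, 'a::comm_ring_1) bg_algebra \<Rightarrow> 'k \<Rightarrow> (nat \<Rightarrow>\<^sub>0 'a) \<Rightarrow> (nat \<Rightarrow>\<^sub>0 'a)" where
  "kscale A c = vsmult (scal A c)"

definition irr_comp ::
    "('k::field, 'a::comm_ring_1) bg_algebra \<Rightarrow> ('a, 'b) free_complex \<Rightarrow> nat \<Rightarrow> bideg \<Rightarrow> (nat \<Rightarrow>\<^sub>0 'a) set" where
  "irr_comp A F i e = module.span (kscale A)
     {vsmult a v | a v c. c \<noteq> 0 \<and> a \<in> acomp A c \<and> v \<in> fcomp A F i (e - c)}"

text \<open>
  The preimages in \<open>(F\<^sub>i)\<^sub>e\<close> of the cycles and of the boundaries of \<open>F/A\<^sub>+F\<close>; their quotient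
  is \<open>H\<^sub>i(F \<otimes>\<^sub>A K)\<^sub>e\<close>.
\<close>

definition tor_cycles ::
    "('k::field, 'a::comm_ring_1) bg_algebra \<Rightarrow> ('a, 'b) free_complex \<Rightarrow> nat \<Rightarrow> bideg \<Rightarrow> (nat \<Rightarrow>\<^sub>0 'a) set" where
  "tor_cycles A F i e =
     {v \<in> fcomp A F i e. i = 0 \<or> diff_map F i v \<in> irr_comp A F (i - 1) e}"

definition tor_boundaries ::
    "('k::field, 'a::comm_ring_1) bg_algebra \<Rightarrow> ('a, 'b) free_complex \<Rightarrow> nat \<Rightarrow> bideg \<Rightarrow> (nat \<Rightarrow>\<^sub>0 'a) set" where
  "tor_boundaries A F i e =
     {diff_map F (Suc i) w + u | w u. w \<in> fcomp A F (Suc i) e \<and> u \<in> irr_comp A F i e}"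

text \<open>
  The Betti number \<open>dim\<^sub>K Tor\<^sub>i\<^sup>A(M, K)\<^sub>e\<close>, computed from a bigraded free resolution chosen
  once for all \<open>i\<close> and \<open>e\<close>.  Resolutions by free modules of finite rank exist for finitely
  generated modules over a noetherian \<open>A\<close>.  The difference of dimensions is the dimension of
  the quotient when the components of \<open>A\<close> have finite dimension.  Both hypotheses hold for
  the Veronese algebras of a polynomial ring.
\<close>

definition betti ::
    "('k::field, 'a::comm_ring_1) bg_algebra \<Rightarrow> ('a, 'b) bg_module \<Rightarrow> nat \<Rightarrow> bideg \<Rightarrow> nat" where
  "betti A M i e =
     (let F = (SOME F. bigraded_free_resolution A M F) in
      vector_space.dim (kscale A) (tor_cycles A F i e) -
      vector_space.dim (kscale A) (tor_boundaries A F i e))"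

definition reg_x :: "('k::field, 'a::comm_ring_1) bg_algebra \<Rightarrow> ('a, 'b) bg_module \<Rightarrow> ereal" where
  "reg_x A M = Sup {ereal (of_int a) | a. \<exists>i b. betti A M i (a + int i, b) \<noteq> 0}"

definition reg_y :: "('k::field, 'a::comm_ring_1) bg_algebra \<Rightarrow> ('a, 'b) bg_module \<Rightarrow> ereal" where
  "reg_y A M = Sup {ereal (of_int b) | b. \<exists>i a. betti A M i (a, b + int i) \<noteq> 0}"

end

theory Submission
  imports Defs "HOL-Library.Nat_Bijection"
begin

text \<open>
  Write \<open>A\<close> for the Veronese algebra of the polynomial ring \<open>S\<close> and \<open>A\<^sub>+\<close> for the span of its
  monomials of nonzero bidegree.  For a bigraded \<open>A\<close>-module \<open>N\<close> the vector space
  \<open>Tor\<^sub>j(N, K)\<close> is the \<open>j\<close>-th homology of the bar complex with terms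
  \<open>N \<otimes> A\<^sub>+ \<otimes> \<dots> \<otimes> A\<^sub>+\<close>.  The algebra \<open>A\<close> has a basis of monomials, so a bar chain is a
  finitely supported function from words in monomials to \<open>N\<close>; the predicate \<open>bar_exact\<close> says
  that the homology vanishes in a given homological degree \<open>j\<close> and bidegree \<open>e\<close>.

  The heart of the proof is a vanishing theorem for the Veronese module of the ideal \<open>J\<close>
  (\<open>bar_exact_ideal_mod\<close>): if \<open>s\<close> is large, then the homology in degree \<open>j\<close> and bidegree \<open>e\<close>
  is zero as soon as the \<open>x\<close>-part of \<open>e\<close> exceeds \<open>j + 1\<close>, whatever \<open>t\<close> is; and the same with
  \<open>x\<close>, \<open>s\<close> and \<open>y\<close>, \<open>t\<close> exchanged.  It is reached in three steps.

  \<^item> The total monomial of a term of a chain (coefficient monomial times the letters of the word)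
    is kept by the differential.  Filtering by a monomial order reduces \<open>J\<close> to its initial ideal
    (\<open>bar_exact_initial\<close>).

  \<^item> The initial ideal is a finite union of principal monomial ideals, by Dickson's lemma, and
    intersections of principal monomial ideals are principal.  Mayer-Vietoris bounds the homology
    of the union in degree \<open>j\<close> by that of the intersections of \<open>c\<close> of the ideals in degree
    \<open>j + 1 - c\<close> (\<open>bar_exact_UN\<close>).  Every least common multiple of the generators divides their
    product, so all its degrees are bounded in advance; this is where \<open>s\<^sub>0\<close> comes from.

  \<^item> For the ideal of a monomial \<open>\<mu>\<close> of bidegree \<open>(a, b)\<close>, homology in degree \<open>j\<close> is confined to
    \<open>x\<close>-degrees at most \<open>j + \<lceil>a/s\<rceil>\<close> and \<open>y\<close>-degrees at most \<open>j + \<lceil>b/t\<rceil>\<close>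
    (\<open>bar_exact_multiples\<close>).  If \<open>s\<close> does not divide \<open>a\<close>, then no monomial of \<open>A\<close> has the same
    \<open>x\<close>-degree as \<open>\<mu>\<close>, so the ideals of \<open>\<mu>\<close> and of all the \<open>\<mu> x\<^sub>i\<close> together have the same
    Veronese module and Mayer-Vietoris applies again; this plays the role of the Koszul complex.
    Once \<open>(a, b)\<close> is a multiple of \<open>(s, t)\<close> the module is a shifted copy of \<open>A\<close>, which is acyclic.

  The Betti numbers are defined by an unspecified resolution \<open>F\<close> by free modules of finite rank.
  One exists, because leading terms and Dickson's lemma show that bigraded submodules of free
  \<open>A\<close>-modules are finitely generated (\<open>free_submodule_finitely_generated\<close>).  For an arbitrary one,
  let \<open>Z\<^sub>k\<close> be the kernels in \<open>F\<close>.  The group \<open>Tor\<^sub>i\<close> is zero when every element of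
  \<open>Z\<^sub>i\<^sub>-\<^sub>1 \<inter> A\<^sub>+F\<^sub>i\<^sub>-\<^sub>1\<close> lies in \<open>A\<^sub>+Z\<^sub>i\<^sub>-\<^sub>1\<close>, and a diagram chase in bar complexes moves this
  statement along \<open>Z\<^sub>i\<^sub>-\<^sub>1, \<dots>, Z\<^sub>0\<close> to homological degree \<open>i - 1\<close> of the bar complex of \<open>J\<close>
  (\<open>lift_boundary\<close>, \<open>syz_boundary\<close>).  The bound \<open>j + 1\<close> for \<open>J\<close> thus becomes the bound \<open>i\<close> for
  the quotient.  Finally the regularity is not smaller than \<open>0\<close>, because the unit of the quotient
  is not in \<open>A\<^sub>+\<close> times the quotient.
\<close>

section \<open>Finitely supported functions\<close>

abbreviation "lookup \<equiv> Poly_Mapping.lookup"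
abbreviation "keys \<equiv> Poly_Mapping.keys"
abbreviation "single \<equiv> Poly_Mapping.single"

lemma keys_minus_subset:
  fixes p q :: "'i \<Rightarrow>\<^sub>0 'b::ab_group_add"
  shows "keys (p - q) \<subseteq> keys p \<union> keys q"
  by (auto simp: in_keys_iff lookup_minus)

lemma keys_sum_subset:
  fixes b :: "'x \<Rightarrow> 'i \<Rightarrow>\<^sub>0 'b::comm_monoid_add"
  shows "keys (sum b I) \<subseteq> (\<Union>i\<in>I. keys (b i))"
  by (auto simp: in_keys_iff lookup_sum) (meson sum.not_neutral_contains_not_neutral)

lemma exists_poly_mapping:
  assumes "finite A"
  shows "\<exists>p. \<forall>x. lookup p x = (if x \<in> A then f x else 0)"
proof -
  have "finite {x. (if x \<in> A then f x else 0) \<noteq> 0}"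
    by (rule finite_subset[OF _ assms]) auto
  then show ?thesis
    by (intro exI[of _ "Abs_poly_mapping (\<lambda>x. if x \<in> A then f x else 0)"])
      (simp only: lookup_Abs_poly_mapping simp_thms)
qed

text \<open>
  The map on finitely supported functions that is induced by a family \<open>\<phi>\<close> of additive maps, one for
  each point of the index set.
\<close>

definition lin :: "('i \<Rightarrow> 'b \<Rightarrow> 'c) \<Rightarrow> ('i \<Rightarrow>\<^sub>0 'b::zero) \<Rightarrow> 'c::comm_monoid_add" where
  "lin \<phi> z = (\<Sum>l\<in>keys z. \<phi> l (lookup z l))"

lemma lin_single: "\<phi> l 0 = 0 \<Longrightarrow> lin \<phi> (single l b) = \<phi> l b"
  by (simp add: lin_def)

lemma additive_lin:
  assumes "\<And>l. additive (\<phi> l)"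
  shows "additive (lin \<phi>)"
proof
  fix x y
  show "lin \<phi> (x + y) = lin \<phi> x + lin \<phi> y"
    unfolding lin_def
    by (rule setsum_keys_plus_distrib) (auto simp: additive.zero[OF assms] additive.add[OF assms])
qed

lemma lin_single_id:
  fixes z :: "'i \<Rightarrow>\<^sub>0 'b::comm_monoid_add"
  shows "lin single z = z"
  by (rule poly_mapping_eqI)
    (auto simp: lin_def lookup_sum lookup_single when_def in_keys_iff)

lemma additive_eqI:
  assumes "additive f" "additive g"
    and "\<And>l b. f (single l b) = g (single l b)"
  shows "f z = g z"
proof -
  have "f (lin single z) = g (lin single z)"
    unfolding lin_def
    by (simp add: additive.sum[OF assms(1)] additive.sum[OF assms(2)] assms(3))
  then show ?thesis by (simp add: lin_single_id)
qed

lemma additive_single: "additive (single l)"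
  by unfold_locales (simp add: single_add)

lemma additive_comp: "additive f \<Longrightarrow> additive g \<Longrightarrow> additive (\<lambda>x. f (g x))"
  unfolding additive_def by simp

lemma additive_minus: "additive f \<Longrightarrow> additive g \<Longrightarrow> additive (\<lambda>x. f x - g x)"
  unfolding additive_def by simp

lemma additive_plus: "additive f \<Longrightarrow> additive g \<Longrightarrow> additive (\<lambda>x. f x + g x)"
  unfolding additive_def by (simp add: algebra_simps)

lemma additive_0: "additive (\<lambda>x. 0)"
  unfolding additive_def by simp

lemma additive_id: "additive (\<lambda>x. x)"
  unfolding additive_def by simp

text \<open>
  For additive \<open>f\<close> this has the same values as \<open>Poly_Mapping.map f\<close>; the form by \<open>lin\<close> makes the
  additivity of \<open>cmap f\<close> an instance of that of \<open>lin\<close>.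
\<close>

definition cmap :: "('b \<Rightarrow> 'c) \<Rightarrow> ('i \<Rightarrow>\<^sub>0 'b::zero) \<Rightarrow> ('i \<Rightarrow>\<^sub>0 'c::comm_monoid_add)" where
  "cmap f = lin (\<lambda>l b. single l (f b))"

lemma additive_cmap: "additive f \<Longrightarrow> additive (cmap f)"
  unfolding cmap_def by (intro additive_lin additive_comp[OF additive_single])

lemma cmap_single: "additive f \<Longrightarrow> cmap f (single l b) = single l (f b)"
  unfolding cmap_def by (simp add: lin_single additive.zero)

lemma lookup_cmap:
  "additive f \<Longrightarrow> lookup (cmap f z) l = f (lookup z l)"
  by (auto simp: cmap_def lin_def lookup_sum lookup_single when_def in_keys_iff additive.zero)

section \<open>Dickson's lemma\<close>

text \<open>
  By induction on the set of coordinates.  For one more coordinate \<open>i\<close>, a finite set \<open>Y\<close>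
  that is good for the old coordinates serves all points whose \<open>i\<close>-th coordinate is at least
  the maximum over \<open>Y\<close>; each of the finitely many smaller values is a slice to which the
  induction hypothesis applies.
\<close>

lemma dickson:
  fixes \<phi> :: "'i \<Rightarrow> 'x \<Rightarrow> nat"
  assumes "finite I"
  shows "\<exists>Y\<subseteq>X. finite Y \<and> (\<forall>x\<in>X. \<exists>y\<in>Y. \<forall>i\<in>I. \<phi> i y \<le> \<phi> i x)"
  using assms
proof (induction I arbitrary: X rule: finite_induct)
  case empty
  show ?case
  proof (cases "X = {}")
    case False
    then obtain x where "x \<in> X" by blast
    then show ?thesis by (intro exI[of _ "{x}"]) auto
  qed auto
next
  case (insert i I)
  obtain Y where Y: "Y \<subseteq> X" "finite Y" "\<forall>x\<in>X. \<exists>y\<in>Y. \<forall>i\<in>I. \<phi> i y \<le> \<phi> i x"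
    using insert.IH[of X] by blast
  define N where "N = Max (insert 0 (\<phi> i ` Y))"
  have N: "\<phi> i y \<le> N" if "y \<in> Y" for y
    using that Y(2) by (auto simp: N_def intro!: Max_ge)
  have "\<forall>c. \<exists>Z\<subseteq>{x\<in>X. \<phi> i x = c}. finite Z \<and> (\<forall>x\<in>{x\<in>X. \<phi> i x = c}. \<exists>y\<in>Z. \<forall>i\<in>I. \<phi> i y \<le> \<phi> i x)"
    by (intro allI insert.IH)
  then have "\<exists>Z. \<forall>c. Z c \<subseteq> {x\<in>X. \<phi> i x = c} \<and> finite (Z c) \<and>
      (\<forall>x\<in>{x\<in>X. \<phi> i x = c}. \<exists>y\<in>Z c. \<forall>i\<in>I. \<phi> i y \<le> \<phi> i x)"
    by (rule choice)
  then obtain Z where Z0: "\<forall>c. Z c \<subseteq> {x\<in>X. \<phi> i x = c} \<and> finite (Z c) \<and>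
      (\<forall>x\<in>{x\<in>X. \<phi> i x = c}. \<exists>y\<in>Z c. \<forall>i\<in>I. \<phi> i y \<le> \<phi> i x)"
    by (rule exE)
  have Z: "Z c \<subseteq> {x\<in>X. \<phi> i x = c}" "finite (Z c)"
    "\<forall>x\<in>{x\<in>X. \<phi> i x = c}. \<exists>y\<in>Z c. \<forall>i\<in>I. \<phi> i y \<le> \<phi> i x" for c
    using Z0[rule_format, of c] by simp_all
  show ?case
  proof (intro exI[of _ "Y \<union> (\<Union>c<N. Z c)"] conjI ballI)
    show "Y \<union> (\<Union>c<N. Z c) \<subseteq> X" using Y Z by blast
    show "finite (Y \<union> (\<Union>c<N. Z c))" using Y Z by blast
    fix x assume x: "x \<in> X"
    show "\<exists>y\<in>Y \<union> (\<Union>c<N. Z c). \<forall>i\<in>insert i I. \<phi> i y \<le> \<phi> i x"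
    proof (cases "\<phi> i x < N")
      case True
      then obtain y where y: "y \<in> Z (\<phi> i x)" "\<forall>i\<in>I. \<phi> i y \<le> \<phi> i x"
        using Z(3)[of "\<phi> i x"] x by blast
      then have "\<phi> i y = \<phi> i x" using Z(1) by blast
      with y True show ?thesis by (intro bexI[of _ y]) auto
    next
      case False
      obtain y where "y \<in> Y" "\<forall>i\<in>I. \<phi> i y \<le> \<phi> i x" using Y x by blast
      with False N[of y] show ?thesis by (intro bexI[of _ y]) auto
    qed
  qed
qed

section \<open>The bar complex\<close>

type_synonym letter = "bideg \<times> mon"

definition prepend :: "'g \<Rightarrow> ('g list \<Rightarrow>\<^sub>0 'b) \<Rightarrow> ('g list \<Rightarrow>\<^sub>0 'b::ab_group_add)" where
  "prepend u = lin (\<lambda>l b. single (u # l) b)"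

lemma additive_prepend: "additive (prepend u)"
  unfolding prepend_def by (intro additive_lin additive_single)

lemma prepend_single [simp]:
  "prepend u (single l b) = single (u # l) b"
  by (simp add: prepend_def lin_single)

text \<open>
  The part of the bar differential that multiplies adjacent letters.  The usual alternating sum over
  the position of the product is unfolded at the first letter:
  \<open>D (u v l) = (u + v) l - u D (v l)\<close>.  This keeps the signs out of all proofs.
\<close>

fun merge_word :: "'g::comm_monoid_add list \<Rightarrow> 'b \<Rightarrow> ('g list \<Rightarrow>\<^sub>0 'b::ab_group_add)" where
  "merge_word (u # v # l) b = single ((u + v) # l) b - prepend u (merge_word (v # l) b)"
| "merge_word _ b = 0"

text \<open>
  The first letter may act on the coefficient.  In the bar complex of \<open>N\<close> with values in \<open>K\<close> the last
  letter acts on \<open>K\<close>, hence by zero, and contributes no term.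
\<close>

definition bar_word ::
    "('g \<Rightarrow> 'b \<Rightarrow> 'b) \<Rightarrow> 'g::comm_monoid_add list \<Rightarrow> 'b \<Rightarrow> ('g list \<Rightarrow>\<^sub>0 'b::ab_group_add)" where
  "bar_word act l b =
     (case l of [] \<Rightarrow> 0 | u # l' \<Rightarrow> single l' (act u b) - merge_word l b)"

definition bar_diff ::
    "('g \<Rightarrow> 'b \<Rightarrow> 'b) \<Rightarrow> ('g::comm_monoid_add list \<Rightarrow>\<^sub>0 'b) \<Rightarrow> ('g list \<Rightarrow>\<^sub>0 'b::ab_group_add)" where
  "bar_diff act = lin (bar_word act)"

lemma additive_merge_word: "additive (merge_word l)"
proof (induction l rule: induct_list012)
  case (3 u v l)
  then show ?case
    by (simp add: additive_minus additive_single additive_comp[OF additive_prepend])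
qed (simp_all add: additive_0)

definition merge :: "('g::comm_monoid_add list \<Rightarrow>\<^sub>0 'b) \<Rightarrow> ('g list \<Rightarrow>\<^sub>0 'b::ab_group_add)" where
  "merge = lin merge_word"

lemma additive_merge: "additive merge"
  unfolding merge_def by (intro additive_lin additive_merge_word)

lemma merge_single: "merge (single l b) = merge_word l b"
  unfolding merge_def by (simp add: lin_single additive.zero[OF additive_merge_word])

text \<open>
  The recursion equation of \<open>merge_word\<close> for combinations of words instead of single words.
\<close>

lemma merge_prepend_prepend:
  "merge (prepend m (prepend u z)) = prepend (m + u) z - prepend m (merge (prepend u z))"
  by (rule additive_eqI[where z = z])
    (auto simp: merge_single intro!: additive_minus additive_comp[OF additive_merge]
      additive_comp[OF additive_prepend] additive_prepend)

text \<open>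
  With \<open>D (u v l) = (u + v) l - u D (v l)\<close> one gets
  \<open>D (D (u v w l)) = u D (D (v w l))\<close>, since the other terms cancel in pairs.
\<close>

lemma merge_merge_word: "merge (merge_word l b) = 0"
proof (induction l arbitrary: b rule: induct_list012)
  case (3 u v l)
  show ?case
  proof (cases l)
    case Nil
    then show ?thesis by (simp add: merge_single additive.zero[OF additive_prepend])
  next
    case (Cons w l')
    have "merge (merge_word (v # l) b) = 0" by (rule 3)
    then have IH: "merge_word ((v + w) # l') b = merge (prepend v (merge_word (w # l') b))"
      by (simp add: Cons additive.diff[OF additive_merge] merge_single)
    show ?thesis
      by (simp add: Cons additive.diff[OF additive_merge] additive.diff[OF additive_prepend]
          merge_single merge_prepend_prepend add.assoc IH)
  qed
qed (simp_all add: additive.zero[OF additive_merge])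

locale bar =
  fixes P :: "letter set" and act :: "letter \<Rightarrow> 'b::ab_group_add \<Rightarrow> 'b"
  assumes P_add: "g \<in> P \<Longrightarrow> h \<in> P \<Longrightarrow> g + h \<in> P"
    and act_add: "act g (x + y) = act g x + act g y"
    and act_act: "act (g + h) x = act g (act h x)"
begin

lemma additive_act: "additive (act g)"
  by unfold_locales (rule act_add)

lemma additive_bar_word: "additive (bar_word act l)"
  unfolding bar_word_def
  by (cases l)
    (auto intro!: additive_0 additive_minus additive_merge_word additive_comp[OF additive_single]
      additive_act)

lemma additive_bar_diff: "additive (bar_diff act)"
  unfolding bar_diff_def by (intro additive_lin additive_bar_word)

lemma bar_diff_single: "bar_diff act (single l b) = bar_word act l b"
  unfolding bar_diff_def by (simp add: lin_single additive.zero[OF additive_bar_word])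

lemma bar_diff_prepend:
  "bar_diff act (prepend u z) = cmap (act u) z - merge (prepend u z)"
  by (rule additive_eqI[where z = z])
    (auto simp: bar_diff_single bar_word_def cmap_single additive_act merge_single
      intro!: additive_minus additive_comp[OF additive_merge] additive_cmap
      additive_comp[OF additive_bar_diff] additive_prepend additive_act)

lemma cmap_merge_word:
  assumes "additive f"
  shows "cmap f (merge_word l b) = merge_word l (f b)"
proof -
  have pre: "cmap f (prepend u z) = prepend u (cmap f z)" for u z
    by (rule additive_eqI[where z = z])
      (auto simp: cmap_single assms intro!: additive_comp[OF additive_prepend] additive_cmap
        additive_comp[OF additive_cmap] additive_prepend assms)
  show ?thesis
    by (induction l rule: induct_list012)
      (simp_all add: additive.zero[OF additive_cmap[OF assms]]
        additive.diff[OF additive_cmap[OF assms]] cmap_single assms pre)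
qed

text \<open>
  The terms in which a letter acts on the coefficient cancel in pairs; the remaining ones form the square
  of \<open>merge_word\<close>.
\<close>

lemma bar_diff_bar_diff: "bar_diff act (bar_diff act z) = 0"
proof (rule additive_eqI[where z = z])
  show "additive (\<lambda>z. bar_diff act (bar_diff act z))"
    by (intro additive_comp[OF additive_bar_diff] additive_bar_diff)
  show "additive (\<lambda>z. 0)" by (rule additive_0)
  fix l b
  show "bar_diff act (bar_diff act (single l b)) = 0"
  proof (cases l rule: remdups_adj.cases)
    case (3 u v l')
    have "merge (merge_word l b) = 0" by (rule merge_merge_word)
    then have *: "merge_word ((u + v) # l') b = merge (prepend u (merge_word (v # l') b))"
      by (simp add: 3 additive.diff[OF additive_merge] merge_single)
    show ?thesis
      by (simp add: 3 bar_diff_single bar_word_def additive.diff[OF additive_bar_diff]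
          bar_diff_prepend cmap_merge_word additive_act *[symmetric] add.commute[of u v]
          act_act[symmetric])
  qed (simp_all add: bar_diff_single bar_word_def additive.zero[OF additive_bar_diff]
      additive.diff[OF additive_bar_diff])
qed

end

text \<open>
  The component of bidegree \<open>e\<close> of \<open>N \<otimes> A\<^sub>+ \<otimes> \<dots> \<otimes> A\<^sub>+\<close> with \<open>j\<close> factors \<open>A\<^sub>+\<close>, where \<open>P\<close> is the
  set of monomials in \<open>A\<^sub>+\<close>.
\<close>

definition bar_chains :: "letter set \<Rightarrow> (bideg \<Rightarrow> 'b::zero set) \<Rightarrow> nat \<Rightarrow> bideg \<Rightarrow> (letter list \<Rightarrow>\<^sub>0 'b) set" where
  "bar_chains P N j e =
     {z. \<forall>l\<in>keys z. length l = j \<and> set l \<subseteq> P \<and>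
           lookup z l \<in> N (e - fst (sum_list l))}"

definition graded_submodule ::
    "letter set \<Rightarrow> (letter \<Rightarrow> 'b::ab_group_add \<Rightarrow> 'b) \<Rightarrow> (bideg \<Rightarrow> 'b set) \<Rightarrow> bool" where
  "graded_submodule P act N \<longleftrightarrow>
     (\<forall>c. 0 \<in> N c \<and> (\<forall>x\<in>N c. \<forall>y\<in>N c. x - y \<in> N c)) \<and>
     (\<forall>g\<in>P. \<forall>c. \<forall>x\<in>N c. act g x \<in> N (c + fst g))"

text \<open>
  For the modules below this is the vanishing of \<open>Tor\<^sub>j(N, K)\<close> in bidegree \<open>e\<close>.
\<close>

definition bar_exact ::
    "letter set \<Rightarrow> (letter \<Rightarrow> 'b::ab_group_add \<Rightarrow> 'b) \<Rightarrow> (bideg \<Rightarrow> 'b set) \<Rightarrow> nat \<Rightarrow> bideg \<Rightarrow> bool" where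
  "bar_exact P act N j e \<longleftrightarrow>
     (\<forall>z\<in>bar_chains P N j e. bar_diff act z = 0 \<longrightarrow> z \<in> bar_diff act ` bar_chains P N (Suc j) e)"

lemma bar_exactD:
  assumes "bar_exact P act N j e" "z \<in> bar_chains P N j e" "bar_diff act z = 0"
  obtains y where "y \<in> bar_chains P N (Suc j) e" "bar_diff act y = z"
  using assms unfolding bar_exact_def by blast

lemma graded_submodule_zero: "graded_submodule P act N \<Longrightarrow> 0 \<in> N c"
  and graded_submodule_diff: "graded_submodule P act N \<Longrightarrow> x \<in> N c \<Longrightarrow> y \<in> N c \<Longrightarrow> x - y \<in> N c"
  and graded_submodule_act: "graded_submodule P act N \<Longrightarrow> g \<in> P \<Longrightarrow> x \<in> N c \<Longrightarrow> act g x \<in> N (c + fst g)"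
  unfolding graded_submodule_def by blast+

lemma graded_submodule_uminus: "graded_submodule P act N \<Longrightarrow> x \<in> N c \<Longrightarrow> - x \<in> N c"
  using graded_submodule_diff[of P act N 0 c x] graded_submodule_zero[of P act N c] by simp

lemma graded_submodule_add:
  "graded_submodule P act N \<Longrightarrow> x \<in> N c \<Longrightarrow> y \<in> N c \<Longrightarrow> x + y \<in> N c"
  using graded_submodule_diff[of P act N x c "- y"] graded_submodule_uminus[of P act N y c] by simp

lemma graded_submodule_sum:
  assumes "graded_submodule P act N" and "\<And>i. i \<in> I \<Longrightarrow> f i \<in> N c"
  shows "sum f I \<in> N c"
  using assms(2)
  by (induction I rule: infinite_finite_induct)
    (auto simp: graded_submodule_zero[OF assms(1)] intro: graded_submodule_add[OF assms(1)])

lemma bar_chains_lookup: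
  assumes "graded_submodule P act N" "z \<in> bar_chains P N j e"
  shows "lookup z l \<in> N (e - fst (sum_list l))"
  using assms by (cases "l \<in> keys z")
    (auto simp: bar_chains_def in_keys_iff graded_submodule_zero)

lemma bar_chains_keys:
  assumes "z \<in> bar_chains P N j e" "lookup z l \<noteq> 0"
  shows "length l = j" "set l \<subseteq> P"
  using assms by (auto simp: bar_chains_def in_keys_iff)

lemma bar_chains_zero [simp]: "0 \<in> bar_chains P N j e"
  by (simp add: bar_chains_def)

lemma bar_chains_single:
  assumes "length l = j" "set l \<subseteq> P" "b \<in> N (e - fst (sum_list l))"
  shows "single l b \<in> bar_chains P N j e"
  using assms by (auto simp: bar_chains_def)

lemma bar_chains_diff:
  assumes N: "graded_submodule P act N" and z: "z \<in> bar_chains P N j e" and w: "w \<in> bar_chains P N j e"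
  shows "z - w \<in> bar_chains P N j e"
proof -
  have "length l = j \<and> set l \<subseteq> P" if "l \<in> keys (z - w)" for l
    using z w subsetD[OF keys_minus_subset that] unfolding bar_chains_def by blast
  then show ?thesis
    using bar_chains_lookup[OF N z] bar_chains_lookup[OF N w] graded_submodule_diff[OF N]
    by (auto simp: bar_chains_def lookup_minus)
qed

lemma bar_chains_uminus:
  "graded_submodule P act N \<Longrightarrow> z \<in> bar_chains P N j e \<Longrightarrow> - z \<in> bar_chains P N j e"
  using bar_chains_diff[of P act N 0 j e z] by simp

lemma bar_chains_add:
  "graded_submodule P act N \<Longrightarrow> z \<in> bar_chains P N j e \<Longrightarrow> w \<in> bar_chains P N j e \<Longrightarrow> z + w \<in> bar_chains P N j e"
  using bar_chains_diff[of P act N z j e "- w"] bar_chains_uminus[of P act N w j e] by simp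

lemma bar_chains_sum:
  assumes "graded_submodule P act N" and "\<And>i. i \<in> I \<Longrightarrow> f i \<in> bar_chains P N j e"
  shows "sum f I \<in> bar_chains P N j e"
  using assms(2)
  by (induction I rule: infinite_finite_induct) (auto intro: bar_chains_add[OF assms(1)])

lemma bar_chains_prepend:
  assumes N: "graded_submodule P act N" and u: "u \<in> P" and z: "z \<in> bar_chains P N j (e - fst u)"
  shows "prepend u z \<in> bar_chains P N (Suc j) e"
  unfolding prepend_def lin_def
proof (intro bar_chains_sum[OF N] bar_chains_single)
  fix l assume l: "l \<in> keys z"
  then show "length (u # l) = Suc j" "set (u # l) \<subseteq> P" using z u by (auto simp: bar_chains_def)
  show "lookup z l \<in> N (e - fst (sum_list (u # l)))"
    using z l by (auto simp: bar_chains_def algebra_simps)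
qed

lemma bar_chains_mono:
  "z \<in> bar_chains P N j e \<Longrightarrow> (\<And>c. N c \<subseteq> N' c) \<Longrightarrow> z \<in> bar_chains P N' j e"
  unfolding bar_chains_def by blast

context bar
begin

lemma merge_word_chains:
  assumes N: "graded_submodule P act N"
  shows "length l = Suc j \<Longrightarrow> set l \<subseteq> P \<Longrightarrow> b \<in> N (e - fst (sum_list l)) \<Longrightarrow>
    merge_word l b \<in> bar_chains P N j e"
proof (induction l arbitrary: j e rule: induct_list012)
  case (3 u v l)
  then obtain j' where j: "j = Suc j'" by (cases j) auto
  show ?case unfolding merge_word.simps
  proof (rule bar_chains_diff[OF N])
    show "single ((u + v) # l) b \<in> bar_chains P N j e"
      using 3 by (intro bar_chains_single) (auto simp: P_add add.assoc)
    show "prepend u (merge_word (v # l) b) \<in> bar_chains P N j e"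
      unfolding j using 3(3-) j
      by (intro bar_chains_prepend[OF N] 3(2)) (auto simp: algebra_simps)
  qed
qed auto

lemma bar_diff_chains:
  assumes N: "graded_submodule P act N" and z: "z \<in> bar_chains P N (Suc j) e"
  shows "bar_diff act z \<in> bar_chains P N j e"
  unfolding bar_diff_def lin_def
proof (intro bar_chains_sum[OF N])
  fix l assume l: "l \<in> keys z"
  then obtain u l' where u: "l = u # l'" using z by (cases l) (auto simp: bar_chains_def)
  let ?b = "lookup z l"
  have *: "length l = Suc j" "set l \<subseteq> P" "?b \<in> N (e - fst (sum_list l))"
    using z l by (auto simp: bar_chains_def)
  have "act u ?b \<in> N (e - fst (sum_list l) + fst u)"
    using * u by (intro graded_submodule_act[OF N]) auto
  then have "single l' (act u ?b) \<in> bar_chains P N j e"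
    using * u by (intro bar_chains_single) (auto simp: algebra_simps)
  then show "bar_word act l ?b \<in> bar_chains P N j e"
    unfolding bar_word_def u
    using merge_word_chains[OF N *] u by (simp add: bar_chains_diff[OF N])
qed

end

lemma bar_diff_cmap:
  assumes "bar P act" "bar P' act'" "additive f" "\<And>g x. f (act g x) = act' g (f x)"
  shows "bar_diff act' (cmap f z) = cmap f (bar_diff act z)"
proof (rule additive_eqI[where z = z])
  interpret b: bar P act by fact
  interpret b': bar P' act' by fact
  show "additive (\<lambda>z. bar_diff act' (cmap f z))" "additive (\<lambda>z. cmap f (bar_diff act z))"
    by (intro additive_comp[OF b'.additive_bar_diff] additive_comp[OF additive_cmap]
        additive_cmap b.additive_bar_diff assms)+
  fix l b
  show "bar_diff act' (cmap f (single l b)) =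
    cmap f (bar_diff act (single l b))"
    by (simp add: cmap_single assms b.bar_diff_single b'.bar_diff_single bar_word_def
        additive.zero[OF additive_cmap[OF assms(3)]]
        additive.diff[OF additive_cmap[OF assms(3)]] b.cmap_merge_word split: list.split)
qed

lemma bar_chains_cmap:
  assumes "additive f" "z \<in> bar_chains P N j e" "\<And>c x. x \<in> N c \<Longrightarrow> f x \<in> N' c"
  shows "cmap f z \<in> bar_chains P N' j e"
proof -
  have "l \<in> keys z" if "l \<in> keys (cmap f z)" for l
    using that by (auto simp: in_keys_iff lookup_cmap[OF assms(1)] additive.zero[OF assms(1)])
  then show ?thesis
    using assms by (auto simp: bar_chains_def lookup_cmap)
qed

text \<open>
  A chain can be lifted along any relation that can be solved for each coefficient.  Unlike the image
  under \<open>cmap\<close>, the lift need not depend on the chain in an additive way.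
\<close>

lemma bar_chains_choice:
  assumes z: "z \<in> bar_chains P N j e"
    and ex: "\<And>c x. x \<in> N c \<Longrightarrow> \<exists>y\<in>N' c. R c x y"
    and R0: "\<And>c. R c 0 0"
  obtains y where "y \<in> bar_chains P N' j e"
    "\<And>l. R (e - fst (sum_list l)) (lookup z l) (lookup y l)"
    "keys y \<subseteq> keys z"
proof -
  have "\<exists>y. \<forall>l\<in>keys z. y l \<in> N' (e - fst (sum_list l)) \<and>
      R (e - fst (sum_list l)) (lookup z l) (y l)"
    using z ex unfolding bar_chains_def by (intro bchoice) blast
  then obtain y where y: "\<forall>l\<in>keys z. y l \<in> N' (e - fst (sum_list l)) \<and>
      R (e - fst (sum_list l)) (lookup z l) (y l)"
    by blast
  obtain p where p: "\<And>l. lookup p l = (if l \<in> keys z then y l else 0)"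
    using exists_poly_mapping[OF finite_keys[of z]] by metis
  have keys: "keys p \<subseteq> keys z" by (auto simp: in_keys_iff p split: if_splits)
  show ?thesis
  proof (rule that[of p])
    show "p \<in> bar_chains P N' j e" using keys z y by (auto simp: bar_chains_def p)
    show "R (e - fst (sum_list l)) (lookup z l) (lookup p l)" for l
      using y R0 by (auto simp: p in_keys_iff)
    show "keys p \<subseteq> keys z" by (rule keys)
  qed
qed

lemma (in bar) bar_diff_chains_0:
  assumes "z \<in> bar_chains P N 0 e"
  shows "bar_diff act z = 0"
  using assms unfolding bar_diff_def lin_def bar_chains_def bar_word_def
  by (auto intro!: sum.neutral)

lemma keys_cmap: "additive f \<Longrightarrow> keys (cmap f z) \<subseteq> keys z"
  by (auto simp: in_keys_iff lookup_cmap additive.zero)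

lemma bar_chains_subkeysI:
  assumes "z \<in> bar_chains P N j e" "keys w \<subseteq> keys z"
    and "\<And>l. lookup w l \<in> N' (e - fst (sum_list l))"
  shows "w \<in> bar_chains P N' j e"
  using assms unfolding bar_chains_def by blast

lemma (in bar) bar_exact_trivial:
  assumes "\<And>c. N c \<subseteq> {0}"
  shows "bar_exact P act N j e"
proof -
  have "z = 0" if "z \<in> bar_chains P N j e" for z
  proof (rule poly_mapping_eqI, rule ccontr)
    fix l assume "lookup z l \<noteq> lookup 0 l"
    then have "l \<in> keys z" by (simp add: in_keys_iff)
    then show False using that assms[of "e - fst (sum_list l)"] by (auto simp: bar_chains_def in_keys_iff)
  qed
  then show ?thesis
    unfolding bar_exact_def by (metis additive.zero bar_chains_zero image_eqI additive_bar_diff)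
qed

section \<open>Mayer-Vietoris sequences and dimension shifting\<close>

text \<open>
  The Mayer-Vietoris sequence for \<open>N = N\<^sub>1 + N\<^sub>2\<close>.
\<close>

lemma (in bar) bar_exact_plus:
  assumes N1: "graded_submodule P act N1" and N2: "graded_submodule P act N2"
    and N: "graded_submodule P act N"
    and sub: "\<And>c. N1 c \<subseteq> N c" "\<And>c. N2 c \<subseteq> N c"
    and split: "\<And>c x. x \<in> N c \<Longrightarrow> \<exists>y\<in>N1 c. x - y \<in> N2 c"
    and ex: "bar_exact P act N1 i e" "bar_exact P act N2 i e"
    and ex_Int: "\<And>k. i = Suc k \<Longrightarrow> bar_exact P act (\<lambda>c. N1 c \<inter> N2 c) k e"
  shows "bar_exact P act N i e"
  unfolding bar_exact_def
proof (intro ballI impI)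
  fix z assume z: "z \<in> bar_chains P N i e" and dz: "bar_diff act z = 0"
  obtain z1 where z1: "z1 \<in> bar_chains P N1 i e"
    "\<And>l. lookup z l - lookup z1 l \<in> N2 (e - fst (sum_list l))"
    "keys z1 \<subseteq> keys z"
    by (rule bar_chains_choice[OF z, of N1 "\<lambda>c x y. x - y \<in> N2 c"])
      (auto simp: split graded_submodule_zero[OF N2])
  define z2 where "z2 = z - z1"
  have z2: "z2 \<in> bar_chains P N2 i e"
  proof (rule bar_chains_subkeysI[OF z])
    show "keys z2 \<subseteq> keys z"
      using z1(3) keys_minus_subset[of z z1] unfolding z2_def by blast
  qed (simp add: z2_def lookup_minus z1(2))
  \<comment> \<open>The two halves of the cycle have opposite boundaries, which lie in the intersection.\<close>
  have d12: "bar_diff act z1 = - bar_diff act z2"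
    using dz unfolding z2_def by (simp add: additive.diff[OF additive_bar_diff])
  have "\<exists>w. w \<in> bar_chains P N1 i e \<and> w \<in> bar_chains P N2 i e \<and> bar_diff act w = bar_diff act z1"
  proof (cases i)
    case 0
    then have "bar_diff act z1 = 0" using z1(1) by (auto intro: bar_diff_chains_0)
    then show ?thesis by (intro exI[of _ 0]) (auto simp: additive.zero[OF additive_bar_diff])
  next
    case (Suc k)
    have "bar_diff act z1 \<in> bar_chains P N1 k e"
      using bar_diff_chains[OF N1] z1(1) Suc by blast
    moreover have "bar_diff act z1 \<in> bar_chains P N2 k e"
      using bar_chains_uminus[OF N2 bar_diff_chains[OF N2]] z2 Suc d12 by simp
    ultimately have *: "bar_diff act z1 \<in> bar_chains P (\<lambda>c. N1 c \<inter> N2 c) k e"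
      unfolding bar_chains_def by blast
    then obtain w where "w \<in> bar_chains P (\<lambda>c. N1 c \<inter> N2 c) i e" "bar_diff act w = bar_diff act z1"
      using bar_exactD[OF ex_Int[OF Suc] * bar_diff_bar_diff] Suc by auto
    then show ?thesis unfolding bar_chains_def by blast
  qed
  then obtain w where w: "w \<in> bar_chains P N1 i e" "w \<in> bar_chains P N2 i e"
    "bar_diff act w = bar_diff act z1" by blast
  obtain y1 where y1: "y1 \<in> bar_chains P N1 (Suc i) e" "bar_diff act y1 = z1 - w"
    using bar_exactD[OF ex(1), of "z1 - w"] bar_chains_diff[OF N1 z1(1) w(1)] w(3)
    by (auto simp: additive.diff[OF additive_bar_diff])
  obtain y2 where y2: "y2 \<in> bar_chains P N2 (Suc i) e" "bar_diff act y2 = z2 + w"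
    using bar_exactD[OF ex(2), of "z2 + w"] bar_chains_add[OF N2 z2 w(2)] w(3) d12
    by (auto simp: additive.add[OF additive_bar_diff])
  have "y1 + y2 \<in> bar_chains P N (Suc i) e"
    by (intro bar_chains_add[OF N] bar_chains_mono[OF y1(1) sub(1)] bar_chains_mono[OF y2(1) sub(2)])
  moreover have "bar_diff act (y1 + y2) = z"
    by (simp add: additive.add[OF additive_bar_diff] y1 y2 z2_def)
  ultimately show "z \<in> bar_diff act ` bar_chains P N (Suc i) e" by blast
qed

text \<open>
  Dimension shifting, relative to a submodule \<open>J\<close> of the target.  Let \<open>f\<close> map \<open>F\<close> onto \<open>C\<close> modulo \<open>J\<close>,
  and let \<open>Z\<close> be the preimage of \<open>J\<close>.  A cycle of \<open>Z\<close> that bounds in \<open>F\<close> then bounds in \<open>Z\<close>,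
  if the homology of \<open>J\<close> in the same degree and that of \<open>C\<close> in the next degree vanish.  For \<open>J = 0\<close>
  this is the connecting map of \<open>0 \<rightarrow> Z \<rightarrow> F \<rightarrow> C \<rightarrow> 0\<close>; for \<open>C = A\<close> it compares \<open>Z\<close> with the ideal
  \<open>J\<close> and avoids the quotient by \<open>J\<close>.
\<close>

lemma lift_boundary:
  fixes f :: "'b::ab_group_add \<Rightarrow> 'c::ab_group_add"
  assumes "bar P act" "bar P act'"
    and f: "additive f" "\<And>g x. f (act g x) = act' g (f x)" "\<And>c x. x \<in> F c \<Longrightarrow> f x \<in> C c"
    and F: "graded_submodule P act F"
    and C: "graded_submodule P act' C" and J: "graded_submodule P act' J" "\<And>c. J c \<subseteq> C c"
    and surj: "\<And>c x. x \<in> C c \<Longrightarrow> \<exists>y\<in>F c. x - f y \<in> J c"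
    and exJ: "bar_exact P act' J j e" and exC: "bar_exact P act' C (Suc j) e"
    and w: "w \<in> bar_chains P F (Suc j) e"
    and z: "bar_diff act w \<in> bar_chains P (\<lambda>c. {v\<in>F c. f v \<in> J c}) j e"
  shows "\<exists>w'\<in>bar_chains P (\<lambda>c. {v\<in>F c. f v \<in> J c}) (Suc j) e. bar_diff act w' = bar_diff act w"
proof -
  interpret b: bar P act by fact
  interpret b': bar P act' by fact
  have nat: "bar_diff act' (cmap f u) = cmap f (bar_diff act u)" for u
    by (rule bar_diff_cmap) (fact assms f)+
  have "cmap f (bar_diff act w) \<in> bar_chains P J j e"
    using z by (rule bar_chains_cmap[OF f(1)]) auto
  moreover have "bar_diff act' (cmap f (bar_diff act w)) = 0"
    by (simp add: nat b.bar_diff_bar_diff additive.zero[OF additive_cmap[OF f(1)]])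
  ultimately obtain g where g: "g \<in> bar_chains P J (Suc j) e" "bar_diff act' g = cmap f (bar_diff act w)"
    by (rule bar_exactD[OF exJ])
  \<comment> \<open>The image of \<open>w\<close> need not lie in \<open>J\<close>; it differs by a cycle of \<open>C\<close> from a chain of \<open>J\<close>, and this cycle
    is a boundary, which can be lifted to \<open>F\<close> up to \<open>J\<close>.\<close>
  have "cmap f w - g \<in> bar_chains P C (Suc j) e"
    using bar_chains_cmap[OF f(1) w f(3)] bar_chains_mono[OF g(1) J(2)] by (intro bar_chains_diff[OF C])
  moreover have "bar_diff act' (cmap f w - g) = 0"
    by (simp add: additive.diff[OF b'.additive_bar_diff] nat g)
  ultimately obtain y where y: "y \<in> bar_chains P C (Suc (Suc j)) e" "bar_diff act' y = cmap f w - g"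
    by (rule bar_exactD[OF exC])
  obtain y' where y': "y' \<in> bar_chains P F (Suc (Suc j)) e"
    "\<And>l. lookup y l - f (lookup y' l) \<in> J (e - fst (sum_list l))"
    "keys y' \<subseteq> keys y"
    by (rule bar_chains_choice[OF y(1), of F "\<lambda>c x v. x - f v \<in> J c"])
      (auto simp: surj graded_submodule_zero[OF J(1)] additive.zero[OF f(1)])
  have y'': "y - cmap f y' \<in> bar_chains P J (Suc (Suc j)) e"
  proof (rule bar_chains_subkeysI[OF y(1)])
    show "keys (y - cmap f y') \<subseteq> keys y"
      using y'(3) keys_cmap[OF f(1), of y'] keys_minus_subset[of y "cmap f y'"] by blast
  qed (simp add: lookup_minus lookup_cmap[OF f(1)] y'(2))
  define w' where "w' = w - bar_diff act y'"
  have w'F: "w' \<in> bar_chains P F (Suc j) e"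
    unfolding w'_def using w y'(1) by (intro bar_chains_diff[OF F] b.bar_diff_chains[OF F])
  have "cmap f w' = g + bar_diff act' (y - cmap f y')"
    unfolding w'_def
    by (simp add: additive.diff[OF b'.additive_bar_diff] additive.diff[OF additive_cmap[OF f(1)]]
        nat y)
  then have fw': "cmap f w' \<in> bar_chains P J (Suc j) e"
    using g(1) y'' by (auto intro!: bar_chains_add[OF J(1)] b'.bar_diff_chains[OF J(1)])
  have "f (lookup w' l) \<in> J (e - fst (sum_list l))" for l
    using bar_chains_lookup[OF J(1) fw', of l] by (simp add: lookup_cmap[OF f(1)])
  then have "w' \<in> bar_chains P (\<lambda>c. {v\<in>F c. f v \<in> J c}) (Suc j) e"
    using w'F unfolding bar_chains_def by auto
  moreover have "bar_diff act w' = bar_diff act w"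
    unfolding w'_def by (simp add: additive.diff[OF b.additive_bar_diff] b.bar_diff_bar_diff)
  ultimately show ?thesis by blast
qed

section \<open>Veronese algebras\<close>

lemma lookup_vsmult [simp]:
  "lookup (vsmult c v) i = c * lookup v i"
  by (simp add: vsmult_def Poly_Mapping.map.rep_eq when_def)

lemma vsmult_add: "vsmult c (v + w) = vsmult c v + vsmult c w"
  and vsmult_add_left: "vsmult (c + d) v = vsmult c v + vsmult d v"
  and vsmult_vsmult: "vsmult c (vsmult d v) = vsmult (c * d) v"
  and vsmult_one: "vsmult 1 v = v"
  and vsmult_zero [simp]: "vsmult c 0 = 0" "vsmult 0 v = 0"
  by (auto intro!: poly_mapping_eqI simp: lookup_add algebra_simps)

lemma vsmult_sum: "vsmult c (sum f I) = (\<Sum>i\<in>I. vsmult c (f i))"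
  by (rule poly_mapping_eqI) (simp add: lookup_sum sum_distrib_left)

lemma vsmult_sum_left: "vsmult (sum f I) v = (\<Sum>i\<in>I. vsmult (f i) v)"
  by (rule poly_mapping_eqI) (simp add: lookup_sum sum_distrib_right)

type_synonym 'k vec = "nat \<Rightarrow>\<^sub>0 'k pol"

abbreviation vars :: "nat \<Rightarrow> nat \<Rightarrow> (nat + nat) set" where
  "vars n m \<equiv> Inl ` {..<n} \<union> Inr ` {..<m}"

abbreviation monom :: "mon \<Rightarrow> 'k::zero_neq_one pol" where
  "monom u \<equiv> single u 1"

lemma bidegree_add: "bidegree n m (\<mu> + \<nu>) = bidegree n m \<mu> + bidegree n m \<nu>"
  by (simp add: bidegree_def lookup_add sum.distrib)

lemma bidegree_zero [simp]: "bidegree n m 0 = 0"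
  by (simp add: bidegree_def zero_prod_def)

lemma bidegree_nonneg: "0 \<le> fst (bidegree n m \<mu>)" "0 \<le> snd (bidegree n m \<mu>)"
  by (simp_all add: bidegree_def sum_nonneg)

lemma bidegree_eq_0D:
  assumes "keys \<mu> \<subseteq> vars n m" "bidegree n m \<mu> = 0"
  shows "\<mu> = 0"
proof (rule poly_mapping_eqI)
  fix k
  have x: "lookup \<mu> (Inl i) = 0" if "i < n" for i
    using assms(2) that by (simp add: bidegree_def zero_prod_def flip: of_nat_sum)
  have y: "lookup \<mu> (Inr i) = 0" if "i < m" for i
    using assms(2) that by (simp add: bidegree_def zero_prod_def flip: of_nat_sum)
  have "k \<notin> keys \<mu>"
  proof
    assume k: "k \<in> keys \<mu>"
    with assms(1) have "k \<in> vars n m" by blast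
    then have "lookup \<mu> k = 0" using x y by auto
    with k show False by (simp add: in_keys_iff)
  qed
  then show "lookup \<mu> k = lookup 0 k"
    by (simp add: in_keys_iff)
qed

lemma keys_add_mon: "keys (\<mu> + \<nu> :: mon) = keys \<mu> \<union> keys \<nu>"
  by (auto simp: in_keys_iff lookup_add)

lemma lookup_monom_mult:
  fixes p :: "'k::comm_ring_1 pol"
  shows "lookup (single u k * p) (u + \<mu>) = k * lookup p \<mu>"
proof -
  have "single u k * p = (\<Sum>\<nu>\<in>keys p. single (u + \<nu>) (k * lookup p \<nu>))"
    by (subst (1) lin_single_id[of p, symmetric]) (simp add: lin_def sum_distrib_left mult_single)
  then show ?thesis
    by (auto simp: lookup_sum lookup_single when_def in_keys_iff)
qed

lemma keys_single_mult:
  fixes p :: "'k::comm_ring_1 pol"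
  shows "keys (single u k * p) \<subseteq> (+) u ` keys p"
  using keys_mult[of "single u k" p] by (auto split: if_splits)

definition act_pol :: "letter \<Rightarrow> 'k::field pol \<Rightarrow> 'k pol" where
  "act_pol g p = monom (snd g) * p"

definition act_vec :: "letter \<Rightarrow> 'k::field vec \<Rightarrow> 'k vec" where
  "act_vec g v = vsmult (monom (snd g)) v"

locale veronese =
  fixes n m s t :: nat
begin

text \<open>
  The monomial basis of \<open>A\<close>.  A basis element carries its index \<open>c\<close> in addition to the monomial,
  because for \<open>t = 0\<close> the same component of \<open>S\<close> occurs for all values of the second index.
\<close>

definition G :: "letter set" where
  "G = {(c, u). 0 \<le> fst c \<and> 0 \<le> snd c \<and> keys u \<subseteq> vars n m \<and>
          bidegree n m u = (fst c * int s, snd c * int t)}"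

definition P :: "letter set" where
  "P = G - {0}"

text \<open>
  The Veronese module of the span of the monomials in \<open>U\<close>; for \<open>U = UNIV\<close> it is \<open>A\<close> itself.
\<close>

definition mon_mod :: "mon set \<Rightarrow> bideg \<Rightarrow> 'k::field pol set" where
  "mon_mod U c = {p. \<forall>\<mu>\<in>keys p. (c, \<mu>) \<in> G \<and> \<mu> \<in> U}"

definition free :: "nat \<Rightarrow> (nat \<Rightarrow> bideg) \<Rightarrow> bideg \<Rightarrow> 'k::field vec set" where
  "free r d c = {v. keys v \<subseteq> {..<r} \<and> (\<forall>j<r. lookup v j \<in> mon_mod UNIV (c - d j))}"

abbreviation A :: "bideg \<Rightarrow> 'k::field pol set" where
  "A \<equiv> mon_mod UNIV"

lemma zero_in_G [simp]: "0 \<in> G"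
  by (simp add: G_def zero_prod_def bidegree_def)

lemma G_add: "g \<in> G \<Longrightarrow> h \<in> G \<Longrightarrow> g + h \<in> G"
  by (auto simp: G_def keys_add_mon bidegree_add algebra_simps)

lemma G_fst_zero: "g \<in> G \<Longrightarrow> fst g = 0 \<Longrightarrow> g = 0"
  using bidegree_eq_0D[of "snd g" n m] by (auto simp: G_def zero_prod_def)

lemma P_fst: "g \<in> P \<Longrightarrow> fst g \<noteq> 0"
  using G_fst_zero unfolding P_def by blast

lemma G_P_add: "g \<in> G \<Longrightarrow> h \<in> P \<Longrightarrow> g + h \<in> P"
proof -
  assume g: "g \<in> G" and h: "h \<in> P"
  have "fst (g + h) \<noteq> 0"
    using g h P_fst[OF h] by (cases "fst g"; cases "fst h") (auto simp: P_def G_def zero_prod_def)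
  then have "g + h \<noteq> 0" by (metis fst_zero)
  then show "g + h \<in> P" using G_add[of g h] g h by (simp add: P_def)
qed

lemma P_subset_G: "g \<in> P \<Longrightarrow> g \<in> G"
  by (simp add: P_def)

lemma G_fst: "g \<in> G \<Longrightarrow> 0 \<le> fst (fst g) \<and> 0 \<le> snd (fst g)"
  by (auto simp: G_def)

lemma in_P_iff: "g \<in> P \<longleftrightarrow> g \<in> G \<and> fst g \<noteq> 0"
  using P_fst[of g] unfolding P_def by (metis Diff_iff fst_zero singletonD)

sublocale pol: bar P act_pol
  by unfold_locales
    (simp_all add: act_pol_def G_P_add P_subset_G mult_single distrib_left flip: mult.assoc)

sublocale vec: bar P act_vec
  by unfold_locales
    (simp_all add: act_vec_def G_P_add P_subset_G mult_single vsmult_vsmult vsmult_add)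

lemma mon_mod_zero [simp]: "0 \<in> mon_mod U c"
  by (simp add: mon_mod_def)

lemma mon_mod_diff: "p \<in> mon_mod U c \<Longrightarrow> q \<in> mon_mod U c \<Longrightarrow> p - q \<in> mon_mod U c"
  using keys_minus_subset[of p q] by (auto simp: mon_mod_def)

lemma mon_mod_add: "p \<in> mon_mod U c \<Longrightarrow> q \<in> mon_mod U c \<Longrightarrow> p + q \<in> mon_mod U c"
  using Poly_Mapping.keys_add[of p q] by (auto simp: mon_mod_def)

lemma mon_mod_sum: "(\<And>i. i \<in> I \<Longrightarrow> f i \<in> mon_mod U c) \<Longrightarrow> sum f I \<in> mon_mod U c"
  by (induction I rule: infinite_finite_induct) (auto intro: mon_mod_add)

lemma mon_mod_mult:
  assumes "a \<in> A c" "p \<in> mon_mod U d" "\<And>g \<mu>. g \<in> G \<Longrightarrow> \<mu> \<in> U \<Longrightarrow> snd g + \<mu> \<in> U"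
  shows "a * p \<in> mon_mod U (c + d)"
proof -
  have "(c + d, \<mu>) \<in> G \<and> \<mu> \<in> U" if \<mu>: "\<mu> \<in> keys (a * p)" for \<mu>
  proof -
    obtain \<alpha> \<beta> where \<alpha>: "\<alpha> \<in> keys a" "\<beta> \<in> keys p" "\<mu> = \<alpha> + \<beta>"
      using subsetD[OF keys_mult \<mu>] by blast
    then have "(c, \<alpha>) \<in> G" "(d, \<beta>) \<in> G" "\<beta> \<in> U" using assms by (auto simp: mon_mod_def)
    then show ?thesis using G_add[of "(c, \<alpha>)" "(d, \<beta>)"] assms(3)[of "(c, \<alpha>)" \<beta>] \<alpha>(3) by auto
  qed
  then show ?thesis by (simp add: mon_mod_def)
qed

lemma A_mult: "a \<in> A c \<Longrightarrow> p \<in> A d \<Longrightarrow> a * p \<in> A (c + d)"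
  by (rule mon_mod_mult) auto

lemma single_in_mon_mod: "(c, u) \<in> G \<Longrightarrow> u \<in> U \<Longrightarrow> single u k \<in> mon_mod U c"
  by (auto simp: mon_mod_def)

lemma single_in_mon_mod_iff: "k \<noteq> 0 \<Longrightarrow> single u k \<in> mon_mod U c \<longleftrightarrow> (c, u) \<in> G \<and> u \<in> U"
  by (auto simp: mon_mod_def)

lemma letter_in_A: "g \<in> G \<Longrightarrow> monom (snd g) \<in> A (fst g)"
  by (auto intro: single_in_mon_mod)

lemma graded_submodule_mon_mod:
  assumes "\<And>g \<mu>. g \<in> G \<Longrightarrow> \<mu> \<in> U \<Longrightarrow> snd g + \<mu> \<in> U"
  shows "graded_submodule P act_pol (mon_mod U)"
proof -
  have "act_pol g x \<in> mon_mod U (c + fst g)" if "g \<in> P" "x \<in> mon_mod U c" for g c and x :: "'k::field pol"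
    using mon_mod_mult[OF letter_in_A[OF P_subset_G[OF that(1)]] that(2) assms]
    by (simp add: act_pol_def add.commute)
  then show ?thesis
    unfolding graded_submodule_def using mon_mod_diff[of _ U] mon_mod_zero by blast
qed

end

section \<open>Free modules are acyclic\<close>

text \<open>
  All words in \<open>merge_word l b\<close> have the same product as \<open>l\<close>, so it suffices to compare the two maps
  on single words with that product.
\<close>

lemma merge_word_transfer:
  assumes "additive H" "additive K"
    and "\<And>l'. sum_list l' = sum_list l \<Longrightarrow> H (single l' b) = K (single l' b')"
  shows "H (merge_word l b) = K (merge_word l b')"
  using assms
proof (induction l arbitrary: H K rule: induct_list012)
  case (3 u v l)
  have "H (prepend u (merge_word (v # l) b)) = K (prepend u (merge_word (v # l) b'))"
    by (rule 3(2)) (auto simp: 3 additive_comp additive_prepend)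
  moreover have "H (single ((u + v) # l) b) = K (single ((u + v) # l) b')"
    by (rule 3) (simp add: add.assoc)
  ultimately show ?case by (simp add: additive.diff[OF 3(3)] additive.diff[OF 3(4)])
qed (simp_all add: additive.zero)

text \<open>
  The agreement is required only at the monomials that occur in \<open>z\<close>, because the contracting homotopy
  of the bar complex is correct only on chains of one bidegree.
\<close>

lemma additive_eqI_monomial:
  fixes z :: "'i \<Rightarrow>\<^sub>0 ('j \<Rightarrow>\<^sub>0 'k::ab_group_add)"
  assumes "additive f" "additive g"
    and "\<And>l u. l \<in> keys z \<Longrightarrow> u \<in> keys (lookup z l) \<Longrightarrow>
      f (single l (single u (lookup (lookup z l) u))) =
      g (single l (single u (lookup (lookup z l) u)))"
  shows "f z = g z"
proof -
  have z: "z = (\<Sum>l\<in>keys z. \<Sum>u\<in>keys (lookup z l).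
      single l (single u (lookup (lookup z l) u)))"
    (is "z = ?s")
  proof -
    have "?s = (\<Sum>l\<in>keys z. single l (lin single (lookup z l)))"
      by (simp add: lin_def additive.sum[OF additive_single])
    also have "\<dots> = lin single z" by (subst lin_single_id) (simp add: lin_def)
    finally show ?thesis by (simp add: lin_single_id)
  qed
  show ?thesis
    by (subst (1 2) z) (simp add: additive.sum[OF assms(1)] additive.sum[OF assms(2)] assms(3))
qed

context veronese
begin

text \<open>
  The contracting homotopy of the bar complex of \<open>A\<close>: it moves the coefficient monomial into the
  word, \<open>k u [l] \<mapsto> k [u|l]\<close>, and kills the unit.  The index of the new letter is not determined by
  the monomial \<open>u\<close>; it is recovered from the bidegree \<open>e\<close> of the chain.
\<close>

definition cone_word :: "bideg \<Rightarrow> letter list \<Rightarrow> 'k::field pol \<Rightarrow> (letter list \<Rightarrow>\<^sub>0 'k pol)" where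
  "cone_word e l = lin (\<lambda>u k. if (e - fst (sum_list l), u) \<in> P
     then single ((e - fst (sum_list l), u) # l) (single 0 k) else 0)"

definition cone :: "bideg \<Rightarrow> (letter list \<Rightarrow>\<^sub>0 'k::field pol) \<Rightarrow> (letter list \<Rightarrow>\<^sub>0 'k pol)" where
  "cone e = lin (cone_word e)"

lemma additive_cone_word: "additive (cone_word e l)"
  unfolding cone_word_def
  by (intro additive_lin) (simp add: additive_def single_add)

lemma additive_cone: "additive (cone e)"
  unfolding cone_def by (intro additive_lin additive_cone_word)

lemma cone_single:
  "cone e (single l (single u k)) =
    (if (e - fst (sum_list l), u) \<in> P
     then single ((e - fst (sum_list l), u) # l) (single 0 k) else 0)"
  unfolding cone_def
  by (simp add: lin_single additive.zero[OF additive_cone_word]) (simp add: cone_word_def lin_single)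

lemma act_pol_single: "act_pol g (single u k) = single (snd g + u) k"
  by (simp add: act_pol_def mult_single)

text \<open>
  Merging the letters of a word keeps its product, so the cone of \<open>merge_word\<close> is computed with the
  same new letter \<open>(c, u)\<close>.  If this letter is the unit, only the term survives in which the letter
  \<open>w\<close> acts on the coefficient and is moved back into the word.
\<close>

lemma cone_homotopy_single:
  assumes w: "w \<in> P" and g: "(e - fst (sum_list (w # l)), u) \<in> G"
  shows "bar_diff act_pol (cone e (single (w # l) (single u k))) +
    cone e (bar_diff act_pol (single (w # l) (single u k))) =
    single (w # l) (single u k)"
proof -
  define c where "c = e - fst (sum_list (w # l))"
  let ?b = "single u k" and ?one = "single (0 :: mon) k"
  let ?g = "(c, u)"
  have gG: "?g \<in> G" using g by (simp add: c_def)
  have gw: "?g + w \<in> P" by (rule G_P_add[OF gG w])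
  have "e - fst (sum_list l) = c + fst w" by (simp add: c_def)
  then have "(e - fst (sum_list l), snd w + u) = ?g + w"
    by (simp add: prod_eq_iff add.commute)
  then have 1: "cone e (single l (act_pol w ?b)) = single ((?g + w) # l) ?one"
    using gw by (simp only: act_pol_single cone_single if_True)
  have 2: "cone e (merge_word (w # l) ?b) = (if ?g \<in> P then prepend ?g (merge_word (w # l) ?one) else 0)"
  proof (cases "?g \<in> P")
    case True
    have "cone e (merge_word (w # l) ?b) = prepend ?g (merge_word (w # l) ?one)"
      by (rule merge_word_transfer[OF additive_cone additive_prepend])
        (use True in \<open>simp add: cone_single c_def\<close>)
    then show ?thesis using True by simp
  next
    case False
    have "cone e (merge_word (w # l) ?b) = (\<lambda>_. 0) (merge_word (w # l) ?one)"
      by (rule merge_word_transfer[OF additive_cone additive_0])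
        (use False in \<open>simp add: cone_single c_def\<close>)
    then show ?thesis using False by simp
  qed
  have 3: "cone e (single (w # l) ?b) =
      (if ?g \<in> P then single (?g # w # l) ?one else 0)"
    by (simp add: cone_single c_def)
  have 4: "u = 0" "?g + w = w" if "?g \<notin> P"
    using that gG by (auto simp: P_def zero_prod_def)
  show ?thesis
    using 1 2 4
    by (auto simp: pol.bar_diff_single bar_word_def additive.diff[OF additive_cone] 3 act_pol_single
        additive.zero[OF pol.additive_bar_diff])
qed

lemma graded_submodule_A_shift: "graded_submodule P act_pol (\<lambda>c. A (c - d) :: 'k::field pol set)"
proof -
  have *: "graded_submodule P act_pol (A :: bideg \<Rightarrow> 'k pol set)" by (rule graded_submodule_mon_mod) simp
  have "act_pol g x \<in> A (c + fst g - d)" if "g \<in> P" "x \<in> A (c - d)" for g c and x :: "'k pol"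
    using graded_submodule_act[OF * that] by (simp add: algebra_simps)
  then show ?thesis
    using graded_submodule_zero[OF *] graded_submodule_diff[OF *]
    unfolding graded_submodule_def by blast
qed

lemma cone_chains:
  assumes z: "z \<in> bar_chains P (\<lambda>c. A (c - d)) j e"
  shows "cone (e - d) z \<in> bar_chains P (\<lambda>c. A (c - d)) (Suc j) e"
  unfolding cone_def lin_def cone_word_def
proof (intro bar_chains_sum[OF graded_submodule_A_shift])
  fix l u assume l: "l \<in> keys z" and u: "u \<in> keys (lookup z l)"
  let ?c = "e - d - fst (sum_list l)"
  show "(if (?c, u) \<in> P then single ((?c, u) # l)
      (single 0 (lookup (lookup z l) u)) else 0)
    \<in> bar_chains P (\<lambda>c. A (c - d)) (Suc j) e"
  proof (cases "(?c, u) \<in> P")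
    case True
    have "(0 :: letter) \<in> G" by simp
    then have "single 0 k \<in> A 0" for k :: 'a
      by (intro single_in_mon_mod) (simp_all add: zero_prod_def)
    then show ?thesis using True l z by (auto simp: bar_chains_def)
  qed simp
qed

text \<open>
  The cone contracts the bar complex except at the unit coefficient of the empty word.  This exception
  sits in homological degree \<open>0\<close> and in the bidegree \<open>d\<close> of the generator.
\<close>

lemma bar_exact_A_shift:
  assumes "j > 0 \<or> e \<noteq> d"
  shows "bar_exact P act_pol (\<lambda>c. A (c - d) :: 'k::field pol set) j e"
  unfolding bar_exact_def
proof (intro ballI impI)
  fix z :: "letter list \<Rightarrow>\<^sub>0 'k pol"
  assume z: "z \<in> bar_chains P (\<lambda>c. A (c - d)) j e" and dz: "bar_diff act_pol z = 0"
  have "(\<lambda>z. bar_diff act_pol (cone (e - d) z) + cone (e - d) (bar_diff act_pol z)) z = (\<lambda>z. z) z"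
  proof (rule additive_eqI_monomial)
    show "additive (\<lambda>z. bar_diff act_pol (cone (e - d) z) + cone (e - d) (bar_diff act_pol z))"
      by (intro additive_plus additive_comp[OF pol.additive_bar_diff] additive_comp[OF additive_cone]
          additive_cone pol.additive_bar_diff)
    show "additive (\<lambda>z. z)" by (rule additive_id)
    fix l u assume l: "l \<in> keys z" and u: "u \<in> keys (lookup z l)"
    have *: "(e - d - fst (sum_list l), u) \<in> G"
      using z l u by (auto simp: bar_chains_def mon_mod_def algebra_simps)
    let ?k = "lookup (lookup z l) u"
    show "bar_diff act_pol (cone (e - d) (single l (single u ?k))) +
        cone (e - d) (bar_diff act_pol (single l (single u ?k))) =
        single l (single u ?k)"
    proof (cases l)
      case (Cons w l')
      then show ?thesis using * z l by (simp only: Cons, intro cone_homotopy_single) (auto simp: bar_chains_def)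
    next
      case Nil
      then have "j = 0" using z l by (auto simp: bar_chains_def)
      then have "(e - d, u) \<in> P" using * assms Nil by (auto simp: in_P_iff)
      then show ?thesis
        by (simp add: Nil cone_single pol.bar_diff_single bar_word_def act_pol_single
            additive.zero[OF additive_cone])
    qed
  qed
  then have "bar_diff act_pol (cone (e - d) z) = z"
    by (simp add: dz additive.zero[OF additive_cone])
  then show "z \<in> bar_diff act_pol ` bar_chains P (\<lambda>c. A (c - d)) (Suc j) e"
    using cone_chains[OF z] by (metis imageI)
qed

lemma graded_submodule_free: "graded_submodule P act_vec (free r d)"
proof -
  have *: "graded_submodule P act_pol (\<lambda>c. A (c - d j) :: 'k::field pol set)" for j
    by (rule graded_submodule_A_shift)
  have "v - w \<in> free r d c" if "v \<in> free r d c" "w \<in> free r d c" for v w :: "'k::field vec" and c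
    using that subset_trans[OF keys_minus_subset[of v w]] by (simp add: free_def lookup_minus mon_mod_diff)
  moreover have "act_vec g v \<in> free r d (c + fst g)" if "g \<in> P" "v \<in> free r d c"
    for g c and v :: "'k::field vec"
  proof -
    have "keys (act_vec g v) \<subseteq> keys v"
      by (auto simp: act_vec_def in_keys_iff)
    moreover have "lookup (act_vec g v) i \<in> A (c + fst g - d i)" if "i < r" for i
      using graded_submodule_act[OF * \<open>g \<in> P\<close>, of "lookup v i" c i] \<open>v \<in> free r d c\<close> that
      by (simp add: free_def act_vec_def act_pol_def)
    ultimately show ?thesis
      using that(2) by (auto simp: free_def)
  qed
  moreover have "0 \<in> free r d c" for c by (simp add: free_def)
  ultimately show ?thesis unfolding graded_submodule_def by blast
qed

lemma additive_lookup: "additive (\<lambda>v. lookup v i)"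
  by unfold_locales (simp add: lookup_add)

text \<open>
  The bar complex of a free module is the direct sum of those of its coordinates.
\<close>

lemma bar_exact_free:
  assumes "j > 0"
  shows "bar_exact P act_vec (free r d :: bideg \<Rightarrow> 'k::field vec set) j e"
  unfolding bar_exact_def
proof (intro ballI impI)
  fix z :: "letter list \<Rightarrow>\<^sub>0 'k vec"
  assume z: "z \<in> bar_chains P (free r d) j e" and dz: "bar_diff act_vec z = 0"
  have "\<exists>y\<in>bar_chains P (\<lambda>c. A (c - d i)) (Suc j) e. bar_diff act_pol y = cmap (\<lambda>v. lookup v i) z"
    if "i < r" for i
  proof -
    have "cmap (\<lambda>v. lookup v i) z \<in> bar_chains P (\<lambda>c. A (c - d i)) j e"
      by (rule bar_chains_cmap[OF additive_lookup z]) (use that in \<open>auto simp: free_def\<close>)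
    moreover have "bar_diff act_pol (cmap (\<lambda>v. lookup v i) z) =
        cmap (\<lambda>v. lookup v i) (bar_diff act_vec z)"
      by (rule bar_diff_cmap[OF vec.bar_axioms pol.bar_axioms additive_lookup])
        (simp add: act_vec_def act_pol_def)
    ultimately obtain y where "y \<in> bar_chains P (\<lambda>c. A (c - d i)) (Suc j) e"
      "bar_diff act_pol y = cmap (\<lambda>v. lookup v i) z"
      using bar_exactD[OF bar_exact_A_shift[of j e "d i"]] assms
      by (auto simp: dz additive.zero[OF additive_cmap[OF additive_lookup]])
    then show ?thesis by blast
  qed
  then obtain y where y: "\<And>i. i < r \<Longrightarrow> y i \<in> bar_chains P (\<lambda>c. A (c - d i)) (Suc j) e"
    "\<And>i. i < r \<Longrightarrow> bar_diff act_pol (y i) = cmap (\<lambda>v. lookup v i) z"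
    by metis
  define Y where "Y = (\<Sum>i<r. cmap (single i) (y i))"
  have nat: "bar_diff act_vec (cmap (single i) u) = cmap (single i) (bar_diff act_pol u)"
    for i and u :: "letter list \<Rightarrow>\<^sub>0 'k pol"
    by (rule bar_diff_cmap[OF pol.bar_axioms vec.bar_axioms additive_single])
      (auto intro!: poly_mapping_eqI simp: act_vec_def act_pol_def lookup_single when_def)
  have "Y \<in> bar_chains P (free r d) (Suc j) e"
    unfolding Y_def
  proof (intro bar_chains_sum[OF graded_submodule_free])
    fix i assume i: "i \<in> {..<r}"
    then show "cmap (single i) (y i) \<in> bar_chains P (free r d) (Suc j) e"
      by (intro bar_chains_cmap[OF additive_single y(1)])
        (auto simp: free_def lookup_single when_def split: if_splits)
  qed
  moreover have "bar_diff act_vec Y = z"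
  proof -
    have "bar_diff act_vec Y = (\<Sum>i<r. cmap (single i) (cmap (\<lambda>v. lookup v i) z))"
      unfolding Y_def by (simp add: additive.sum[OF vec.additive_bar_diff] nat y)
    also have "\<dots> = z"
    proof (rule poly_mapping_eqI, rule poly_mapping_eqI)
      fix l k
      have "lookup z l \<in> free r d (e - fst (sum_list l))"
        by (rule bar_chains_lookup[OF graded_submodule_free z])
      then have "k \<ge> r \<Longrightarrow> lookup (lookup z l) k = 0"
        by (force simp: free_def in_keys_iff)
      then show "lookup (lookup (\<Sum>i<r. cmap (single i)
          (cmap (\<lambda>v. lookup v i) z)) l) k = lookup (lookup z l) k"
        by (auto simp: lookup_sum lookup_cmap additive_single additive_lookup lookup_single when_def)
    qed
    finally show ?thesis .
  qed
  ultimately show "z \<in> bar_diff act_vec ` bar_chains P (free r d) (Suc j) e" by blast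
qed

section \<open>Unions of monomial ideals\<close>

definition mon_ideal :: "mon set \<Rightarrow> bool" where
  "mon_ideal U \<longleftrightarrow> (\<forall>\<mu>\<in>U. \<forall>\<rho>. keys \<rho> \<subseteq> vars n m \<longrightarrow> \<rho> + \<mu> \<in> U)"

lemma graded_submodule_mon_ideal:
  "mon_ideal U \<Longrightarrow> graded_submodule P act_pol (mon_mod U)"
  by (rule graded_submodule_mon_mod) (auto simp: mon_ideal_def G_def)

lemma mon_mod_Int: "mon_mod (U \<inter> V) = (\<lambda>c. mon_mod U c \<inter> mon_mod V c)"
  by (auto simp: mon_mod_def)

lemma mon_mod_mono: "U \<subseteq> V \<Longrightarrow> mon_mod U c \<subseteq> mon_mod V c"
  by (auto simp: mon_mod_def)

lemma mon_mod_Un_split: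
  assumes "p \<in> mon_mod (U \<union> V) c"
  shows "\<exists>q\<in>mon_mod U c. p - q \<in> mon_mod V c"
proof -
  obtain q where q: "\<And>\<mu>. lookup q \<mu> =
      (if \<mu> \<in> keys p \<inter> U then lookup p \<mu> else 0)"
    using exists_poly_mapping[of "keys p \<inter> U" "lookup p"] by auto
  show ?thesis
    using assms by (intro bexI[of _ q]) (auto simp: mon_mod_def in_keys_iff lookup_minus q split: if_splits)
qed

text \<open>
  Iterated Mayer-Vietoris: one ideal is split off, and the induction hypothesis is applied to the
  other ideals and to their intersections with it.  Each intersection costs one homological degree.
\<close>

lemma bar_exact_UN:
  assumes "finite I"
    and "\<And>i. i \<in> I \<Longrightarrow> mon_ideal (V i)"
    and "\<And>T. T \<subseteq> I \<Longrightarrow> T \<noteq> {} \<Longrightarrow> card T \<le> Suc j \<Longrightarrow>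
      bar_exact P act_pol (mon_mod (\<Inter>i\<in>T. V i) :: bideg \<Rightarrow> 'k::field pol set) (Suc j - card T) e"
  shows "bar_exact P act_pol (mon_mod (\<Union>i\<in>I. V i) :: bideg \<Rightarrow> 'k pol set) j e"
  using assms
proof (induction I arbitrary: V j rule: finite_induct)
  case empty
  show ?case by (rule pol.bar_exact_trivial) (auto simp: mon_mod_def in_keys_iff intro!: poly_mapping_eqI)
next
  case (insert x F)
  have id: "mon_ideal (V i)" if "i \<in> insert x F" for i using insert.prems that by blast
  let ?U = "\<Union>i\<in>F. V i"
  have U: "mon_ideal ?U" using id unfolding mon_ideal_def by blast
  have "bar_exact P act_pol (mon_mod (?U \<union> V x) :: bideg \<Rightarrow> 'k pol set) j e"
  proof (rule pol.bar_exact_plus[of "mon_mod ?U" "mon_mod (V x)"])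
    show "graded_submodule P act_pol (mon_mod ?U)" "graded_submodule P act_pol (mon_mod (V x))"
      "graded_submodule P act_pol (mon_mod (?U \<union> V x))"
      using U id[of x] by (auto intro!: graded_submodule_mon_ideal simp: mon_ideal_def)
    show "mon_mod ?U c \<subseteq> mon_mod (?U \<union> V x) c" "mon_mod (V x) c \<subseteq> mon_mod (?U \<union> V x) c" for c
      by (auto intro: mon_mod_mono[THEN subsetD, rotated])
    show "\<And>c p. p \<in> mon_mod (?U \<union> V x) c \<Longrightarrow> \<exists>q\<in>mon_mod ?U c. p - q \<in> mon_mod (V x) c"
      by (rule mon_mod_Un_split)
    show "bar_exact P act_pol (mon_mod ?U :: bideg \<Rightarrow> 'k pol set) j e"
      using insert.prems by (intro insert.IH) auto
    show "bar_exact P act_pol (mon_mod (V x) :: bideg \<Rightarrow> 'k pol set) j e"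
      using insert.prems(2)[of "{x}"] by auto
    fix k assume k: "j = Suc k"
    have "bar_exact P act_pol (mon_mod (\<Union>i\<in>F. V i \<inter> V x) :: bideg \<Rightarrow> 'k pol set) k e"
    proof (rule insert.IH)
      show "mon_ideal (V i \<inter> V x)" if "i \<in> F" for i
        using id[of i] id[of x] that by (auto simp: mon_ideal_def)
      fix T assume T: "T \<subseteq> F" "T \<noteq> {}" "card T \<le> Suc k"
      have "x \<notin> T" "finite T" using T insert.hyps finite_subset by auto
      then have "card (insert x T) = Suc (card T)" by simp
      moreover have "(\<Inter>i\<in>insert x T. V i) = (\<Inter>i\<in>T. V i \<inter> V x)" using T(2) by auto
      ultimately show "bar_exact P act_pol (mon_mod (\<Inter>i\<in>T. V i \<inter> V x) :: bideg \<Rightarrow> 'k pol set) (Suc k - card T) e"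
        using insert.prems(2)[of "insert x T"] T k by auto
    qed
    moreover have "(\<Union>i\<in>F. V i \<inter> V x) = ?U \<inter> V x" by blast
    ultimately show "bar_exact P act_pol (\<lambda>c. mon_mod ?U c \<inter> mon_mod (V x) c :: 'k pol set) k e"
      by (simp add: mon_mod_Int)
  qed
  moreover have "(\<Union>i\<in>insert x F. V i) = ?U \<union> V x" by blast
  ultimately show ?case by metis
qed

end

section \<open>Principal monomial ideals\<close>

text \<open>
  The value \<open>0\<close> for \<open>s = 0\<close> fits the bounds below: then \<open>A\<close> contains no monomials of positive degree in
  this direction, and a monomial of degree \<open>0\<close> generates a module that starts at index \<open>0\<close>.
\<close>

definition ceil_div :: "nat \<Rightarrow> nat \<Rightarrow> nat" where
  "ceil_div a s = (a + s - 1) div s"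

lemma ceil_div_le_iff: "s > 0 \<Longrightarrow> ceil_div a s \<le> q \<longleftrightarrow> a \<le> q * s"
proof -
  assume s: "s > 0"
  have "ceil_div a s \<le> q \<longleftrightarrow> (a + s - 1) div s < Suc q" by (simp add: ceil_div_def less_Suc_eq_le)
  also have "\<dots> \<longleftrightarrow> a + s - 1 < Suc q * s" using s by (simp add: div_less_iff_less_mult)
  also have "\<dots> \<longleftrightarrow> a \<le> q * s" using s by auto
  finally show ?thesis .
qed

lemma ceil_div_zero_right [simp]: "ceil_div a 0 = 0"
  by (simp add: ceil_div_def)

lemma ceil_div_mult_ge: "s > 0 \<Longrightarrow> a \<le> ceil_div a s * s"
  using ceil_div_le_iff by blast

lemma ceil_div_dvd: "s dvd a \<Longrightarrow> ceil_div a s * s = a"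
proof (cases "s > 0")
  case True
  moreover assume "s dvd a"
  then obtain k where k: "a = s * k" by (rule dvdE)
  then have "ceil_div a s \<le> k" using ceil_div_le_iff[OF True, of a k] by (simp add: mult.commute)
  then have "ceil_div a s * s \<le> a" by (simp add: k mult.commute)
  then show ?thesis using ceil_div_mult_ge[OF True, of a] by simp
qed auto

text \<open>
  The next multiple of \<open>s\<close> is reached with the first unit that is added, so \<open>k\<close> units raise the
  rounded quotient by at most \<open>k - 1\<close>.
\<close>

lemma ceil_div_add_le:
  assumes "s > 0" "\<not> s dvd a" "k \<ge> 1"
  shows "ceil_div (a + k) s \<le> ceil_div a s + (k - 1)"
proof -
  have "a \<noteq> ceil_div a s * s" using assms(2) by (metis dvd_triv_right)
  then have "a < ceil_div a s * s" using ceil_div_mult_ge[OF assms(1), of a] by simp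
  moreover have "k - 1 \<le> (k - 1) * s" using assms(1) by simp
  ultimately have "a + k \<le> (ceil_div a s + (k - 1)) * s"
    using assms(3) unfolding add_mult_distrib by linarith
  then show ?thesis using ceil_div_le_iff[OF assms(1)] by blast
qed

text \<open>
  The distance to the next multiple of \<open>s\<close>, a termination measure.
\<close>

definition gap :: "nat \<Rightarrow> nat \<Rightarrow> nat" where
  "gap a s = ceil_div a s * s - a"

lemma gap_Suc:
  assumes "s > 0" "\<not> s dvd a"
  shows "gap (Suc a) s < gap a s"
proof -
  have "a \<noteq> ceil_div a s * s" using assms(2) by (metis dvd_triv_right)
  then have "a < ceil_div a s * s" using ceil_div_mult_ge[OF assms(1), of a] by simp
  moreover have "ceil_div (Suc a) s * s \<le> ceil_div a s * s"
    using ceil_div_add_le[OF assms, of 1] by simp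
  ultimately show ?thesis unfolding gap_def by linarith
qed

text \<open>
  The monomials divisible by \<open>\<mu>\<close>.
\<close>

definition multiples :: "mon \<Rightarrow> mon set" where
  "multiples \<mu> = {\<nu>. \<forall>k. lookup \<mu> k \<le> lookup \<nu> k}"

lemma multiples_add_diff: "\<nu> \<in> multiples \<mu> \<Longrightarrow> \<mu> + (\<nu> - \<mu>) = \<nu>"
  by (rule poly_mapping_eqI) (simp add: multiples_def lookup_add lookup_minus)

lemma bidegree_mono:
  assumes "\<nu> \<in> multiples \<mu>"
  shows "fst (bidegree n m \<mu>) \<le> fst (bidegree n m \<nu>)" "snd (bidegree n m \<mu>) \<le> snd (bidegree n m \<nu>)"
  using assms by (auto simp: bidegree_def multiples_def intro!: sum_mono)

definition sqfree :: "(nat + nat) set \<Rightarrow> mon" where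
  "sqfree T = (\<Sum>k\<in>T. single k 1)"

lemma lookup_sqfree:
  "finite T \<Longrightarrow> lookup (sqfree T) k = (if k \<in> T then 1 else 0)"
  by (simp add: sqfree_def lookup_sum lookup_single when_def)

lemma bidegree_sqfree_x:
  assumes "T \<subseteq> Inl ` {..<n}"
  shows "bidegree n m (sqfree T) = (int (card T), 0)"
proof -
  have "finite T" using assms finite_subset by blast
  obtain U where U: "T = Inl ` U" "U \<subseteq> {..<n}" using assms by (meson subset_imageE)
  have "card T = card ({..<n} \<inter> U)"
    using U by (simp add: card_image Int_absorb1)
  then show ?thesis
    using \<open>finite T\<close> U by (auto simp: bidegree_def lookup_sqfree image_iff sum.If_cases Int_def)
qed

lemma bidegree_sqfree_y:
  assumes "T \<subseteq> Inr ` {..<m}"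
  shows "bidegree n m (sqfree T) = (0, int (card T))"
proof -
  have "finite T" using assms finite_subset by blast
  obtain U where U: "T = Inr ` U" "U \<subseteq> {..<m}" using assms by (meson subset_imageE)
  have "card T = card ({..<m} \<inter> U)"
    using U by (simp add: card_image Int_absorb1)
  then show ?thesis
    using \<open>finite T\<close> U by (auto simp: bidegree_def lookup_sqfree image_iff sum.If_cases Int_def)
qed

context veronese
begin

lemma mon_ideal_multiples: "mon_ideal (multiples \<mu>)"
  by (auto simp: mon_ideal_def multiples_def lookup_add intro: trans_le_add2)

lemma G_diff:
  assumes "(c, \<nu>) \<in> G" "(d, \<mu>) \<in> G" "\<nu> \<in> multiples \<mu>" "fst d \<le> fst c" "snd d \<le> snd c"
  shows "(c - d, \<nu> - \<mu>) \<in> G"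
proof -
  have "bidegree n m \<nu> = bidegree n m \<mu> + bidegree n m (\<nu> - \<mu>)"
    using multiples_add_diff[OF assms(3)] bidegree_add by metis
  moreover have "keys (\<nu> - \<mu>) \<subseteq> keys \<nu>"
    by (auto simp: in_keys_iff lookup_minus)
  ultimately show ?thesis using assms by (auto simp: G_def algebra_simps prod_eq_iff)
qed

text \<open>
  If every monomial of \<open>A\<close> divisible by \<open>\<mu>\<close> is divisible by some \<open>\<mu> x\<^sub>k\<close> with \<open>k\<close> in \<open>X\<close>, then the ideals of
  \<open>\<mu>\<close> and of all these \<open>\<mu> x\<^sub>k\<close> have the same Veronese module.  The intersection of the ideals with \<open>k\<close> in
  \<open>T\<close> is generated by \<open>\<mu>\<close> times the product of \<open>T\<close>.
\<close>

lemma bar_exact_multiples_split: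
  assumes "finite X"
    and above: "\<And>c \<nu>. (c, \<nu>) \<in> G \<Longrightarrow> \<nu> \<in> multiples \<mu> \<Longrightarrow> \<exists>k\<in>X. lookup \<mu> k < lookup \<nu> k"
    and ex: "\<And>T. T \<subseteq> X \<Longrightarrow> T \<noteq> {} \<Longrightarrow> card T \<le> Suc j \<Longrightarrow>
      bar_exact P act_pol (mon_mod (multiples (\<mu> + sqfree T)) :: bideg \<Rightarrow> 'k::field pol set) (Suc j - card T) e"
  shows "bar_exact P act_pol (mon_mod (multiples \<mu>) :: bideg \<Rightarrow> 'k pol set) j e"
proof -
  have "bar_exact P act_pol (mon_mod (\<Union>k\<in>X. multiples (\<mu> + single k 1)) :: bideg \<Rightarrow> 'k pol set) j e"
  proof (rule bar_exact_UN[OF assms(1) mon_ideal_multiples])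
    fix T assume T: "T \<subseteq> X" "T \<noteq> {}" "card T \<le> Suc j"
    then have "finite T" using assms(1) finite_subset by blast
    have "\<nu> \<in> (\<Inter>k\<in>T. multiples (\<mu> + single k 1)) \<longleftrightarrow> \<nu> \<in> multiples (\<mu> + sqfree T)" for \<nu>
    proof
      assume *: "\<nu> \<in> (\<Inter>k\<in>T. multiples (\<mu> + single k 1))"
      have le': "lookup \<mu> i + lookup (single k 1) i \<le> lookup \<nu> i"
        if "k \<in> T" for k i
      proof -
        have "\<nu> \<in> multiples (\<mu> + single k 1)" using * that by blast
        then show ?thesis by (simp add: multiples_def lookup_add)
      qed
      obtain k0 where "k0 \<in> T" using T(2) by blast
      then have le: "lookup \<mu> k \<le> lookup \<nu> k" for k
        using le'[of k0 k] by linarith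
      have "Suc (lookup \<mu> k) \<le> lookup \<nu> k" if "k \<in> T" for k
        using le'[OF that, of k] by simp
      with le show "\<nu> \<in> multiples (\<mu> + sqfree T)"
        using \<open>finite T\<close> by (simp add: multiples_def lookup_add lookup_sqfree)
    next
      assume *: "\<nu> \<in> multiples (\<mu> + sqfree T)"
      have "lookup (\<mu> + single k 1) i \<le> lookup \<nu> i"
        if "k \<in> T" for k i
      proof -
        have "lookup (\<mu> + single k 1) i \<le> lookup (\<mu> + sqfree T) i"
          using that \<open>finite T\<close> by (auto simp: lookup_add lookup_sqfree lookup_single when_def)
        also have "\<dots> \<le> lookup \<nu> i" using * by (simp add: multiples_def)
        finally show ?thesis .
      qed
      then show "\<nu> \<in> (\<Inter>k\<in>T. multiples (\<mu> + single k 1))"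
        by (simp add: multiples_def)
    qed
    then have "(\<Inter>k\<in>T. multiples (\<mu> + single k 1)) = multiples (\<mu> + sqfree T)" by blast
    then show "bar_exact P act_pol (mon_mod (\<Inter>k\<in>T. multiples (\<mu> + single k 1)) :: bideg \<Rightarrow> 'k pol set)
        (Suc j - card T) e"
      using ex[OF T] by simp
  qed
  moreover have "mon_mod (\<Union>k\<in>X. multiples (\<mu> + single k 1)) = (mon_mod (multiples \<mu>) :: bideg \<Rightarrow> 'k pol set)"
  proof -
    have "\<nu> \<in> (\<Union>k\<in>X. multiples (\<mu> + single k 1)) \<longleftrightarrow> \<nu> \<in> multiples \<mu>" if "(c, \<nu>) \<in> G" for c \<nu>
    proof
      assume "\<nu> \<in> (\<Union>k\<in>X. multiples (\<mu> + single k 1))"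
      then show "\<nu> \<in> multiples \<mu>" by (auto simp: multiples_def lookup_add dest: add_leD1)
    next
      assume \<nu>: "\<nu> \<in> multiples \<mu>"
      from above[OF that this] obtain k where "k \<in> X" "lookup \<mu> k < lookup \<nu> k"
        by blast
      then have "\<nu> \<in> multiples (\<mu> + single k 1)"
        using \<nu> by (auto simp: multiples_def lookup_add lookup_single when_def Suc_le_eq)
      then show "\<nu> \<in> (\<Union>k\<in>X. multiples (\<mu> + single k 1))" using \<open>k \<in> X\<close> by blast
    qed
    then show ?thesis unfolding mon_mod_def by blast
  qed
  ultimately show ?thesis by simp
qed

text \<open>
  Here \<open>\<mu>\<close> is itself a monomial of \<open>A\<close>, of bidegree \<open>d\<close>, and multiplication by \<open>\<mu>\<close> is an isomorphism
  from \<open>A\<close>, shifted by \<open>d\<close>, onto the Veronese module of its ideal.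
\<close>

lemma bar_exact_multiples_free:
  assumes \<mu>: "(d, \<mu>) \<in> G" and d: "\<And>c \<nu>. (c, \<nu>) \<in> G \<Longrightarrow> \<nu> \<in> multiples \<mu> \<Longrightarrow> fst d \<le> fst c \<and> snd d \<le> snd c"
    and "j > 0 \<or> e \<noteq> d"
  shows "bar_exact P act_pol (mon_mod (multiples \<mu>) :: bideg \<Rightarrow> 'k::field pol set) j e"
  unfolding bar_exact_def
proof (intro ballI impI)
  fix z :: "letter list \<Rightarrow>\<^sub>0 'k pol"
  assume z: "z \<in> bar_chains P (mon_mod (multiples \<mu>)) j e" and dz: "bar_diff act_pol z = 0"
  define f :: "'k pol \<Rightarrow> 'k pol" where "f = act_pol (d, \<mu>)"
  have f: "additive f" unfolding f_def by (rule pol.additive_act)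
  have inj: "p = 0" if "f p = 0" for p :: "'k pol"
  proof (rule poly_mapping_eqI)
    fix \<nu> show "lookup p \<nu> = lookup 0 \<nu>"
      using lookup_monom_mult[of \<mu> 1 p \<nu>] that by (simp add: f_def act_pol_def)
  qed
  have into: "f p \<in> mon_mod (multiples \<mu>) c" if "p \<in> A (c - d)" for p :: "'k pol" and c
  proof -
    have "(c, \<nu>) \<in> G \<and> \<nu> \<in> multiples \<mu>" if \<nu>: "\<nu> \<in> keys (f p)" for \<nu>
    proof -
      obtain \<kappa> where \<kappa>: "\<kappa> \<in> keys p" "\<nu> = \<mu> + \<kappa>"
        using \<nu> keys_single_mult[of \<mu> 1 p] by (auto simp: f_def act_pol_def)
      then have "(c - d, \<kappa>) \<in> G" using \<open>p \<in> A (c - d)\<close> by (simp add: mon_mod_def)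
      then show ?thesis using G_add[OF \<mu>] \<kappa>(2) by (fastforce simp: multiples_def lookup_add)
    qed
    then show ?thesis by (simp add: mon_mod_def)
  qed
  have onto: "\<exists>p\<in>A (c - d). x = f p" if x: "x \<in> mon_mod (multiples \<mu>) c" for x :: "'k pol" and c
  proof
    let ?p = "\<Sum>\<nu>\<in>keys x. single (\<nu> - \<mu>) (lookup x \<nu>)"
    have *: "(c, \<nu>) \<in> G" "\<nu> \<in> multiples \<mu>" if "\<nu> \<in> keys x" for \<nu>
      using that x by (auto simp: mon_mod_def)
    have **: "fst d \<le> fst c" "snd d \<le> snd c" if "\<nu> \<in> keys x" for \<nu>
      using d[OF *[OF that]] by auto
    show "?p \<in> A (c - d)"
      using * ** by (intro mon_mod_sum single_in_mon_mod G_diff \<mu>) auto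
    have "f ?p = (\<Sum>\<nu>\<in>keys x. single (\<mu> + (\<nu> - \<mu>)) (lookup x \<nu>))"
      by (simp add: additive.sum[OF f]) (simp add: f_def act_pol_single)
    also have "\<dots> = lin single x"
      unfolding lin_def by (intro sum.cong refl) (simp add: multiples_add_diff *)
    finally show "x = f ?p" by (simp add: lin_single_id)
  qed
  obtain z' where z': "z' \<in> bar_chains P (\<lambda>c. A (c - d)) j e"
    "\<And>l. lookup z l = f (lookup z' l)"
    by (rule bar_chains_choice[OF z, of "\<lambda>c. A (c - d)" "\<lambda>c x y. x = f y"])
      (auto simp: onto additive.zero[OF f])
  have zz': "z = cmap f z'"
    by (rule poly_mapping_eqI) (simp add: z' lookup_cmap[OF f])
  have nat: "bar_diff act_pol (cmap f u) = cmap f (bar_diff act_pol u)" for u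
    by (rule bar_diff_cmap[OF pol.bar_axioms pol.bar_axioms f])
      (simp add: f_def pol.act_act[symmetric] add.commute)
  have "bar_diff act_pol z' = 0"
  proof (rule poly_mapping_eqI)
    fix l
    have "f (lookup (bar_diff act_pol z') l) = 0"
      using dz unfolding zz' nat by (metis lookup_cmap[OF f] lookup_zero)
    then show "lookup (bar_diff act_pol z') l = lookup 0 l"
      using inj by simp
  qed
  then obtain y where y: "y \<in> bar_chains P (\<lambda>c. A (c - d)) (Suc j) e" "bar_diff act_pol y = z'"
    using bar_exactD[OF bar_exact_A_shift[OF assms(3)] z'(1)] by blast
  have "cmap f y \<in> bar_chains P (mon_mod (multiples \<mu>)) (Suc j) e"
    using bar_chains_cmap[OF f y(1) into] .
  moreover have "bar_diff act_pol (cmap f y) = z" by (simp add: nat y zz')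
  ultimately show "z \<in> bar_diff act_pol ` bar_chains P (mon_mod (multiples \<mu>)) (Suc j) e" by blast
qed

text \<open>
  Induction on \<open>j\<close> and then on the distance of \<open>(a, b)\<close> to the next multiple of \<open>(s, t)\<close>.  In a split
  by the \<open>x\<close>-variables, a product of \<open>c\<close> variables lowers \<open>j\<close> by \<open>c - 1\<close> and raises \<open>\<lceil>a/s\<rceil>\<close> by at most
  \<open>c - 1\<close>, so the bound is kept; for \<open>c = 1\<close> the distance drops.  The bounds in the two directions are
  carried together, because a split in one direction leaves the rounded quotient of the other
  unchanged.
\<close>

lemma bar_exact_multiples:
  assumes "keys \<mu> \<subseteq> vars n m" "bidegree n m \<mu> = (int a, int b)"
    and "fst e > int (j + ceil_div a s) \<or> snd e > int (j + ceil_div b t)"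
  shows "bar_exact P act_pol (mon_mod (multiples \<mu>) :: bideg \<Rightarrow> 'k::field pol set) j e"
  using assms
proof (induction j arbitrary: \<mu> a b rule: less_induct)
  case (less j)
  note outer = less.IH
  show ?case
    using less.prems
  proof (induction "gap a s + gap b t" arbitrary: \<mu> a b rule: less_induct)
    case less
    note inner = less.hyps and \<mu> = less.prems(1) and ab = less.prems(2) and e = less.prems(3)
    have deg: "int a \<le> fst c * int s" "int b \<le> snd c * int t" if "(c, \<nu>) \<in> G" "\<nu> \<in> multiples \<mu>" for c \<nu>
      using bidegree_mono[OF that(2), of n m] that(1) ab by (auto simp: G_def)
    have keys: "keys (\<mu> + sqfree T) \<subseteq> vars n m" if "T \<subseteq> vars n m" for T
    proof -
      have "finite T" using that finite_subset by blast
      then show ?thesis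
        using \<mu> that by (auto simp: keys_add_mon in_keys_iff lookup_sqfree split: if_splits)
    qed
    have step: "bar_exact P act_pol (mon_mod (multiples (\<mu> + sqfree T)) :: bideg \<Rightarrow> 'k pol set) (Suc j - card T) e"
      if T: "T \<subseteq> vars n m" "T \<noteq> {}" "card T \<le> Suc j" "bidegree n m (sqfree T) = (int a', int b')"
        and le: "ceil_div (a + a') s \<le> ceil_div a s + (card T - 1)" "ceil_div (b + b') t \<le> ceil_div b t + (card T - 1)"
        and gap: "card T = 1 \<Longrightarrow> gap (a + a') s + gap (b + b') t < gap a s + gap b t" for T a' b'
    proof -
      have bd: "bidegree n m (\<mu> + sqfree T) = (int (a + a'), int (b + b'))"
        using T(4) ab by (simp add: bidegree_add)
      have "finite T" using T(1) finite_subset by blast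
      then have card: "card T \<noteq> 0" using T(2) by simp
      have e': "fst e > int (Suc j - card T + ceil_div (a + a') s) \<or> snd e > int (Suc j - card T + ceil_div (b + b') t)"
        using e le card T(3) by linarith
      show ?thesis
      proof (cases "card T = 1")
        case True
        then show ?thesis
          using inner[OF gap[OF True] keys[OF T(1)] bd] e' by simp
      next
        case False
        then have "Suc j - card T < j" using card T(3) by linarith
        then show ?thesis using outer[OF _ keys[OF T(1)] bd e'] by blast
      qed
    qed
    consider (zero) "s = 0 \<and> a > 0 \<or> t = 0 \<and> b > 0" | (x) "s > 0" "\<not> s dvd a" | (y) "t > 0" "\<not> t dvd b"
      | (free) "s dvd a" "t dvd b"
      by (metis dvd_0_left_iff neq0_conv)
    then show ?case
    proof cases
      case zero
      \<comment> \<open>The components of \<open>A\<close> have degree \<open>0\<close> in this direction, so the module is zero.\<close>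
      have empty: False if "(c, \<nu>) \<in> G" "\<nu> \<in> multiples \<mu>" for c \<nu>
        using deg[OF that] zero by auto
      show ?thesis
      proof (rule bar_exact_multiples_split[of "{}"])
        fix c \<nu> assume "(c, \<nu>) \<in> G" "\<nu> \<in> multiples \<mu>"
        then have False by (rule empty)
        then show "\<exists>k\<in>{}. lookup \<mu> k < lookup \<nu> k" ..
      qed simp_all
    next
      case x
      show ?thesis
      proof (rule bar_exact_multiples_split[of "Inl ` {..<n}"])
        fix c \<nu> assume *: "(c, \<nu>) \<in> G" "\<nu> \<in> multiples \<mu>"
        show "\<exists>k\<in>Inl ` {..<n}. lookup \<mu> k < lookup \<nu> k"
        proof (rule ccontr)
          assume "\<not> ?thesis"
          then have "lookup \<mu> (Inl i) = lookup \<nu> (Inl i)" if "i < n" for i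
            using *(2) that by (simp add: multiples_def) (metis imageI lessThan_iff nless_le)
          then have "fst (bidegree n m \<nu>) = int a" using ab by (simp add: bidegree_def)
          then have "int a = fst c * int s" using *(1) by (simp add: G_def)
          then have "int s dvd int a" by simp
          then show False using x by simp
        qed
      next
        fix T :: "(nat + nat) set"
        assume T: "T \<subseteq> Inl ` {..<n}" "T \<noteq> {}" "card T \<le> Suc j"
        have "finite T" using T(1) finite_subset by blast
        then have "card T \<ge> 1" using T(2) by (simp add: Suc_le_eq card_gt_0_iff)
        then show "bar_exact P act_pol (mon_mod (multiples (\<mu> + sqfree T)) :: bideg \<Rightarrow> 'k pol set) (Suc j - card T) e"
          using T ceil_div_add_le[OF x, of "card T"] gap_Suc[OF x]
          by (intro step[of T "card T" 0]) (auto simp: bidegree_sqfree_x)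
      qed auto
    next
      case y
      show ?thesis
      proof (rule bar_exact_multiples_split[of "Inr ` {..<m}"])
        fix c \<nu> assume *: "(c, \<nu>) \<in> G" "\<nu> \<in> multiples \<mu>"
        show "\<exists>k\<in>Inr ` {..<m}. lookup \<mu> k < lookup \<nu> k"
        proof (rule ccontr)
          assume "\<not> ?thesis"
          then have "lookup \<mu> (Inr i) = lookup \<nu> (Inr i)" if "i < m" for i
            using *(2) that by (simp add: multiples_def) (metis imageI lessThan_iff nless_le)
          then have "snd (bidegree n m \<nu>) = int b" using ab by (simp add: bidegree_def)
          then have "int b = snd c * int t" using *(1) by (simp add: G_def)
          then have "int t dvd int b" by simp
          then show False using y by simp
        qed
      next
        fix T :: "(nat + nat) set"
        assume T: "T \<subseteq> Inr ` {..<m}" "T \<noteq> {}" "card T \<le> Suc j"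
        have "finite T" using T(1) finite_subset by blast
        then have "card T \<ge> 1" using T(2) by (simp add: Suc_le_eq card_gt_0_iff)
        then show "bar_exact P act_pol (mon_mod (multiples (\<mu> + sqfree T)) :: bideg \<Rightarrow> 'k pol set) (Suc j - card T) e"
          using T ceil_div_add_le[OF y, of "card T"] gap_Suc[OF y]
          by (intro step[of T 0 "card T"]) (auto simp: bidegree_sqfree_y)
      qed auto
    next
      case free
      let ?d = "(int (ceil_div a s), int (ceil_div b t))"
      show ?thesis
      proof (rule bar_exact_multiples_free[of ?d])
        have "int a = int (ceil_div a s) * int s" "int b = int (ceil_div b t) * int t"
          using ceil_div_dvd[OF free(1)] ceil_div_dvd[OF free(2)] by (metis of_nat_mult)+
        then show "(?d, \<mu>) \<in> G" using \<mu> ab by (simp add: G_def)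
        fix c \<nu> assume *: "(c, \<nu>) \<in> G" "\<nu> \<in> multiples \<mu>"
        have nonneg: "0 \<le> fst c" "0 \<le> snd c" using *(1) by (auto simp: G_def)
        have "int (ceil_div x q) \<le> i" if "int x \<le> i * int q" "0 \<le> i" for x q i
        proof (cases "q > 0")
          case True
          have "x \<le> nat i * q" using that by (metis nat_0_le of_nat_le_iff of_nat_mult)
          then have "ceil_div x q \<le> nat i" using ceil_div_le_iff[OF True] by blast
          then show ?thesis using that(2) by linarith
        qed (use that in auto)
        then show "fst ?d \<le> fst c \<and> snd ?d \<le> snd c"
          using deg[OF *] nonneg by simp
      next
        show "j > 0 \<or> e \<noteq> ?d" using e by (auto simp: prod_eq_iff)
      qed
    qed
  qed
qed

end

section \<open>Initial ideals\<close>

text \<open>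
  Monomials are compared lexicographically.  The order on finitely supported functions requires a
  linearly ordered index type, so the variables are enumerated first.
\<close>

definition mon_key :: "mon \<Rightarrow> (nat \<Rightarrow>\<^sub>0 nat)" where
  "mon_key = Poly_Mapping.map_key sum_decode"

lemma mon_key_add: "mon_key (\<mu> + \<nu>) = mon_key \<mu> + mon_key \<nu>"
  unfolding mon_key_def by (rule map_key_plus) (rule inj_sum_decode)

lemma lookup_mon_key: "lookup (mon_key \<mu>) i = lookup \<mu> (sum_decode i)"
  unfolding mon_key_def by (simp add: map_key.rep_eq inj_sum_decode)

lemma mon_key_inj: "mon_key \<mu> = mon_key \<nu> \<longleftrightarrow> \<mu> = \<nu>"
proof
  assume *: "mon_key \<mu> = mon_key \<nu>"
  show "\<mu> = \<nu>"
  proof (rule poly_mapping_eqI)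
    fix k
    show "lookup \<mu> k = lookup \<nu> k"
      using arg_cong[OF *, of "\<lambda>p. lookup p (sum_encode k)"] by (simp add: lookup_mon_key)
  qed
qed simp

lemma mon_key_add_less: "mon_key (\<rho> + \<mu>) < mon_key (\<rho> + \<nu>) \<longleftrightarrow> mon_key \<mu> < mon_key \<nu>"
  and mon_key_add_le: "mon_key (\<rho> + \<mu>) \<le> mon_key (\<rho> + \<nu>) \<longleftrightarrow> mon_key \<mu> \<le> mon_key \<nu>"
  by (simp_all add: mon_key_add)

lemma mon_key_less_iff: "mon_key \<mu> < mon_key \<nu> \<longleftrightarrow> mon_key \<mu> \<le> mon_key \<nu> \<and> \<mu> \<noteq> \<nu>"
  by (auto simp: less_le mon_key_inj)

lemma exists_max_mon_key:
  assumes "finite W" "W \<noteq> {}"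
  obtains \<omega> where "\<omega> \<in> W" "\<And>\<nu>. \<nu> \<in> W \<Longrightarrow> mon_key \<nu> \<le> mon_key \<omega>"
proof -
  have "Max (mon_key ` W) \<in> mon_key ` W" using assms by (intro Max_in) auto
  then obtain \<omega> where "\<omega> \<in> W" "Max (mon_key ` W) = mon_key \<omega>" by auto
  then show ?thesis using assms by (intro that[of \<omega>]) (auto simp flip: \<open>Max _ = _\<close>)
qed

lemma finite_bounded_mons:
  assumes "finite X"
  shows "finite {u :: mon. keys u \<subseteq> X \<and> (\<forall>k. lookup u k \<le> N)}"
proof -
  have "finite {f. \<forall>x. (x \<in> X \<longrightarrow> f x \<in> {..N}) \<and> (x \<notin> X \<longrightarrow> f x = 0)}"
    by (rule finite_set_of_finite_funs) (use assms in auto)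
  moreover have "lookup ` {u :: mon. keys u \<subseteq> X \<and> (\<forall>k. lookup u k \<le> N)}
      \<subseteq> {f. \<forall>x. (x \<in> X \<longrightarrow> f x \<in> {..N}) \<and> (x \<notin> X \<longrightarrow> f x = 0)}"
    by (auto simp: in_keys_iff)
  moreover have "inj_on lookup U" for U :: "mon set"
    by (auto intro!: inj_onI)
  ultimately show ?thesis by (metis (no_types, lifting) finite_imageD finite_subset)
qed

lemma lookup_le_bidegree:
  assumes "keys u \<subseteq> vars n m"
  shows "int (lookup u k) \<le> fst (bidegree n m u) + snd (bidegree n m u)"
proof (cases "k \<in> vars n m")
  case True
  then consider i where "k = Inl i" "i < n" | i where "k = Inr i" "i < m" by auto
  then show ?thesis
  proof cases
    case 1
    have "lookup u (Inl i) \<le> (\<Sum>i<n. lookup u (Inl i))"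
      using 1 by (intro member_le_sum) auto
    then show ?thesis using 1 by (simp add: bidegree_def flip: of_nat_sum)
  next
    case 2
    have "lookup u (Inr i) \<le> (\<Sum>i<m. lookup u (Inr i))"
      using 2 by (intro member_le_sum) auto
    then show ?thesis using 2 by (simp add: bidegree_def flip: of_nat_sum)
  qed
next
  case False
  then have "lookup u k = 0" using assms by (auto simp: in_keys_iff)
  then show ?thesis using bidegree_nonneg[where \<mu> = u and n = n and m = m] by simp
qed

lemma finite_mons_of_bidegree:
  "finite {u. keys u \<subseteq> vars n m \<and> bidegree n m u = d}"
proof (rule finite_subset)
  show "finite {u :: mon. keys u \<subseteq> vars n m \<and> (\<forall>k. lookup u k \<le> nat (fst d + snd d))}"
    by (rule finite_bounded_mons) simp
  show "{u. keys u \<subseteq> vars n m \<and> bidegree n m u = d}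
      \<subseteq> {u. keys u \<subseteq> vars n m \<and> (\<forall>k. lookup u k \<le> nat (fst d + snd d))}"
  proof (safe, simp)
    fix u :: mon and k assume "keys u \<subseteq> vars n m"
    from lookup_le_bidegree[OF this, of k]
    show "lookup u k \<le> nat (fst (bidegree n m u) + snd (bidegree n m u))" by linarith
  qed
qed

definition is_lead :: "'k::zero pol \<Rightarrow> mon \<Rightarrow> bool" where
  "is_lead p \<mu> \<longleftrightarrow> \<mu> \<in> keys p \<and> (\<forall>\<nu>\<in>keys p. mon_key \<nu> \<le> mon_key \<mu>)"

text \<open>
  The leading monomials of the homogeneous elements of \<open>J\<close> for the grading of \<open>S\<close>.  They do not depend
  on \<open>s\<close> and \<open>t\<close>, so one finite set of generators serves for all Veronese algebras at once.
\<close>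

definition initial_set :: "nat \<Rightarrow> nat \<Rightarrow> 'k::field pol set \<Rightarrow> mon set" where
  "initial_set n m J = {\<mu>. \<exists>d. \<exists>p\<in>J \<inter> pol_comp n m d. is_lead p \<mu>}"

definition pol_ideal :: "nat \<Rightarrow> nat \<Rightarrow> 'k::field pol set \<Rightarrow> bool" where
  "pol_ideal n m J \<longleftrightarrow> 0 \<in> J \<and> (\<forall>p\<in>J. \<forall>q\<in>J. p - q \<in> J) \<and> (\<forall>a\<in>pol_set n m. \<forall>p\<in>J. a * p \<in> J)"

lemma pol_ideal_mult: "pol_ideal n m J \<Longrightarrow> a \<in> pol_set n m \<Longrightarrow> p \<in> J \<Longrightarrow> a * p \<in> J"
  unfolding pol_ideal_def by blast

lemma single_in_pol_set: "keys u \<subseteq> vars n m \<Longrightarrow> single u k \<in> pol_set n m"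
  by (simp add: pol_set_def)

lemma keys_monom_mult:
  fixes p :: "'k::comm_ring_1 pol"
  shows "keys (monom u * p) = (+) u ` keys p"
proof
  show "(+) u ` keys p \<subseteq> keys (monom u * p)"
    by (auto simp: in_keys_iff lookup_monom_mult)
qed (rule keys_single_mult)

lemma initial_set_mult:
  assumes J: "pol_ideal n m J" and \<mu>: "\<mu> \<in> initial_set n m J" and \<rho>: "keys \<rho> \<subseteq> vars n m"
  shows "\<rho> + \<mu> \<in> initial_set n m J"
proof -
  obtain d p where p: "p \<in> J" "p \<in> pol_comp n m d" "is_lead p \<mu>"
    using \<mu> by (auto simp: initial_set_def)
  have "monom \<rho> * p \<in> J" by (intro pol_ideal_mult[OF J] single_in_pol_set \<rho> p)
  moreover have "monom \<rho> * p \<in> pol_comp n m (bidegree n m \<rho> + d)"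
    using p(2) \<rho> by (auto simp: pol_comp_def pol_set_def keys_monom_mult keys_add_mon bidegree_add)
  moreover have "is_lead (monom \<rho> * p) (\<rho> + \<mu>)"
    using p(3) by (auto simp: is_lead_def keys_monom_mult mon_key_add_le)
  ultimately show ?thesis unfolding initial_set_def by blast
qed

text \<open>
  The total monomials of the terms of a chain: coefficient monomial times all letters.  The bar complex
  of a monomial ideal is graded by them, that of an arbitrary ideal is filtered.
\<close>

definition weights :: "(letter list \<Rightarrow>\<^sub>0 'k::zero pol) \<Rightarrow> mon set" where
  "weights z = {snd (sum_list l) + \<mu> | l \<mu>. \<mu> \<in> keys (lookup z l)}"

lemma finite_weights: "finite (weights z)"
proof -
  have "weights z \<subseteq> (\<Union>l\<in>keys z. (+) (snd (sum_list l)) ` keys (lookup z l))"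
    by (auto simp: weights_def in_keys_iff) (metis image_eqI in_keys_iff lookup_zero)
  then show ?thesis by (rule finite_subset) auto
qed

lemma weights_empty: "weights z = {} \<Longrightarrow> z = 0"
proof (rule poly_mapping_eqI, rule poly_mapping_eqI)
  fix l \<mu> assume "weights z = {}"
  then show "lookup (lookup z l) \<mu> = lookup (lookup 0 l) \<mu>"
    by (auto simp: weights_def in_keys_iff)
qed

lemma weights_diff:
  fixes z :: "letter list \<Rightarrow>\<^sub>0 'k::ab_group_add pol"
  shows "weights (z - w) \<subseteq> weights z \<union> weights w"
  using keys_minus_subset by (fastforce simp: weights_def lookup_minus)

lemma weights_add:
  fixes z :: "letter list \<Rightarrow>\<^sub>0 'k::ab_group_add pol"
  shows "weights (z + w) \<subseteq> weights z \<union> weights w"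
  using Poly_Mapping.keys_add by (fastforce simp: weights_def lookup_add)

lemma weights_sum:
  fixes f :: "'i \<Rightarrow> letter list \<Rightarrow>\<^sub>0 'k::ab_group_add pol"
  shows "weights (sum f I) \<subseteq> (\<Union>i\<in>I. weights (f i))"
  using keys_sum_subset by (fastforce simp: weights_def lookup_sum)

lemma weights_single: "weights (single l p) = (+) (snd (sum_list l)) ` keys p"
  by (auto simp: weights_def lookup_single when_def split: if_splits)

lemma weights_prepend:
  fixes z :: "letter list \<Rightarrow>\<^sub>0 'k::ab_group_add pol"
  shows "weights (prepend u z) \<subseteq> (+) (snd u) ` weights z"
proof -
  have "weights (prepend u z) \<subseteq> (\<Union>l\<in>keys z. weights (single (u # l) (lookup z l)))"
    unfolding prepend_def lin_def by (rule weights_sum)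
  also have "\<dots> \<subseteq> (+) (snd u) ` weights z"
  proof (intro UN_least)
    fix l
    have "weights (single (u # l) (lookup z l)) =
        (+) (snd u) ` (+) (snd (sum_list l)) ` keys (lookup z l)"
      by (simp add: weights_single image_image add.assoc)
    also have "\<dots> \<subseteq> (+) (snd u) ` weights z"
      by (intro image_mono) (auto simp: weights_def)
    finally show "weights (single (u # l) (lookup z l)) \<subseteq> (+) (snd u) ` weights z" .
  qed
  finally show ?thesis .
qed

lemma weights_merge_word:
  fixes p :: "'k::ab_group_add pol"
  shows "weights (merge_word l p) \<subseteq> (+) (snd (sum_list l)) ` keys p"
proof (induction l rule: induct_list012)
  case (3 u v l)
  have "weights (prepend u (merge_word (v # l) p)) \<subseteq> (+) (snd u) ` (+) (snd (sum_list (v # l))) ` keys p"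
    using weights_prepend 3(2) by (meson image_mono subset_trans)
  also have "\<dots> = (+) (snd (sum_list (u # v # l))) ` keys p"
    by (simp add: image_image add.assoc)
  finally show ?case
    using weights_diff[of "single ((u + v) # l) p" "prepend u (merge_word (v # l) p)"]
    by (simp add: weights_single add.assoc) blast
qed (auto simp: weights_def)

lemma weights_bar_diff: "weights (bar_diff act_pol z) \<subseteq> weights z"
proof -
  have "weights (bar_word act_pol l (lookup z l)) \<subseteq> weights z" for l
  proof (cases l)
    case Nil
    then show ?thesis by (simp add: bar_word_def weights_def)
  next
    case (Cons u l')
    have "weights (single l' (act_pol u (lookup z l)))
        \<subseteq> (+) (snd (sum_list l)) ` keys (lookup z l)"
      by (auto simp: weights_single act_pol_def keys_monom_mult Cons image_image algebra_simps)
    then have "weights (bar_word act_pol l (lookup z l))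
        \<subseteq> (+) (snd (sum_list l)) ` keys (lookup z l)"
      using weights_diff weights_merge_word unfolding bar_word_def Cons by fastforce
    also have "\<dots> \<subseteq> weights z" by (auto simp: weights_def)
    finally show ?thesis .
  qed
  then show ?thesis
    unfolding bar_diff_def lin_def using weights_sum by fast
qed

lemma weight_split:
  fixes z :: "letter list \<Rightarrow>\<^sub>0 'k::ab_group_add pol"
  obtains z1 where "keys z1 \<subseteq> keys z"
    "\<And>l \<mu>. lookup (lookup z1 l) \<mu> =
      (if snd (sum_list l) + \<mu> = \<omega> then lookup (lookup z l) \<mu> else 0)"
    "weights z1 \<subseteq> {\<omega>}" "weights (z - z1) \<subseteq> weights z - {\<omega>}"
proof -
  let ?R = "\<lambda>l p. \<forall>\<mu>. lookup p \<mu> =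
      (if snd (sum_list l) + \<mu> = \<omega> then lookup (lookup z l) \<mu> else 0)"
  have "\<exists>p. ?R l p" for l
  proof -
    let ?S = "{\<mu> \<in> keys (lookup z l). snd (sum_list l) + \<mu> = \<omega>}"
    obtain p where "\<forall>\<mu>. lookup p \<mu> = (if \<mu> \<in> ?S then lookup (lookup z l) \<mu> else 0)"
      using exists_poly_mapping[of ?S "lookup (lookup z l)"] by auto
    then show ?thesis by (intro exI[of _ p]) (auto simp: in_keys_iff)
  qed
  then obtain f where f: "\<And>l. ?R l (f l)" by metis
  obtain z1 where z1: "\<And>l. lookup z1 l = (if l \<in> keys z then f l else 0)"
    using exists_poly_mapping[OF finite_keys[of z], of f] by auto
  have keys: "keys z1 \<subseteq> keys z"
    by (auto simp: in_keys_iff z1 split: if_splits)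
  have look: "lookup (lookup z1 l) \<mu> =
      (if snd (sum_list l) + \<mu> = \<omega> then lookup (lookup z l) \<mu> else 0)" for l \<mu>
    using f by (simp add: z1 in_keys_iff)
  show ?thesis
  proof (rule that[OF keys look])
    show "weights z1 \<subseteq> {\<omega>}" by (auto simp: weights_def in_keys_iff look split: if_splits)
    show "weights (z - z1) \<subseteq> weights z - {\<omega>}"
      by (auto simp: weights_def in_keys_iff lookup_minus look split: if_splits)
  qed
qed

lemma weights_disjoint_zero:
  fixes x y :: "letter list \<Rightarrow>\<^sub>0 'k::ab_group_add pol"
  assumes "x + y = 0" "weights x \<subseteq> {\<omega>}" "\<omega> \<notin> weights y"
  shows "x = 0"
proof (rule weights_empty)
  have "x = 0 - y" using assms(1) by (simp add: eq_neg_iff_add_eq_0)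
  then have "weights x \<subseteq> weights y" using weights_diff[of 0 y] by (simp add: weights_def)
  then show "weights x = {}" using assms by auto
qed

context veronese
begin

text \<open>
  The Veronese module of \<open>J\<close>.
\<close>

definition ideal_mod :: "'k::field pol set \<Rightarrow> bideg \<Rightarrow> 'k pol set" where
  "ideal_mod J c = A c \<inter> J"

lemma A_subset_pol_set: "A c \<subseteq> pol_set n m"
  by (auto simp: mon_mod_def pol_set_def G_def)

lemma A_subset_pol_comp: "A c \<subseteq> pol_comp n m (fst c * int s, snd c * int t)"
  by (auto simp: mon_mod_def pol_set_def G_def pol_comp_def)

lemma graded_submodule_ideal_mod:
  assumes "pol_ideal n m J"
  shows "graded_submodule P act_pol (ideal_mod J)"
proof -
  have A: "graded_submodule P act_pol (A :: bideg \<Rightarrow> 'a pol set)" by (rule graded_submodule_mon_mod) simp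
  have "act_pol g x \<in> J" if "g \<in> P" "x \<in> J" for g x
    unfolding act_pol_def using that P_subset_G[OF that(1)]
    by (intro pol_ideal_mult[OF assms] single_in_pol_set) (auto simp: G_def)
  then show ?thesis
    using graded_submodule_zero[OF A] graded_submodule_diff[OF A] graded_submodule_act[OF A] assms
    unfolding graded_submodule_def ideal_mod_def pol_ideal_def by blast
qed

lemma sum_list_in_G: "set l \<subseteq> P \<Longrightarrow> sum_list l \<in> G"
  by (induction l) (auto intro: G_add P_subset_G)

lemma weights_chains:
  assumes "z \<in> bar_chains P A i e"
  shows "weights z \<subseteq> {\<omega>. (e, \<omega>) \<in> G}"
proof (clarsimp simp: weights_def)
  fix l \<mu> assume \<mu>: "\<mu> \<in> keys (lookup z l)"
  then have l: "l \<in> keys z" by (auto simp: in_keys_iff)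
  have "sum_list l \<in> G" using assms l by (intro sum_list_in_G) (auto simp: bar_chains_def)
  moreover have "(e - fst (sum_list l), \<mu>) \<in> G" using assms l \<mu> by (auto simp: bar_chains_def mon_mod_def)
  ultimately have "sum_list l + (e - fst (sum_list l), \<mu>) \<in> G" by (rule G_add)
  then show "(e, snd (sum_list l) + \<mu>) \<in> G" by (simp add: plus_prod_def)
qed

lemma finite_G_slice: "finite {\<omega>. (e, \<omega>) \<in> G}"
  by (rule finite_subset[OF _ finite_mons_of_bidegree[of n m "(fst e * int s, snd e * int t)"]])
    (auto simp: G_def)

text \<open>
  A multiple of a leading monomial is lifted to the same multiple of a homogeneous element of \<open>J\<close>; the
  error has smaller monomials only.
\<close>

lemma initial_lift:
  assumes J: "pol_ideal n m J" and x: "x \<in> mon_mod (initial_set n m J) c" "x = single \<mu> k"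
  shows "\<exists>y\<in>ideal_mod J c. \<forall>\<nu>\<in>keys (x - y). \<exists>\<mu>\<in>keys x. mon_key \<nu> < mon_key \<mu>"
proof (cases "k = 0")
  case True
  then show ?thesis using x(2) graded_submodule_zero[OF graded_submodule_ideal_mod[OF J]]
    by (intro bexI[of _ 0]) auto
next
  case False
  then have \<mu>: "(c, \<mu>) \<in> G" "\<mu> \<in> initial_set n m J"
    using x by (auto simp: single_in_mon_mod_iff)
  obtain d p where p: "p \<in> J" "p \<in> pol_comp n m d" "is_lead p \<mu>"
    using \<mu> by (auto simp: initial_set_def)
  have d: "d = (fst c * int s, snd c * int t)"
    using p \<mu>(1) by (auto simp: is_lead_def pol_comp_def G_def)
  define y where "y = single 0 (k / lookup p \<mu>) * p"
  have look: "lookup y \<nu> = k / lookup p \<mu> * lookup p \<nu>" for \<nu>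
    using lookup_monom_mult[of 0 "k / lookup p \<mu>" p \<nu>] by (simp add: y_def)
  have keys: "keys y \<subseteq> keys p" by (auto simp: in_keys_iff look)
  have "y \<in> J" unfolding y_def by (intro pol_ideal_mult[OF J] single_in_pol_set p) simp
  moreover have "p \<in> A c"
    using p(2) \<mu>(1) by (auto simp: mon_mod_def pol_comp_def pol_set_def G_def d)
  then have "y \<in> A c" using keys by (auto simp: mon_mod_def)
  ultimately have "y \<in> ideal_mod J c" by (simp add: ideal_mod_def)
  moreover have "\<exists>\<mu>\<in>keys x. mon_key \<nu> < mon_key \<mu>" if "\<nu> \<in> keys (x - y)" for \<nu>
  proof -
    have "lookup p \<mu> \<noteq> 0" using p(3) by (simp add: is_lead_def in_keys_iff)
    then have "lookup (x - y) \<mu> = 0" by (simp add: lookup_minus x(2) look)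
    then have ne: "\<nu> \<noteq> \<mu>" using that by (auto simp: in_keys_iff)
    then have "\<nu> \<in> keys p"
      using that by (auto simp: in_keys_iff lookup_minus x(2) look lookup_single)
    then have "mon_key \<nu> < mon_key \<mu>" using p(3) ne by (simp add: is_lead_def mon_key_less_iff)
    then show ?thesis using x(2) False by auto
  qed
  ultimately show ?thesis by blast
qed

lemma bar_chains_weight_part:
  assumes "z \<in> bar_chains P (mon_mod U) i e" "keys z1 \<subseteq> keys z"
    and "\<And>l. keys (lookup z1 l) \<subseteq> keys (lookup z l)"
  shows "z1 \<in> bar_chains P (mon_mod U) i e"
proof (rule bar_chains_subkeysI[OF assms(1,2)])
  fix l
  have "lookup z l \<in> mon_mod U (e - fst (sum_list l))"
    using assms(1) by (cases "l \<in> keys z") (auto simp: bar_chains_def in_keys_iff)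
  then show "lookup z1 l \<in> mon_mod U (e - fst (sum_list l))"
    using assms(3)[of l] by (auto simp: mon_mod_def)
qed

text \<open>
  Let \<open>\<omega>\<close> be the largest total monomial in a cycle of \<open>J\<close>.  The component in \<open>\<omega>\<close> consists of leading terms
  of the coefficients, so it is a cycle of the initial ideal.  It bounds there a chain \<open>y\<^sub>1\<close> that is
  concentrated in \<open>\<omega>\<close>, and a lift \<open>y\<^sub>2\<close> of this chain to \<open>J\<close> has the same component in \<open>\<omega>\<close>.  Subtracting the
  boundary of \<open>y\<^sub>2\<close> leaves a cycle with smaller total monomials.  There are only finitely many
  monomials of the given bidegree, so this ends.
\<close>

lemma bar_exact_initial:
  fixes J :: "'k::field pol set"
  assumes J: "pol_ideal n m J"
    and init: "bar_exact P act_pol (mon_mod (initial_set n m J) :: bideg \<Rightarrow> 'k pol set) i e"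
  shows "bar_exact P act_pol (ideal_mod J) i e"
proof -
  \<comment> \<open>The monomials of the given bidegree up to the largest weight of \<open>z\<close>; their number decreases.\<close>
  let ?B = "\<lambda>z :: letter list \<Rightarrow>\<^sub>0 'k pol. {\<omega>'. (e, \<omega>') \<in> G \<and> (\<exists>\<omega>\<in>weights z. mon_key \<omega>' \<le> mon_key \<omega>)}"
  note gJ = graded_submodule_ideal_mod[OF J]
  have gU: "graded_submodule P act_pol (mon_mod (initial_set n m J) :: bideg \<Rightarrow> 'k pol set)"
    using initial_set_mult[OF J] by (intro graded_submodule_mon_ideal) (auto simp: mon_ideal_def)
  have fin: "finite (?B z)" for z
    by (rule finite_subset[OF _ finite_G_slice[of e]]) auto
  have "z \<in> bar_diff act_pol ` bar_chains P (ideal_mod J) (Suc i) e"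
    if "z \<in> bar_chains P (ideal_mod J) i e" "bar_diff act_pol z = 0" for z
    using that
  proof (induction "card (?B z)" arbitrary: z rule: less_induct)
    case less
    note z = less.prems(1) and dz = less.prems(2)
    show ?case
    proof (cases "z = 0")
      case True
      then show ?thesis using bar_chains_zero additive.zero[OF pol.additive_bar_diff] by (metis image_eqI)
    next
      case False
      then have "weights z \<noteq> {}" using weights_empty by blast
      then obtain \<omega> where \<omega>: "\<omega> \<in> weights z" "\<And>\<nu>. \<nu> \<in> weights z \<Longrightarrow> mon_key \<nu> \<le> mon_key \<omega>"
        using exists_max_mon_key[OF finite_weights] by metis
      have zA: "z \<in> bar_chains P A i e" by (rule bar_chains_mono[OF z]) (simp add: ideal_mod_def)
      obtain z1 where z1: "keys z1 \<subseteq> keys z"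
        "\<And>l \<mu>. lookup (lookup z1 l) \<mu> =
          (if snd (sum_list l) + \<mu> = \<omega> then lookup (lookup z l) \<mu> else 0)"
        "weights z1 \<subseteq> {\<omega>}" "weights (z - z1) \<subseteq> weights z - {\<omega>}"
        by (rule weight_split[of z \<omega>]) (rule that)
      have dz1: "bar_diff act_pol z1 = 0"
      proof (rule weights_disjoint_zero)
        show "bar_diff act_pol z1 + bar_diff act_pol (z - z1) = 0"
          by (simp add: additive.diff[OF pol.additive_bar_diff] dz)
        show "weights (bar_diff act_pol z1) \<subseteq> {\<omega>}" using weights_bar_diff z1(3) by blast
        show "\<omega> \<notin> weights (bar_diff act_pol (z - z1))" using weights_bar_diff[of "z - z1"] z1(4) by blast
      qed
      have z1U: "z1 \<in> bar_chains P (mon_mod (initial_set n m J)) i e"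
      proof (rule bar_chains_subkeysI[OF z z1(1)])
        fix l
        have zl: "lookup z l \<in> ideal_mod J (e - fst (sum_list l))"
          by (rule bar_chains_lookup[OF gJ z])
        have "(e - fst (sum_list l), \<mu>) \<in> G \<and> \<mu> \<in> initial_set n m J"
          if "\<mu> \<in> keys (lookup z1 l)" for \<mu>
        proof
          from that have \<mu>: "\<mu> \<in> keys (lookup z l)" "snd (sum_list l) + \<mu> = \<omega>"
            by (auto simp: in_keys_iff z1(2) split: if_splits)
          show "(e - fst (sum_list l), \<mu>) \<in> G" using zl \<mu> by (auto simp: ideal_mod_def mon_mod_def)
          have "mon_key \<nu> \<le> mon_key \<mu>" if "\<nu> \<in> keys (lookup z l)" for \<nu>
          proof -
            have "snd (sum_list l) + \<nu> \<in> weights z" using that by (auto simp: weights_def)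
            from \<omega>(2)[OF this] show ?thesis unfolding \<mu>(2)[symmetric] mon_key_add_le .
          qed
          then have "is_lead (lookup z l) \<mu>" using \<mu>(1) by (simp add: is_lead_def)
          then show "\<mu> \<in> initial_set n m J"
            using zl A_subset_pol_comp unfolding initial_set_def ideal_mod_def by blast
        qed
        then show "lookup z1 l \<in> mon_mod (initial_set n m J) (e - fst (sum_list l))"
          by (simp add: mon_mod_def)
      qed
      obtain y where y: "y \<in> bar_chains P (mon_mod (initial_set n m J)) (Suc i) e" "bar_diff act_pol y = z1"
        by (rule bar_exactD[OF init z1U dz1])
      obtain y1 where y1: "keys y1 \<subseteq> keys y"
        "\<And>l \<mu>. lookup (lookup y1 l) \<mu> =
          (if snd (sum_list l) + \<mu> = \<omega> then lookup (lookup y l) \<mu> else 0)"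
        "weights y1 \<subseteq> {\<omega>}" "weights (y - y1) \<subseteq> weights y - {\<omega>}"
        by (rule weight_split[of y \<omega>]) (rule that)
      have dy1: "bar_diff act_pol y1 = z1"
      proof -
        have "bar_diff act_pol y1 - z1 = 0"
        proof (rule weights_disjoint_zero)
          show "bar_diff act_pol y1 - z1 + bar_diff act_pol (y - y1) = 0"
            by (simp add: additive.diff[OF pol.additive_bar_diff] y)
          show "weights (bar_diff act_pol y1 - z1) \<subseteq> {\<omega>}"
            using weights_diff[of "bar_diff act_pol y1" z1] weights_bar_diff[of y1] y1(3) z1(3) by blast
          show "\<omega> \<notin> weights (bar_diff act_pol (y - y1))"
            using weights_bar_diff[of "y - y1"] y1(4) by blast
        qed
        then show ?thesis by simp
      qed
      have y1U: "y1 \<in> bar_chains P (mon_mod (initial_set n m J)) (Suc i) e"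
        by (rule bar_chains_weight_part[OF y(1) y1(1)]) (auto simp: in_keys_iff y1(2) split: if_splits)
      let ?N = "\<lambda>c. {x \<in> mon_mod (initial_set n m J) c. \<exists>\<mu> k. x = single \<mu> k}"
      have y1N: "y1 \<in> bar_chains P ?N (Suc i) e"
      proof (rule bar_chains_subkeysI[OF y1U subset_refl])
        fix l
        have "\<exists>\<mu> k. lookup y1 l = single \<mu> k"
        proof (cases "\<exists>\<mu>. snd (sum_list l) + \<mu> = \<omega>")
          case True
          then obtain \<mu> where \<mu>: "snd (sum_list l) + \<mu> = \<omega>" by blast
          then have uniq: "snd (sum_list l) + \<nu> = \<omega> \<longleftrightarrow> \<nu> = \<mu>" for \<nu> by auto
          have "lookup y1 l = single \<mu> (lookup (lookup y l) \<mu>)"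
            by (rule poly_mapping_eqI) (auto simp: y1(2) uniq lookup_single when_def)
          then show ?thesis by blast
        next
          case False
          then have "lookup y1 l = single 0 0"
            by (intro poly_mapping_eqI) (simp add: y1(2))
          then show ?thesis by blast
        qed
        then show "lookup y1 l \<in> ?N (e - fst (sum_list l))"
          using bar_chains_lookup[OF gU y1U] by blast
      qed
      let ?R = "\<lambda>x y :: 'k pol. \<forall>\<nu>\<in>keys (x - y). \<exists>\<mu>\<in>keys x. mon_key \<nu> < mon_key \<mu>"
      obtain y2 where y2: "y2 \<in> bar_chains P (ideal_mod J) (Suc i) e"
        "\<And>l. ?R (lookup y1 l) (lookup y2 l)"
      proof (rule bar_chains_choice[OF y1N, of "ideal_mod J" "\<lambda>c. ?R"])
        show "\<exists>y\<in>ideal_mod J c. ?R x y" if x: "x \<in> ?N c" for c x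
        proof -
          obtain \<mu> k where "x = single \<mu> k" using x by blast
          with x show ?thesis by (intro initial_lift[OF J]) blast+
        qed
      qed auto
      have small: "mon_key \<nu> < mon_key \<omega>" if \<nu>: "\<nu> \<in> weights (y1 - y2)" for \<nu>
      proof -
        obtain l \<kappa> where \<kappa>: "\<nu> = snd (sum_list l) + \<kappa>" "\<kappa> \<in> keys (lookup y1 l - lookup y2 l)"
          using \<nu> unfolding weights_def lookup_minus by blast
        obtain \<mu> where \<mu>: "\<mu> \<in> keys (lookup y1 l)" "mon_key \<kappa> < mon_key \<mu>"
          using y2(2)[of l] \<kappa>(2) by blast
        then have "snd (sum_list l) + \<mu> = \<omega>" by (auto simp: in_keys_iff y1(2) split: if_splits)
        then show ?thesis using \<mu>(2) unfolding \<kappa>(1) by (metis mon_key_add_less)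
      qed
      define z' where "z' = z - bar_diff act_pol y2"
      have z': "z' \<in> bar_chains P (ideal_mod J) i e"
        unfolding z'_def by (intro bar_chains_diff[OF gJ] z pol.bar_diff_chains[OF gJ] y2)
      have dz': "bar_diff act_pol z' = 0"
        by (simp add: z'_def additive.diff[OF pol.additive_bar_diff] dz pol.bar_diff_bar_diff)
      have z'_eq: "z' = (z - z1) + bar_diff act_pol (y1 - y2)"
        by (simp add: z'_def additive.diff[OF pol.additive_bar_diff] dy1)
      have less': "mon_key \<nu> < mon_key \<omega>" if "\<nu> \<in> weights z'" for \<nu>
      proof -
        have "\<nu> \<in> weights (z - z1) \<or> \<nu> \<in> weights (y1 - y2)"
          using that weights_add[of "z - z1" "bar_diff act_pol (y1 - y2)"] weights_bar_diff[of "y1 - y2"]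
          unfolding z'_eq by blast
        then show ?thesis using small \<omega>(2) z1(4) by (auto simp: mon_key_less_iff)
      qed
      have "?B z' \<subset> ?B z"
      proof
        show "?B z' \<subseteq> ?B z"
        proof
          fix x assume x: "x \<in> ?B z'"
          then obtain \<nu> where "\<nu> \<in> weights z'" "mon_key x \<le> mon_key \<nu>" by blast
          then have "mon_key x \<le> mon_key \<omega>" using less'[of \<nu>] by simp
          then show "x \<in> ?B z" using x \<omega>(1) by blast
        qed
        have "\<omega> \<in> ?B z" using \<omega>(1) weights_chains[OF zA] by auto
        moreover have "\<omega> \<notin> ?B z'" using less' by (auto simp: not_le)
        ultimately show "?B z' \<noteq> ?B z" by blast
      qed
      then have "card (?B z') < card (?B z)" using fin by (simp add: psubset_card_mono)
      from less.hyps[OF this z' dz'] obtain x where x: "x \<in> bar_chains P (ideal_mod J) (Suc i) e" "z' = bar_diff act_pol x"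
        by blast
      have "z = bar_diff act_pol (x + y2)"
        using x(2) by (simp add: additive.add[OF pol.additive_bar_diff] z'_def algebra_simps)
      then show ?thesis using bar_chains_add[OF gJ x(1) y2(1)] by blast
    qed
  qed
  then show ?thesis unfolding bar_exact_def by blast
qed

end

section \<open>The bar complex of an arbitrary ideal\<close>

lemma multiples_Int: "multiples \<mu> \<inter> multiples \<nu> = multiples (\<mu> + (\<nu> - \<mu>))"
proof -
  have "lookup (\<mu> + (\<nu> - \<mu>)) k = max (lookup \<mu> k) (lookup \<nu> k)" for k
    by (simp add: lookup_add lookup_minus)
  then show ?thesis by (auto simp: multiples_def)
qed

text \<open>
  The generator is the least common multiple.  The product of all the given monomials (written
  additively) is one of its multiples, which bounds its degrees.
\<close>

lemma multiples_INT:
  assumes "finite T"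
  shows "\<exists>\<tau>. (\<Inter>\<mu>\<in>T. multiples \<mu>) = multiples \<tau> \<and> \<Sum>T \<in> multiples \<tau>"
  using assms
proof (induction T rule: finite_induct)
  case empty
  show ?case by (intro exI[of _ 0]) (auto simp: multiples_def)
next
  case (insert \<mu> T)
  then obtain \<tau> where \<tau>: "(\<Inter>\<mu>\<in>T. multiples \<mu>) = multiples \<tau>" "\<Sum>T \<in> multiples \<tau>" by blast
  have "lookup (\<mu> + (\<tau> - \<mu>)) k \<le> lookup (\<Sum>(insert \<mu> T)) k" for k
    using \<tau>(2)[unfolded multiples_def, simplified, rule_format, of k] insert.hyps
    by (simp add: lookup_add lookup_minus)
  then show ?case
    using \<tau>(1) multiples_Int[of \<mu> \<tau>] by (intro exI[of _ "\<mu> + (\<tau> - \<mu>)"]) (auto simp: multiples_def)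
qed

lemma initial_set_vars:
  fixes J :: "'k::field pol set"
  assumes "\<mu> \<in> initial_set n m J"
  shows "keys \<mu> \<subseteq> vars n m"
proof -
  obtain d and p :: "'k pol" where "p \<in> pol_comp n m d" "is_lead p \<mu>"
    using assms unfolding initial_set_def by blast
  then show ?thesis unfolding pol_comp_def pol_set_def is_lead_def by blast
qed

lemma initial_set_finite_generators:
  fixes J :: "'k::field pol set"
  shows "\<exists>M\<subseteq>initial_set n m J. finite M \<and> (\<forall>\<mu>\<in>initial_set n m J. \<exists>\<nu>\<in>M. \<mu> \<in> multiples \<nu>)"
proof -
  obtain Y where Y: "Y \<subseteq> initial_set n m J" "finite Y"
    "\<forall>\<mu>\<in>initial_set n m J. \<exists>\<nu>\<in>Y. \<forall>k\<in>vars n m. lookup \<nu> k \<le> lookup \<mu> k"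
    using dickson[of "vars n m" "initial_set n m J" "\<lambda>k \<mu>. lookup \<mu> k"] by auto
  have le: "lookup \<nu> k \<le> lookup \<mu> k"
    if "\<nu> \<in> Y" "\<forall>k\<in>vars n m. lookup \<nu> k \<le> lookup \<mu> k" for \<mu> \<nu> k
  proof (cases "k \<in> vars n m")
    case False
    then have "k \<notin> keys \<nu>" using initial_set_vars[of \<nu> n m J] that(1) Y(1) by blast
    then show ?thesis by (simp add: in_keys_iff)
  qed (use that in blast)
  have "\<forall>\<mu>\<in>initial_set n m J. \<exists>\<nu>\<in>Y. \<mu> \<in> multiples \<nu>"
  proof
    fix \<mu> assume "\<mu> \<in> initial_set n m J"
    from bspec[OF Y(3) this] obtain \<nu> where \<nu>: "\<nu> \<in> Y"
      "\<forall>k\<in>vars n m. lookup \<nu> k \<le> lookup \<mu> k" by (rule bexE)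
    then have "\<mu> \<in> multiples \<nu>" using le[OF \<nu>] by (simp add: multiples_def)
    then show "\<exists>\<nu>\<in>Y. \<mu> \<in> multiples \<nu>" using \<nu>(1) by (rule bexI)
  qed
  then show ?thesis using Y(1,2) by (intro exI[of _ Y] conjI)
qed

lemma ceil_div_le_1: "a \<le> s \<Longrightarrow> ceil_div a s \<le> 1"
  using ceil_div_le_iff[of s a 1] by (cases "s > 0") auto

text \<open>
  All least common multiples of generators of the initial ideal divide the product of the generators.
  If \<open>s\<close> is at least the \<open>x\<close>-degree of this product, then \<open>\<lceil>a/s\<rceil> \<le> 1\<close> for each of them.  The bound for the
  intersection of \<open>c\<close> principal ideals in homological degree \<open>i + 1 - c\<close> is then at most
  \<open>i + 2 - c \<le> i + 1\<close>.  The same computation applies to \<open>t\<close> and the \<open>y\<close>-degree.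
\<close>

lemma (in veronese) bar_exact_ideal_mod:
  fixes J :: "'k::field pol set"
  assumes J: "pol_ideal n m J"
    and M0: "finite M0" "M0 \<subseteq> initial_set n m J" "\<And>\<mu>. \<mu> \<in> initial_set n m J \<Longrightarrow> \<exists>\<nu>\<in>M0. \<mu> \<in> multiples \<nu>"
    and e: "fst (bidegree n m (\<Sum>M0)) \<le> int s \<and> fst e > int i + 1 \<or>
      snd (bidegree n m (\<Sum>M0)) \<le> int t \<and> snd e > int i + 1"
  shows "bar_exact P act_pol (ideal_mod J) i e"
proof (rule bar_exact_initial[OF J])
  have vars: "keys \<nu> \<subseteq> vars n m" if "\<nu> \<in> initial_set n m J" for \<nu>
    using that by (rule initial_set_vars)
  have "bar_exact P act_pol (mon_mod (\<Union>\<mu>\<in>M0. multiples \<mu>) :: bideg \<Rightarrow> 'k pol set) i e"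
  proof (rule bar_exact_UN[OF M0(1) mon_ideal_multiples])
    fix T assume T: "T \<subseteq> M0" "T \<noteq> {}" "card T \<le> Suc i"
    have fT: "finite T" using T(1) M0(1) finite_subset by blast
    obtain \<tau> where \<tau>: "(\<Inter>\<mu>\<in>T. multiples \<mu>) = multiples \<tau>" "\<Sum>T \<in> multiples \<tau>" using multiples_INT[OF fT] by blast
    have "\<Sum>M0 = \<Sum>T + \<Sum>(M0 - T)" using T(1) M0(1) by (metis add.commute sum.subset_diff)
    then have le: "\<Sum>M0 \<in> multiples \<tau>" using \<tau>(2) by (auto simp: multiples_def lookup_add intro: trans_le_add1)
    have "keys (\<Sum>M0) \<subseteq> vars n m"
      using keys_sum_subset[of "\<lambda>x. x" M0] vars M0(2) by blast
    moreover have "keys \<tau> \<subseteq> keys (\<Sum>M0)"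
    proof
      fix k assume "k \<in> keys \<tau>"
      moreover have "lookup \<tau> k \<le> lookup (\<Sum>M0) k" using le by (simp add: multiples_def)
      ultimately show "k \<in> keys (\<Sum>M0)" by (simp add: in_keys_iff)
    qed
    ultimately have keys: "keys \<tau> \<subseteq> vars n m" by blast
    define a b where "a = nat (fst (bidegree n m \<tau>))" and "b = nat (snd (bidegree n m \<tau>))"
    have ab: "bidegree n m \<tau> = (int a, int b)"
      using bidegree_nonneg[of n m \<tau>] by (simp add: a_def b_def)
    have card: "card T \<ge> 1" using T(2) fT by (simp add: Suc_le_eq card_gt_0_iff)
    have "fst e > int (Suc i - card T + ceil_div a s) \<or> snd e > int (Suc i - card T + ceil_div b t)"
      using e
    proof
      assume *: "fst (bidegree n m (\<Sum>M0)) \<le> int s \<and> fst e > int i + 1"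
      then have "a \<le> s" using bidegree_mono(1)[OF le, of n m] ab by auto
      then show ?thesis using * card ceil_div_le_1[of a s] by linarith
    next
      assume *: "snd (bidegree n m (\<Sum>M0)) \<le> int t \<and> snd e > int i + 1"
      then have "b \<le> t" using bidegree_mono(2)[OF le, of n m] ab by auto
      then show ?thesis using * card ceil_div_le_1[of b t] by linarith
    qed
    then show "bar_exact P act_pol (mon_mod (\<Inter>\<mu>\<in>T. multiples \<mu>) :: bideg \<Rightarrow> 'k pol set) (Suc i - card T) e"
      unfolding \<tau>(1) by (rule bar_exact_multiples[OF keys ab])
  qed
  moreover have "mon_mod (\<Union>\<mu>\<in>M0. multiples \<mu>) = (mon_mod (initial_set n m J) :: bideg \<Rightarrow> 'k pol set)"
  proof -
    have "\<nu> \<in> (\<Union>\<mu>\<in>M0. multiples \<mu>) \<longleftrightarrow> \<nu> \<in> initial_set n m J" if \<nu>: "(c, \<nu>) \<in> G" for c \<nu>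
    proof
      assume "\<nu> \<in> (\<Union>\<mu>\<in>M0. multiples \<mu>)"
      then obtain \<mu> where \<mu>: "\<mu> \<in> M0" "\<nu> \<in> multiples \<mu>" by blast
      have "keys (\<nu> - \<mu>) \<subseteq> keys \<nu>" by (auto simp: in_keys_iff lookup_minus)
      then have "(\<nu> - \<mu>) + \<mu> \<in> initial_set n m J"
        using \<nu> \<mu>(1) M0(2) by (intro initial_set_mult[OF J]) (auto simp: G_def)
      then show "\<nu> \<in> initial_set n m J" using multiples_add_diff[OF \<mu>(2)] by (simp add: add.commute)
    qed (use M0 in blast)
    then show ?thesis unfolding mon_mod_def by blast
  qed
  ultimately show "bar_exact P act_pol (mon_mod (initial_set n m J) :: bideg \<Rightarrow> 'k pol set) i e" by simp
qed

section \<open>Submodules of free modules are finitely generated\<close>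

definition comb :: "nat \<Rightarrow> (nat \<Rightarrow> 'k::field vec) \<Rightarrow> 'k vec \<Rightarrow> 'k vec" where
  "comb r D v = (\<Sum>k<r. vsmult (lookup v k) (D k))"

lemma additive_comb: "additive (comb r D)"
  by unfold_locales (simp add: comb_def lookup_add vsmult_add_left sum.distrib)

lemma comb_vsmult: "comb r D (vsmult a v) = vsmult a (comb r D v)"
  by (simp add: comb_def vsmult_sum vsmult_vsmult)

lemma comb_single: "k < r \<Longrightarrow> comb r D (single k a) = vsmult a (D k)"
proof -
  assume k: "k < r"
  have "comb r D (single k a) = (\<Sum>i<r. if i = k then vsmult a (D k) else 0)"
    unfolding comb_def by (intro sum.cong refl) (simp add: lookup_single when_def)
  then show ?thesis using k by simp
qed

definition vsupp :: "(nat \<Rightarrow>\<^sub>0 'k::zero pol) \<Rightarrow> (nat \<times> mon) set" where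
  "vsupp v = {(j, \<mu>). \<mu> \<in> keys (lookup v j)}"

definition term_less :: "nat \<times> mon \<Rightarrow> nat \<times> mon \<Rightarrow> bool" where
  "term_less p q \<longleftrightarrow> fst p < fst q \<or> fst p = fst q \<and> mon_key (snd p) < mon_key (snd q)"

lemma vsupp_empty: "vsupp v = {} \<Longrightarrow> v = 0"
  by (rule poly_mapping_eqI, rule poly_mapping_eqI) (auto simp: vsupp_def in_keys_iff)

lemma finite_vsupp: "finite (vsupp v)"
proof -
  have "vsupp v \<subseteq> (SIGMA j:keys v. keys (lookup v j))"
  proof (clarsimp simp: vsupp_def)
    fix j \<mu> assume "\<mu> \<in> keys (lookup v j)"
    then show "j \<in> keys v" by (cases "lookup v j = 0") (auto simp: in_keys_iff)
  qed
  then show ?thesis by (rule finite_subset) auto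
qed

lemma exists_lead_term:
  assumes "v \<noteq> 0"
  obtains j \<mu> where "(j, \<mu>) \<in> vsupp v" "\<And>q. q \<in> vsupp v \<Longrightarrow> q = (j, \<mu>) \<or> term_less q (j, \<mu>)"
proof -
  let ?j = "Max (fst ` vsupp v)"
  have ne: "vsupp v \<noteq> {}" using assms vsupp_empty by blast
  have "?j \<in> fst ` vsupp v" using ne by (intro Max_in) (auto simp: finite_vsupp)
  then have 1: "snd ` {q \<in> vsupp v. fst q = ?j} \<noteq> {}" by auto
  have 2: "finite (snd ` {q \<in> vsupp v. fst q = ?j})"
    by (intro finite_imageI finite_subset[OF _ finite_vsupp[of v]]) auto
  obtain \<mu> where \<mu>: "\<mu> \<in> snd ` {q \<in> vsupp v. fst q = ?j}"
    "\<And>\<nu>. \<nu> \<in> snd ` {q \<in> vsupp v. fst q = ?j} \<Longrightarrow> mon_key \<nu> \<le> mon_key \<mu>"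
    by (rule exists_max_mon_key[OF 2 1]) (rule that)
  show ?thesis
  proof (rule that)
    show "(?j, \<mu>) \<in> vsupp v" using \<mu>(1) by force
    fix q assume q: "q \<in> vsupp v"
    have "fst q \<le> ?j" using q finite_vsupp by (intro Max_ge) auto
    moreover have "mon_key (snd q) \<le> mon_key \<mu>" if "fst q = ?j" using \<mu>(2) that q by blast
    ultimately show "q = (?j, \<mu>) \<or> term_less q (?j, \<mu>)"
      by (auto simp: term_less_def mon_key_less_iff prod_eq_iff)
  qed
qed

context veronese
begin

definition free_submodule :: "nat \<Rightarrow> (nat \<Rightarrow> bideg) \<Rightarrow> (bideg \<Rightarrow> 'k::field vec set) \<Rightarrow> bool" where
  "free_submodule r d Z \<longleftrightarrow>
     (\<forall>c. Z c \<subseteq> free r d c \<and> 0 \<in> Z c \<and> (\<forall>v\<in>Z c. \<forall>w\<in>Z c. v - w \<in> Z c)) \<and>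
     (\<forall>a c e v. a \<in> A c \<longrightarrow> v \<in> Z e \<longrightarrow> vsmult a v \<in> Z (c + e))"

lemma free_add: "v \<in> free r d c \<Longrightarrow> w \<in> free r d c \<Longrightarrow> v + w \<in> free r d c"
  by (rule graded_submodule_add[OF graded_submodule_free])

lemma free_diff: "v \<in> free r d c \<Longrightarrow> w \<in> free r d c \<Longrightarrow> v - w \<in> free r d c"
  by (rule graded_submodule_diff[OF graded_submodule_free])

lemma free_zero [simp]: "0 \<in> free r d c"
  by (rule graded_submodule_zero[OF graded_submodule_free])

lemma free_vsmult:
  assumes "a \<in> A c" "v \<in> free r d e"
  shows "vsmult a v \<in> free r d (c + e)"
proof -
  have "keys (vsmult a v) \<subseteq> keys v" by (auto simp: in_keys_iff)
  moreover have "a * lookup v j \<in> A (c + e - d j)" if "j < r" for j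
    using A_mult[OF assms(1), of "lookup v j" "e - d j"] assms(2) that
    by (simp add: free_def algebra_simps)
  ultimately show ?thesis using assms(2) by (auto simp: free_def)
qed

lemma free_single: "k < r \<Longrightarrow> a \<in> A (c - d k) \<Longrightarrow> single k a \<in> free r d c"
  by (auto simp: free_def lookup_single when_def)

lemma free_sum: "(\<And>i. i \<in> I \<Longrightarrow> f i \<in> free r d c) \<Longrightarrow> sum f I \<in> free r d c"
  by (rule graded_submodule_sum[OF graded_submodule_free])

lemma free_vsupp: "v \<in> free r d c \<Longrightarrow> (j, \<mu>) \<in> vsupp v \<Longrightarrow> j < r \<and> (c - d j, \<mu>) \<in> G"
proof -
  assume v: "v \<in> free r d c" and \<mu>: "(j, \<mu>) \<in> vsupp v"
  have "j \<in> keys v" using \<mu> by (cases "lookup v j = 0") (auto simp: vsupp_def in_keys_iff)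
  then show ?thesis using v \<mu> by (auto simp: free_def vsupp_def mon_mod_def)
qed

lemma finite_free_terms:
  fixes r :: nat
  shows "finite {(j, \<mu>). j < r \<and> (c - d j, \<mu>) \<in> G}"
proof -
  have "{(j, \<mu>). j < r \<and> (c - d j, \<mu>) \<in> G} = (SIGMA j:{..<r}. {\<mu>. (c - d j, \<mu>) \<in> G})" by auto
  then show ?thesis by (simp add: finite_SigmaI finite_G_slice)
qed

lemma comb_free:
  assumes "v \<in> free r' d' c" "\<And>k. k < r' \<Longrightarrow> D k \<in> free r d (d' k)"
  shows "comb r' D v \<in> free r d c"
  unfolding comb_def
proof (intro free_sum)
  fix k assume "k \<in> {..<r'}"
  then show "vsmult (lookup v k) (D k) \<in> free r d c"
    using free_vsmult[of "lookup v k" "c - d' k" "D k" r d "d' k"] assms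
    by (simp add: free_def)
qed

text \<open>
  One step of the division algorithm: a suitable multiple of \<open>w\<close> cancels the leading term of \<open>v\<close>.
\<close>

lemma lead_reduction:
  fixes v w :: "'k::field vec"
  assumes v: "(j, \<mu>) \<in> vsupp v" "\<And>q. q \<in> vsupp v \<Longrightarrow> q = (j, \<mu>) \<or> term_less q (j, \<mu>)"
    and w: "(j, \<nu>) \<in> vsupp w" "\<And>q. q \<in> vsupp w \<Longrightarrow> q = (j, \<nu>) \<or> term_less q (j, \<nu>)"
    and \<mu>\<nu>: "\<mu> \<in> multiples \<nu>"
  shows "\<exists>k. \<forall>q\<in>vsupp (v - vsmult (single (\<mu> - \<nu>) k) w). term_less q (j, \<mu>)"
proof -
  define k where "k = lookup (lookup v j) \<mu> / lookup (lookup w j) \<nu>"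
  define x where "x = v - vsmult (single (\<mu> - \<nu>) k) w"
  have eq: "\<mu> = (\<mu> - \<nu>) + \<nu>" using multiples_add_diff[OF \<mu>\<nu>] by (simp add: add.commute)
  have "lookup (single (\<mu> - \<nu>) k * lookup w j) \<mu> =
      k * lookup (lookup w j) \<nu>"
    using lookup_monom_mult[of "\<mu> - \<nu>" k "lookup w j" \<nu>] eq by simp
  then have cancel: "lookup (lookup x j) \<mu> = 0"
    using w(1) by (simp add: x_def k_def lookup_minus vsupp_def in_keys_iff)
  have "term_less q (j, \<mu>)" if q: "q \<in> vsupp x" for q
  proof -
    obtain j' \<kappa> where q': "q = (j', \<kappa>)" by (cases q)
    have ne: "q \<noteq> (j, \<mu>)" using q cancel by (auto simp: vsupp_def in_keys_iff)
    have "\<kappa> \<in> keys (lookup v j') \<or>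
        \<kappa> \<in> keys (single (\<mu> - \<nu>) k * lookup w j')"
      using q keys_minus_subset[of "lookup v j'" "single (\<mu> - \<nu>) k * lookup w j'"]
      by (auto simp: vsupp_def q' x_def lookup_minus)
    then show ?thesis
    proof
      assume "\<kappa> \<in> keys (lookup v j')"
      then have "q \<in> vsupp v" by (simp add: vsupp_def q')
      then show ?thesis using v(2) ne by blast
    next
      assume "\<kappa> \<in> keys (single (\<mu> - \<nu>) k * lookup w j')"
      then obtain \<kappa>' where \<kappa>': "\<kappa> = (\<mu> - \<nu>) + \<kappa>'" "\<kappa>' \<in> keys (lookup w j')"
        using keys_single_mult by blast
      then have "(j', \<kappa>') \<in> vsupp w" by (simp add: vsupp_def)
      then have "(j', \<kappa>') = (j, \<nu>) \<or> term_less (j', \<kappa>') (j, \<nu>)" by (rule w(2))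
      moreover have "mon_key ((\<mu> - \<nu>) + \<kappa>') < mon_key \<mu> \<longleftrightarrow> mon_key \<kappa>' < mon_key \<nu>"
        by (metis eq mon_key_add_less)
      ultimately have "q = (j, (\<mu> - \<nu>) + \<nu>) \<or> term_less q (j, \<mu>)"
        by (auto simp: q' \<kappa>'(1) term_less_def)
      then show ?thesis using ne eq by metis
    qed
  qed
  then show ?thesis unfolding x_def by blast
qed

text \<open>
  A finite Groebner basis.  Dickson's lemma is applied to the leading terms of the homogeneous elements
  of \<open>Z\<close>; a generator whose leading term is below another one in all coordinates divides it in \<open>A\<close>, so
  division reduces every element to zero.  The two components of the index \<open>c\<close> are coordinates as well,
  since divisibility in \<open>A\<close> requires that the quotient has a nonnegative index.
\<close>

lemma free_submodule_finitely_generated: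
  fixes Z :: "bideg \<Rightarrow> 'k::field vec set"
  assumes Z: "free_submodule r d Z"
  obtains r' d' D where "\<And>k. k < r' \<Longrightarrow> D k \<in> Z (d' k)" "\<And>c. comb r' D ` free r' d' c = Z c"
proof -
  have sub: "Z c \<subseteq> free r d c" and zero: "0 \<in> Z c" and diff: "v \<in> Z c \<Longrightarrow> w \<in> Z c \<Longrightarrow> v - w \<in> Z c"
    and mult: "a \<in> A c \<Longrightarrow> v \<in> Z e \<Longrightarrow> vsmult a v \<in> Z (c + e)" for a c e v w
    using Z unfolding free_submodule_def by blast+
  have add: "v + w \<in> Z c" if "v \<in> Z c" "w \<in> Z c" for v w c
    using diff[OF that(1) diff[OF zero that(2)]] by simp
  define X where "X = {(c, v, j, \<mu>). v \<in> Z c \<and> (j, \<mu>) \<in> vsupp v \<and>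
      (\<forall>q\<in>vsupp v. q = (j, \<mu>) \<or> term_less q (j, \<mu>))}"
  \<comment> \<open>The coordinates \<open>j\<close> and \<open>r - j\<close> can only be both smaller if the positions agree.\<close>
  define \<phi> :: "nat + nat + nat \<Rightarrow> bideg \<times> 'k vec \<times> nat \<times> mon \<Rightarrow> nat" where
    "\<phi> i = (\<lambda>(c, v, j, \<mu>). case i of Inr k \<Rightarrow> lookup \<mu> k
       | Inl i \<Rightarrow> (if i = 0 then nat (fst (c - d j)) else if i = 1 then nat (snd (c - d j))
           else if i = 2 then j else r - j))" for i
  obtain Y where Y: "Y \<subseteq> X" "finite Y"
    "\<forall>x\<in>X. \<exists>y\<in>Y. \<forall>i\<in>Inl ` {..<4} \<union> Inr ` vars n m. \<phi> i y \<le> \<phi> i x"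
    using dickson[of "Inl ` {..<4} \<union> Inr ` vars n m" X \<phi>] by auto
  obtain h where h: "bij_betw h {0..<card Y} Y" using ex_bij_betw_nat_finite[OF Y(2)] by blast
  define D where "D k = fst (snd (h k))" for k
  define d' where "d' k = fst (h k)" for k
  have hY: "h k \<in> Y" if "k < card Y" for k using h that by (auto simp: bij_betw_def)
  have D: "D k \<in> Z (d' k)" if "k < card Y" for k
    using hY[OF that] Y(1) by (auto simp: X_def D_def d'_def)
  have red: "\<exists>k<card Y. \<exists>u q. (c - d' k, u) \<in> G \<and>
      (\<forall>p\<in>vsupp (v - vsmult (single u q) (D k)). term_less p (j, \<mu>))"
    if x: "(c, v, j, \<mu>) \<in> X" for c v j \<mu>
  proof -
    obtain y where y: "y \<in> Y" "\<forall>i\<in>Inl ` {..<4} \<union> Inr ` vars n m. \<phi> i y \<le> \<phi> i (c, v, j, \<mu>)"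
      using Y(3) x by blast
    obtain k where k: "k < card Y" "h k = y" using h y(1) by (force simp: bij_betw_def)
    obtain c0 w j0 \<nu> where y0: "y = (c0, w, j0, \<nu>)" by (cases y) auto
    have x': "v \<in> Z c" "(j, \<mu>) \<in> vsupp v" "\<And>q. q \<in> vsupp v \<Longrightarrow> q = (j, \<mu>) \<or> term_less q (j, \<mu>)"
      using x by (auto simp: X_def)
    have y': "w \<in> Z c0" "(j0, \<nu>) \<in> vsupp w" "\<And>q. q \<in> vsupp w \<Longrightarrow> q = (j0, \<nu>) \<or> term_less q (j0, \<nu>)"
      using y(1) Y(1) by (auto simp: X_def y0)
    have jr: "j < r" "(c - d j, \<mu>) \<in> G" using free_vsupp x' sub by blast+
    have j0r: "j0 < r" "(c0 - d j0, \<nu>) \<in> G" using free_vsupp y' sub by blast+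
    have i: "\<phi> (Inl i) y \<le> \<phi> (Inl i) (c, v, j, \<mu>)" if "i < 4" for i using y(2) that by blast
    have "j0 \<le> j" "r - j0 \<le> r - j" using i[of 2] i[of 3] by (simp_all add: \<phi>_def y0)
    then have j0: "j0 = j" using jr j0r by simp
    have "lookup \<nu> i \<le> lookup \<mu> i" for i
    proof (cases "i \<in> vars n m")
      case True
      then show ?thesis using y(2) by (auto simp: \<phi>_def y0 dest!: bspec[of _ _ "Inr i"])
    next
      case False
      then have "i \<notin> keys \<nu>" using j0r(2) by (auto simp: G_def)
      then show ?thesis by (simp add: in_keys_iff)
    qed
    then have \<mu>\<nu>: "\<mu> \<in> multiples \<nu>" by (simp add: multiples_def)
    have "fst (c0 - d j) \<le> fst (c - d j)" "snd (c0 - d j) \<le> snd (c - d j)"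
      using i[of 0] i[of 1] G_fst[OF jr(2)] G_fst[OF j0r(2)] by (simp_all add: \<phi>_def y0 j0, arith+)
    then have "(c - d j - (c0 - d j), \<mu> - \<nu>) \<in> G"
      using jr(2) j0r(2) \<mu>\<nu> unfolding j0 by (intro G_diff) auto
    moreover have "c - d j - (c0 - d j) = c - d' k" by (simp add: d'_def k(2) y0)
    ultimately have "(c - d' k, \<mu> - \<nu>) \<in> G" by metis
    moreover have "\<exists>q. \<forall>p\<in>vsupp (v - vsmult (single (\<mu> - \<nu>) q) w). term_less p (j, \<mu>)"
      by (rule lead_reduction) (fact x'(2) x'(3) y'(2)[unfolded j0] y'(3)[unfolded j0] \<mu>\<nu>)+
    moreover have "D k = w" by (simp add: D_def k(2) y0)
    ultimately show ?thesis using k(1) by blast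
  qed
  let ?B = "\<lambda>c v. {p \<in> {(j, \<mu>). j < r \<and> (c - d j, \<mu>) \<in> G}. \<exists>q\<in>vsupp v. p = q \<or> term_less p q}"
  have gen: "v \<in> comb (card Y) D ` free (card Y) d' c" if "v \<in> Z c" for v c
    using that
  proof (induction "card (?B c v)" arbitrary: v rule: less_induct)
    case less
    show ?case
    proof (cases "v = 0")
      case True
      then show ?thesis by (intro image_eqI[of _ _ 0]) (auto simp: additive.zero[OF additive_comb])
    next
      case False
      then obtain j \<mu> where lead: "(j, \<mu>) \<in> vsupp v" "\<And>q. q \<in> vsupp v \<Longrightarrow> q = (j, \<mu>) \<or> term_less q (j, \<mu>)"
        by (rule exists_lead_term) (rule that)
      then have "(c, v, j, \<mu>) \<in> X" using less.prems by (auto simp: X_def)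
      then obtain k u q where k: "k < card Y" "(c - d' k, u) \<in> G"
        "\<forall>p\<in>vsupp (v - vsmult (single u q) (D k)). term_less p (j, \<mu>)"
        using red by blast
      define v' where "v' = v - vsmult (single u q) (D k)"
      have uA: "single u q \<in> A (c - d' k)" using k(2) by (simp add: single_in_mon_mod)
      have "vsmult (single u q) (D k) \<in> Z (c - d' k + d' k)"
        using uA D[OF k(1)] by (rule mult)
      then have v'Z: "v' \<in> Z c" using less.prems unfolding v'_def by (intro diff) auto
      have small: "term_less p (j, \<mu>)" if "p \<in> vsupp v'" for p using k(3) that by (simp add: v'_def)
      have "?B c v' \<subset> ?B c v"
      proof
        show "?B c v' \<subseteq> ?B c v"
        proof
          fix p assume p: "p \<in> ?B c v'"
          then obtain q where "q \<in> vsupp v'" "p = q \<or> term_less p q" by blast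
          then have "term_less p (j, \<mu>)" using small[of q] by (auto simp: term_less_def)
          then show "p \<in> ?B c v" using p lead(1) by blast
        qed
        have "(j, \<mu>) \<in> ?B c v" using lead(1) free_vsupp less.prems sub by blast
        moreover have "(j, \<mu>) \<notin> ?B c v'"
        proof
          assume "(j, \<mu>) \<in> ?B c v'"
          then obtain q where "q \<in> vsupp v'" "(j, \<mu>) = q \<or> term_less (j, \<mu>) q" by blast
          then show False using small[of q] by (auto simp: term_less_def)
        qed
        ultimately show "?B c v' \<noteq> ?B c v" by blast
      qed
      moreover have "finite (?B c v)" using finite_free_terms[of r c d] by simp
      ultimately have "card (?B c v') < card (?B c v)" by (simp add: psubset_card_mono)
      from less.hyps[OF this v'Z] obtain a where a: "a \<in> free (card Y) d' c" "v' = comb (card Y) D a" by blast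
      have "a + single k (single u q) \<in> free (card Y) d' c"
        using a(1) k(1) uA by (intro free_add free_single)
      moreover have "v = comb (card Y) D (a + single k (single u q))"
        using a(2) by (simp add: additive.add[OF additive_comb] comb_single[OF k(1)] v'_def algebra_simps)
      ultimately show ?thesis by blast
    qed
  qed
  moreover have "comb (card Y) D a \<in> Z c" if "a \<in> free (card Y) d' c" for a c
  proof -
    have *: "vsmult (lookup a k) (D k) \<in> Z c" if "k < card Y" for k
      using mult[of "lookup a k" "c - d' k" "D k" "d' k"] D[OF that] \<open>a \<in> _\<close> that
      by (simp add: free_def)
    have "(\<And>k. k \<in> I \<Longrightarrow> f k \<in> Z c) \<Longrightarrow> sum f I \<in> Z c" for f and I :: "nat set"
      by (induction I rule: infinite_finite_induct) (auto intro: zero add)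
    from this[of "{..<card Y}" "\<lambda>k. vsmult (lookup a k) (D k)"]
    show ?thesis unfolding comb_def by (simp add: *)
  qed
  ultimately have "comb (card Y) D ` free (card Y) d' c = Z c" for c by blast
  then show ?thesis using D by (intro that[of "card Y" D d'])
qed

end

section \<open>Chains of syzygies\<close>

context veronese
begin

abbreviation S_ver :: "('k::field, 'k pol) bg_algebra" where
  "S_ver \<equiv> pol_veronese n m (s, t)"

abbreviation R_ver :: "'k::field pol set \<Rightarrow> ('k pol, 'k pol set) bg_module" where
  "R_ver J \<equiv> quot_veronese n m J (s, t)"

text \<open>
  A component is determined by its monomials: it is zero unless both indices are nonnegative.
\<close>

lemma acomp_pol_veronese: "acomp S_ver c = A c"
proof -
  have "pol_comp n m (fst c * int s, snd c * int t) = A c" if "0 \<le> fst c" "0 \<le> snd c"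
    using that by (auto simp: mon_mod_def pol_comp_def pol_set_def G_def)
  moreover have "A c = {0}" if "\<not> (0 \<le> fst c \<and> 0 \<le> snd c)"
  proof -
    have "p = 0" if "p \<in> A c" for p :: "'b pol"
      using that \<open>\<not> _\<close> by (intro poly_mapping_eqI) (force simp: mon_mod_def G_def in_keys_iff)
    then show ?thesis by auto
  qed
  ultimately show ?thesis
    by (cases c) (auto simp: pol_veronese_def veronese_comp_def)
qed

lemma fcomp_pol_veronese: "fcomp S_ver F i = free (rk F i) (dg F i)"
  by (rule ext) (simp add: fcomp_def free_comp_def free_def acomp_pol_veronese)

lemma free_submodule_kernel:
  fixes D :: "nat \<Rightarrow> 'k::field vec"
  shows "free_submodule r d (\<lambda>c. {v \<in> free r d c. comb r D v = 0})"
  unfolding free_submodule_def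
proof (intro conjI allI impI ballI)
  fix a :: "'k pol" and c e v
  assume "a \<in> A c" "v \<in> {v \<in> free r d e. comb r D v = 0}"
  then show "vsmult a v \<in> {v \<in> free r d (c + e). comb r D v = 0}"
    by (simp add: free_vsmult comb_vsmult)
qed (auto simp: additive.zero[OF additive_comb] additive.diff[OF additive_comb] intro: free_diff)

text \<open>
  Generators of \<open>Z\<close>, generators of the relations between them, and so on, by dependent choice.
\<close>

lemma exists_syzygy_chain:
  fixes Z :: "bideg \<Rightarrow> 'k::field vec set"
  assumes Z: "free_submodule r0 d0 Z"
  shows "\<exists>R Dg Df. R 0 = r0 \<and> Dg 0 = d0 \<and>
    (\<forall>c. comb (R 1) (Df 1) ` free (R 1) (Dg 1) c = Z c) \<and>
    (\<forall>i c. comb (R (Suc (Suc i))) (Df (Suc (Suc i))) ` free (R (Suc (Suc i))) (Dg (Suc (Suc i))) c =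
       {v \<in> free (R (Suc i)) (Dg (Suc i)) c. comb (R (Suc i)) (Df (Suc i)) v = 0}) \<and>
    (\<forall>i. \<forall>k<R (Suc i). Df (Suc i) k \<in> free (R i) (Dg i) (Dg (Suc i) k))"
proof -
  let ?P = "\<lambda>i (x :: nat \<times> (nat \<Rightarrow> bideg) \<times> (nat \<Rightarrow> 'k vec) \<times> (bideg \<Rightarrow> 'k vec set)).
    case x of (r, d, D, Y) \<Rightarrow> free_submodule r d Y \<and> (i = (0::nat) \<longrightarrow> r = r0 \<and> d = d0 \<and> Y = Z)"
  let ?Q = "\<lambda>(i :: nat) (x :: nat \<times> (nat \<Rightarrow> bideg) \<times> (nat \<Rightarrow> 'k vec) \<times> (bideg \<Rightarrow> 'k vec set)) y.
    case x of (r, d, D, Y) \<Rightarrow> case y of (r', d', D', Y') \<Rightarrow>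
      (\<forall>k<r'. D' k \<in> free r d (d' k)) \<and> (\<forall>c. comb r' D' ` free r' d' c = Y c) \<and>
      Y' = (\<lambda>c. {v \<in> free r' d' c. comb r' D' v = 0})"
  have "\<exists>f. \<forall>i. ?P i (f i) \<and> ?Q i (f i) (f (Suc i))"
  proof (rule dependent_nat_choice)
    show "\<exists>x. ?P 0 x" using Z by (intro exI[of _ "(r0, d0, undefined, Z)"]) simp
    fix x i assume x: "?P i x"
    obtain r d D Y where x': "x = (r, d, D, Y)" by (cases x) auto
    have Y: "free_submodule r d Y" using x by (simp add: x')
    obtain r' d' D' where D': "\<And>k. k < r' \<Longrightarrow> D' k \<in> Y (d' k)" "\<And>c. comb r' D' ` free r' d' c = Y c"
      by (rule free_submodule_finitely_generated[OF Y]) (rule that)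
    have "Y c \<subseteq> free r d c" for c using Y unfolding free_submodule_def by blast
    then have "\<forall>k<r'. D' k \<in> free r d (d' k)" using D'(1) by blast
    then show "\<exists>y. ?P (Suc i) y \<and> ?Q i x y"
      using D'(2) free_submodule_kernel[of r' d' D']
      by (intro exI[of _ "(r', d', D', \<lambda>c. {v \<in> free r' d' c. comb r' D' v = 0})"]) (simp add: x')
  qed
  then obtain f where "\<forall>i. ?P i (f i) \<and> ?Q i (f i) (f (Suc i))" by (rule exE)
  then have f: "?P i (f i)" "?Q i (f i) (f (Suc i))" for i by simp_all
  define R where "R i = fst (f i)" for i
  define Dg where "Dg i = fst (snd (f i))" for i
  define Df where "Df i = fst (snd (snd (f i)))" for i
  define Y where "Y i = snd (snd (snd (f i)))" for i
  have fi: "f i = (R i, Dg i, Df i, Y i)" for i by (simp add: R_def Dg_def Df_def Y_def)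
  have 0: "R 0 = r0" "Dg 0 = d0" "Y 0 = Z" using f(1)[of 0] by (simp_all add: fi)
  have S: "(\<forall>k<R (Suc i). Df (Suc i) k \<in> free (R i) (Dg i) (Dg (Suc i) k)) \<and>
    (\<forall>c. comb (R (Suc i)) (Df (Suc i)) ` free (R (Suc i)) (Dg (Suc i)) c = Y i c) \<and>
    Y (Suc i) = (\<lambda>c. {v \<in> free (R (Suc i)) (Dg (Suc i)) c. comb (R (Suc i)) (Df (Suc i)) v = 0})" for i
    using f(2)[of i] unfolding fi prod.case .
  note S1 = S[THEN conjunct1] and S2 = S[THEN conjunct2, THEN conjunct1, THEN spec]
    and S3 = S[THEN conjunct2, THEN conjunct2]
  show ?thesis
  proof (intro exI[of _ R] exI[of _ Dg] exI[of _ Df] conjI allI)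
    show "R 0 = r0" "Dg 0 = d0" by (fact 0)+
    show "comb (R 1) (Df 1) ` free (R 1) (Dg 1) c = Z c" for c
      using S2[of 0 c] by (simp only: 0(3) One_nat_def)
    show "comb (R (Suc (Suc i))) (Df (Suc (Suc i))) ` free (R (Suc (Suc i))) (Dg (Suc (Suc i))) c =
       {v \<in> free (R (Suc i)) (Dg (Suc i)) c. comb (R (Suc i)) (Df (Suc i)) v = 0}" for i c
      using S2[of "Suc i" c] by (simp only: S3)
    show "k < R (Suc i) \<longrightarrow> Df (Suc i) k \<in> free (R i) (Dg i) (Dg (Suc i) k)" for i k
      using S1[of i] by blast
  qed
qed

lemma vector_space_kscale: "vector_space (kscale S_ver :: 'k::field \<Rightarrow> _)"
proof -
  have [simp]: "single 0 (1::'k) = 1" by (metis single_one)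
  show ?thesis
    by unfold_locales
      (simp_all add: kscale_def pol_veronese_def vsmult_add single_add vsmult_add_left vsmult_vsmult
        mult_single vsmult_one)
qed

lemma kscale_eq: "kscale S_ver k = vsmult (single 0 k)"
  by (rule ext) (simp add: kscale_def pol_veronese_def)

lemma free_kscale: "v \<in> free r d e \<Longrightarrow> kscale S_ver k v \<in> free r d e"
proof -
  assume v: "v \<in> free r d e"
  have "(0 :: letter) \<in> G" by simp
  then have "single 0 k \<in> A 0" by (intro single_in_mon_mod) (simp_all add: zero_prod_def)
  from free_vsmult[OF this v] show ?thesis by (simp add: kscale_eq)
qed

lemma subspace_free: "module.subspace (kscale S_ver :: 'k::field \<Rightarrow> _) (free r d e)"
proof -
  interpret V: vector_space "kscale S_ver :: 'k \<Rightarrow> _" by (rule vector_space_kscale)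
  show ?thesis by (rule V.subspaceI) (auto intro: free_add free_kscale)
qed

text \<open>
  Expanding \<open>a \<in> A\<^sub>+\<close> into monomials writes \<open>a v\<close> as the boundary of a combination of words of length one;
  so the boundaries in homological degree \<open>0\<close> are the elements of \<open>A\<^sub>+F\<^sub>i\<close>.
\<close>

lemma irr_comp_iff:
  fixes F :: "('k::field pol, 'b) free_complex"
  shows "v \<in> irr_comp S_ver F i e \<longleftrightarrow>
    single [] v \<in> bar_diff act_vec ` bar_chains P (free (rk F i) (dg F i)) 1 e"
proof -
  let ?K = "kscale S_ver :: 'k \<Rightarrow> _"
  let ?F = "free (rk F i) (dg F i) :: bideg \<Rightarrow> 'k vec set"
  let ?S = "{vsmult a v | a v c. c \<noteq> 0 \<and> a \<in> A c \<and> v \<in> ?F (e - c)}"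
  interpret V: vector_space ?K by (rule vector_space_kscale)
  have irr: "irr_comp S_ver F i e = V.span ?S"
    by (simp add: irr_comp_def acomp_pol_veronese fcomp_pol_veronese)
  show ?thesis
  proof
    let ?V = "{v. single [] v \<in> bar_diff act_vec ` bar_chains P ?F 1 e}"
    note gF = graded_submodule_free[of "rk F i" "dg F i"]
    have "V.span ?S \<subseteq> ?V"
    proof (rule V.span_minimal)
      show "V.subspace ?V"
      proof (rule V.subspaceI)
        show "0 \<in> ?V" using bar_chains_zero by (auto simp: image_iff additive.zero[OF vec.additive_bar_diff] intro!: bexI[of _ 0])
      next
        fix x y :: "'k vec" assume "x \<in> ?V" "y \<in> ?V"
        then obtain z w where zw: "z \<in> bar_chains P ?F 1 e" "single [] x = bar_diff act_vec z"
          "w \<in> bar_chains P ?F 1 e" "single [] y = bar_diff act_vec w" by blast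
        have "single [] (x + y) = bar_diff act_vec (z + w)"
          by (simp add: single_add zw(2,4) additive.add[OF vec.additive_bar_diff])
        then show "x + y \<in> ?V"
          using bar_chains_add[OF gF zw(1,3)] by blast
      next
        fix k and x :: "'k vec" assume "x \<in> ?V"
        then obtain z where z: "z \<in> bar_chains P ?F 1 e" "single [] x = bar_diff act_vec z" by blast
        have K: "additive (?K k)" by unfold_locales (simp add: kscale_eq vsmult_add)
        have "bar_diff act_vec (cmap (?K k) z) = cmap (?K k) (bar_diff act_vec z)"
          by (rule bar_diff_cmap[OF vec.bar_axioms vec.bar_axioms K])
            (simp add: kscale_eq act_vec_def vsmult_vsmult mult.commute)
        also have "\<dots> = single [] (?K k x)" by (simp add: cmap_single[OF K] flip: z(2))
        finally have "single [] (?K k x) = bar_diff act_vec (cmap (?K k) z)" by (rule sym)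
        moreover have "cmap (?K k) z \<in> bar_chains P ?F 1 e"
          by (rule bar_chains_cmap[OF K z(1)]) (rule free_kscale)
        ultimately show "?K k x \<in> ?V" by blast
      qed
      show "?S \<subseteq> ?V"
      proof
        fix x assume "x \<in> ?S"
        then obtain a v c where x: "x = vsmult a v" "c \<noteq> 0" "a \<in> A c" "v \<in> ?F (e - c)" by blast
        let ?y = "\<Sum>u\<in>keys a. single [(c, u)] (?K (lookup a u) v)"
        have "?y \<in> bar_chains P ?F 1 e"
          using x by (intro bar_chains_sum[OF gF] bar_chains_single)
            (auto simp: mon_mod_def in_P_iff free_kscale)
        moreover have "bar_diff act_vec ?y = single [] x"
        proof -
          have "bar_diff act_vec ?y =
            (\<Sum>u\<in>keys a. single [] (vsmult (single u (lookup a u)) v))"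
            by (simp add: additive.sum[OF vec.additive_bar_diff] vec.bar_diff_single bar_word_def
                kscale_eq act_vec_def vsmult_vsmult mult_single)
          also have "\<dots> = single [] (vsmult (lin single a) v)"
            by (simp add: lin_def vsmult_sum_left additive.sum[OF additive_single])
          finally show ?thesis by (simp add: lin_single_id x(1))
        qed
        ultimately show "x \<in> ?V" by (metis (mono_tags, lifting) image_eqI mem_Collect_eq)
      qed
    qed
    then show "v \<in> irr_comp S_ver F i e \<Longrightarrow>
        single [] v \<in> bar_diff act_vec ` bar_chains P ?F 1 e"
      unfolding irr by blast
  next
    assume "single [] v \<in> bar_diff act_vec ` bar_chains P ?F 1 e"
    then obtain y where y: "y \<in> bar_chains P ?F 1 e" "single [] v = bar_diff act_vec y" by blast
    have "v = lookup (bar_diff act_vec y) []" by (simp flip: y(2))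
    also have "\<dots> = (\<Sum>l\<in>keys y. lookup (bar_word act_vec l (lookup y l)) [])"
      by (simp add: bar_diff_def lin_def lookup_sum)
    also have "\<dots> \<in> V.span ?S"
    proof (rule V.span_sum)
      fix l assume l: "l \<in> keys y"
      then obtain g where g: "l = [g]" using y(1) by (auto simp: bar_chains_def length_Suc_conv)
      have *: "g \<in> P" "lookup y l \<in> ?F (e - fst g)" using y(1) l by (auto simp: bar_chains_def g)
      have "lookup (bar_word act_vec l (lookup y l)) [] =
          vsmult (monom (snd g)) (lookup y l)"
        by (simp add: bar_word_def g act_vec_def)
      also have "\<dots> \<in> ?S" using * P_fst letter_in_A[OF P_subset_G] by blast
      finally show "lookup (bar_word act_vec l (lookup y l)) [] \<in> V.span ?S"
        by (rule V.span_base)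
    qed
    finally show "v \<in> irr_comp S_ver F i e" unfolding irr .
  qed
qed

end

section \<open>Tor of an arbitrary resolution\<close>

text \<open>
  The augmentation \<open>F\<^sub>0 \<rightarrow> S/J\<close>, lifted to a map into \<open>S\<close> by representatives \<open>p k\<close> of the images of the
  basis elements.
\<close>

definition aug_lift :: "nat \<Rightarrow> (nat \<Rightarrow> 'k::field pol) \<Rightarrow> 'k vec \<Rightarrow> 'k pol" where
  "aug_lift r p v = (\<Sum>k<r. lookup v k * p k)"

lemma additive_aug_lift: "additive (aug_lift r p)"
  by unfold_locales (simp add: aug_lift_def lookup_add distrib_right sum.distrib)

lemma aug_lift_vsmult: "aug_lift r p (vsmult a v) = a * aug_lift r p v"
  by (simp add: aug_lift_def sum_distrib_left mult.assoc)

lemma diff_map_eq_comb: "diff_map F i = comb (rk F i) (dif F i)"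
  by (rule ext) (simp add: diff_map_def comb_def)

text \<open>
  What a resolution \<open>F\<close> of the quotient says about the lifted augmentation.  All modules in
  sight are now submodules of free modules over polynomials, and cosets do not occur.
\<close>

locale cyclic_resolution = veronese n m s t for n m s t :: nat +
  fixes J :: "'k::field pol set" and F :: "('k pol, 'b) free_complex" and p :: "nat \<Rightarrow> 'k pol"
  assumes J: "pol_ideal n m J"
    and p: "k < rk F 0 \<Longrightarrow> p k \<in> A (dg F 0 k)"
    and dif: "k < rk F (Suc i) \<Longrightarrow> dif F (Suc i) k \<in> free (rk F i) (dg F i) (dg F (Suc i) k)"
    and surj: "x \<in> A c \<Longrightarrow> \<exists>v\<in>free (rk F 0) (dg F 0) c. x - aug_lift (rk F 0) p v \<in> J"
    and exact_0: "diff_map F 1 ` free (rk F 1) (dg F 1) c =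
      {v \<in> free (rk F 0) (dg F 0) c. aug_lift (rk F 0) p v \<in> J}"
    and exact_Suc: "diff_map F (Suc (Suc i)) ` free (rk F (Suc (Suc i))) (dg F (Suc (Suc i))) c =
      {v \<in> free (rk F (Suc i)) (dg F (Suc i)) c. diff_map F (Suc i) v = 0}"
begin

abbreviation FF :: "nat \<Rightarrow> bideg \<Rightarrow> 'k vec set" where
  "FF i \<equiv> free (rk F i) (dg F i)"

abbreviation aug_lift_F :: "'k vec \<Rightarrow> 'k pol" where
  "aug_lift_F \<equiv> aug_lift (rk F 0) p"

text \<open>
  The kernel of \<open>F\<^sub>0 \<rightarrow> S/J\<close>, followed by the kernels of the differentials.  The condition is written as
  membership in a submodule to match \<open>lift_boundary\<close>.
\<close>

primrec syz :: "nat \<Rightarrow> bideg \<Rightarrow> 'k vec set" where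
  "syz 0 = (\<lambda>c. {v \<in> FF 0 c. aug_lift_F v \<in> ideal_mod J c})"
| "syz (Suc k) = (\<lambda>c. {v \<in> FF (Suc k) c. diff_map F (Suc k) v \<in> {0}})"

lemma aug_lift_A: "v \<in> FF 0 c \<Longrightarrow> aug_lift_F v \<in> A c"
  unfolding aug_lift_def
proof (intro mon_mod_sum)
  fix k assume v: "v \<in> FF 0 c" and k: "k \<in> {..<rk F 0}"
  then have "lookup v k \<in> A (c - dg F 0 k)" by (simp add: free_def)
  moreover have "p k \<in> A (dg F 0 k)" using k by (simp add: p)
  ultimately have "lookup v k * p k \<in> A (c - dg F 0 k + dg F 0 k)" by (rule A_mult)
  then show "lookup v k * p k \<in> A c" by simp
qed

lemma additive_diff_map: "additive (diff_map F i)"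
  unfolding diff_map_eq_comb by (rule additive_comb)

lemma diff_map_vsmult: "diff_map F i (vsmult a v) = vsmult a (diff_map F i v)"
  unfolding diff_map_eq_comb by (rule comb_vsmult)

lemma diff_map_FF: "v \<in> FF (Suc i) c \<Longrightarrow> diff_map F (Suc i) v \<in> FF i c"
  unfolding diff_map_eq_comb by (rule comb_free) (use dif in auto)

lemma syz_subset: "syz k c \<subseteq> FF k c"
  by (cases k) auto

lemma syz_image: "diff_map F (Suc k) ` FF (Suc k) c = syz k c"
proof (cases k)
  case 0
  then show ?thesis using exact_0[of c] aug_lift_A[of _ c] by (auto simp: ideal_mod_def)
next
  case (Suc i)
  then show ?thesis using exact_Suc[of i c] by simp
qed

lemma graded_submodule_syz: "graded_submodule P act_vec (syz k)"
proof -
  have "v - w \<in> syz k c" if "v \<in> syz k c" "w \<in> syz k c" for v w c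
  proof -
    obtain x y where "x \<in> FF (Suc k) c" "v = diff_map F (Suc k) x" "y \<in> FF (Suc k) c" "w = diff_map F (Suc k) y"
      using \<open>v \<in> _\<close> \<open>w \<in> _\<close> unfolding syz_image[symmetric] by blast
    then have "v - w = diff_map F (Suc k) (x - y)" "x - y \<in> FF (Suc k) c"
      by (simp_all add: additive.diff[OF additive_diff_map] free_diff)
    then show ?thesis unfolding syz_image[symmetric] by blast
  qed
  moreover have "act_vec g v \<in> syz k (c + fst g)" if "g \<in> P" "v \<in> syz k c" for g v c
  proof -
    obtain x where "x \<in> FF (Suc k) c" "v = diff_map F (Suc k) x"
      using \<open>v \<in> _\<close> unfolding syz_image[symmetric] by blast
    then have "act_vec g v = diff_map F (Suc k) (act_vec g x)" "act_vec g x \<in> FF (Suc k) (c + fst g)"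
      using graded_submodule_act[OF graded_submodule_free \<open>g \<in> P\<close>]
      by (simp_all add: act_vec_def diff_map_vsmult)
    then show ?thesis unfolding syz_image[symmetric] by blast
  qed
  moreover have "0 \<in> syz k c" for c
    unfolding syz_image[symmetric]
    by (rule image_eqI[of _ _ 0]) (simp_all add: additive.zero[OF additive_diff_map])
  ultimately show ?thesis unfolding graded_submodule_def by blast
qed

text \<open>
  From the \<open>k\<close>-th to the previous kernel the homological degree goes up by one; after \<open>k + 1\<close> steps the ideal
  is reached, the last step keeping the degree.  For \<open>j > 0\<close> every cycle of \<open>F\<^sub>k\<close> bounds, so the chain \<open>w\<close>
  always exists; for \<open>j = 0\<close> its existence says that an element of the kernel lies in \<open>A\<^sub>+F\<^sub>k\<close>.
\<close>

lemma syz_boundary: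
  fixes \<delta> :: "bideg \<Rightarrow> int"
  assumes ex: "\<And>j e. \<delta> e > int j + 1 \<Longrightarrow> bar_exact P act_pol (ideal_mod J) j e"
    and "\<delta> e > int (j + 1 + k)" "w \<in> bar_chains P (FF k) (Suc j) e" "bar_diff act_vec w \<in> bar_chains P (syz k) j e"
  shows "\<exists>w'\<in>bar_chains P (syz k) (Suc j) e. bar_diff act_vec w' = bar_diff act_vec w"
  using assms(2-)
proof (induction k arbitrary: j w)
  case 0
  have A: "graded_submodule P act_pol (A :: bideg \<Rightarrow> 'k pol set)" by (rule graded_submodule_mon_mod) simp
  have exA: "bar_exact P act_pol (A :: bideg \<Rightarrow> 'k pol set) (Suc j) e"
    using bar_exact_A_shift[of "Suc j" e 0] by simp
  show ?case
    unfolding syz.simps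
  proof (rule lift_boundary[OF vec.bar_axioms pol.bar_axioms additive_aug_lift, where C = A])
    show "aug_lift (rk F 0) p (act_vec g x) = act_pol g (aug_lift (rk F 0) p x)" for g x
      by (simp add: act_vec_def act_pol_def aug_lift_vsmult)
    show "aug_lift_F x \<in> A c" if "x \<in> FF 0 c" for c x using that by (rule aug_lift_A)
    show "ideal_mod J c \<subseteq> A c" for c by (simp add: ideal_mod_def)
    show "\<exists>y\<in>FF 0 c. x - aug_lift_F y \<in> ideal_mod J c" if "x \<in> A c" for c x
      using surj[OF that] aug_lift_A mon_mod_diff[OF that] by (auto simp: ideal_mod_def)
    show "bar_exact P act_pol (ideal_mod J) j e" using 0 by (intro ex) simp
    show "w \<in> bar_chains P (FF 0) (Suc j) e" by (rule 0)
    show "bar_diff act_vec w \<in> bar_chains P (\<lambda>c. {v \<in> FF 0 c. aug_lift_F v \<in> ideal_mod J c}) j e"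
      using 0 by simp
  qed (fact graded_submodule_free A graded_submodule_ideal_mod[OF J] exA)+
next
  case (Suc k)
  have exC: "bar_exact P act_vec (syz k) (Suc j) e"
    unfolding bar_exact_def
  proof (intro ballI impI)
    fix z assume z: "z \<in> bar_chains P (syz k) (Suc j) e" and dz: "bar_diff act_vec z = 0"
    have "z \<in> bar_chains P (FF k) (Suc j) e" by (rule bar_chains_mono[OF z syz_subset])
    then obtain u where u: "u \<in> bar_chains P (FF k) (Suc (Suc j)) e" "bar_diff act_vec u = z"
      using bar_exactD[OF bar_exact_free, of "Suc j"] dz by blast
    then obtain w' where "w' \<in> bar_chains P (syz k) (Suc (Suc j)) e" "bar_diff act_vec w' = z"
      using Suc.IH[of "Suc j" u] Suc.prems(1) z by auto
    then show "z \<in> bar_diff act_vec ` bar_chains P (syz k) (Suc (Suc j)) e" by blast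
  qed
  show ?case
    unfolding syz.simps
  proof (rule lift_boundary[OF vec.bar_axioms vec.bar_axioms additive_diff_map, where C = "syz k"])
    show "diff_map F (Suc k) (act_vec g x) = act_vec g (diff_map F (Suc k) x)" for g x
      by (simp add: act_vec_def diff_map_vsmult)
    show "diff_map F (Suc k) x \<in> syz k c" if "x \<in> FF (Suc k) c" for c x
      unfolding syz_image[symmetric] using that by blast
    show "graded_submodule P act_vec (\<lambda>c. {0 :: 'k vec})"
      by (simp add: graded_submodule_def additive.zero[OF vec.additive_act])
    show "{0} \<subseteq> syz k c" for c using graded_submodule_zero[OF graded_submodule_syz] by simp
    show "\<exists>y\<in>FF (Suc k) c. x - diff_map F (Suc k) y \<in> {0}" if "x \<in> syz k c" for c x
      using that unfolding syz_image[symmetric] by auto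
    show "w \<in> bar_chains P (FF (Suc k)) (Suc j) e" by (rule Suc.prems)
    show "bar_diff act_vec w \<in> bar_chains P (\<lambda>c. {v \<in> FF (Suc k) c. diff_map F (Suc k) v \<in> {0}}) j e"
      using Suc.prems by simp
    show "bar_exact P act_vec (\<lambda>c. {0 :: 'k vec}) j e"
      by (rule vec.bar_exact_trivial) simp
  qed (fact graded_submodule_free graded_submodule_syz exC)+
qed

text \<open>
  For \<open>i > 0\<close> let \<open>v\<close> be a cycle modulo \<open>A\<^sub>+\<close>.  Its differential lies in the kernel and in
  \<open>A\<^sub>+F\<^sub>i\<^sub>-\<^sub>1\<close>, hence in \<open>A\<^sub>+\<close> times the kernel, which is the image of \<open>A\<^sub>+F\<^sub>i\<close>.  So \<open>v\<close> differs
  from an element of \<open>A\<^sub>+F\<^sub>i\<close> by an element of the next kernel.  For \<open>i = 0\<close> the quotient is generated by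
  its unit, which has bidegree \<open>0\<close>.
\<close>

lemma tor_cycles_subset_boundaries:
  fixes \<delta> :: "bideg \<Rightarrow> int"
  assumes ex: "\<And>j e. \<delta> e > int j + 1 \<Longrightarrow> bar_exact P act_pol (ideal_mod J) j e"
    and \<delta>: "\<delta> 0 = 0" "\<delta> e > int i"
  shows "tor_cycles S_ver F i e \<subseteq> tor_boundaries S_ver F i e"
proof
  fix v assume v: "v \<in> tor_cycles S_ver F i e"
  then have vF: "v \<in> FF i e" by (simp add: tor_cycles_def fcomp_pol_veronese)
  have "\<exists>u\<in>irr_comp S_ver F i e. v - u \<in> syz i e"
  proof (cases i)
    case 0
    have "(0 :: letter) \<in> G" by simp
    then have "(1 :: 'k pol) \<in> A 0"
      unfolding single_one[symmetric] by (intro single_in_mon_mod) (simp_all add: zero_prod_def)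
    \<comment> \<open>The element \<open>f\<close> of \<open>F\<^sub>0\<close> lifts the unit of the quotient.\<close>
    from surj[OF this] obtain f where f: "f \<in> FF 0 0" "1 - aug_lift_F f \<in> J" by blast
    define u where "u = vsmult (aug_lift_F v) f"
    have vA: "aug_lift_F v \<in> A e" using vF 0 by (intro aug_lift_A) simp
    have "e \<noteq> 0" using \<delta> 0 by auto
    then have u: "u \<in> irr_comp S_ver F 0 e"
      unfolding irr_comp_def u_def acomp_pol_veronese fcomp_pol_veronese
    proof -
      interpret V: vector_space "kscale S_ver :: 'k \<Rightarrow> _" by (rule vector_space_kscale)
      show "vsmult (aug_lift_F v) f \<in> V.span {vsmult a v |a v c. c \<noteq> 0 \<and> a \<in> A c \<and> v \<in> FF 0 (e - c)}"
        using vA f(1) \<open>e \<noteq> 0\<close>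
        by (intro V.span_base CollectI exI[of _ "aug_lift_F v"] exI[of _ f] exI[of _ e]) simp
    qed
    have "u \<in> FF 0 (e + 0)" unfolding u_def by (rule free_vsmult[OF vA f(1)])
    then have "v - u \<in> FF 0 e" using vF 0 by (simp add: free_diff)
    moreover have "aug_lift_F (v - u) = aug_lift_F v * (1 - aug_lift_F f)"
      by (simp add: additive.diff[OF additive_aug_lift] u_def aug_lift_vsmult right_diff_distrib)
    then have "aug_lift_F (v - u) \<in> J"
      using pol_ideal_mult[OF J _ f(2)] vA A_subset_pol_set by (metis subsetD)
    ultimately have "v - u \<in> syz 0 e" using aug_lift_A by (simp add: ideal_mod_def)
    then show ?thesis using u 0 by blast
  next
    case (Suc k)
    have "diff_map F (Suc k) v \<in> irr_comp S_ver F k e"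
      using v Suc by (simp add: tor_cycles_def)
    then have "single [] (diff_map F (Suc k) v) \<in> bar_diff act_vec ` bar_chains P (FF k) 1 e"
      unfolding irr_comp_iff .
    then obtain w where "single [] (diff_map F (Suc k) v) = bar_diff act_vec w"
      "w \<in> bar_chains P (FF k) 1 e" by (rule imageE)
    note w = this(2) this(1)[symmetric]
    have dv: "diff_map F (Suc k) v \<in> syz k e" unfolding syz_image[symmetric] using vF Suc by blast
    have "\<exists>w'\<in>bar_chains P (syz k) (Suc 0) e. bar_diff act_vec w' = bar_diff act_vec w"
    proof (rule syz_boundary[where \<delta> = \<delta>])
      show "\<delta> e > int (0 + 1 + k)" using \<delta>(2) Suc by simp
      show "w \<in> bar_chains P (FF k) (Suc 0) e" using w(1) by simp
      show "bar_diff act_vec w \<in> bar_chains P (syz k) 0 e"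
        unfolding w(2) by (rule bar_chains_single) (simp_all add: dv)
    qed (rule ex)
    then obtain w' where w': "w' \<in> bar_chains P (syz k) 1 e" "bar_diff act_vec w' = bar_diff act_vec w"
      by auto
    obtain y where y: "y \<in> bar_chains P (FF (Suc k)) 1 e"
      "\<And>l. lookup w' l = diff_map F (Suc k) (lookup y l)"
      by (rule bar_chains_choice[OF w'(1), of "FF (Suc k)" "\<lambda>c x y. x = diff_map F (Suc k) y"])
        (auto simp: syz_image[symmetric] additive.zero[OF additive_diff_map])
    define u where "u = lookup (bar_diff act_vec y) []"
    have dyc: "bar_diff act_vec y \<in> bar_chains P (FF (Suc k)) 0 e"
      using vec.bar_diff_chains[OF graded_submodule_free, of y "rk F (Suc k)" "dg F (Suc k)" 0 e] y(1) by simp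
    then have "u \<in> FF (Suc k) (e - fst (sum_list [] :: letter))"
      unfolding u_def by (rule bar_chains_lookup[OF graded_submodule_free])
    then have uF: "u \<in> FF (Suc k) e" by simp
    have dy: "bar_diff act_vec y = single [] u"
    proof (rule poly_mapping_eqI)
      fix l
      show "lookup (bar_diff act_vec y) l = lookup (single [] u) l"
        using bar_chains_keys(1)[OF dyc, of l] by (cases "l = []") (auto simp: u_def lookup_single)
    qed
    have irr: "u \<in> irr_comp S_ver F (Suc k) e"
      unfolding irr_comp_iff dy[symmetric] by (rule imageI) (rule y(1))
    have "w' = cmap (diff_map F (Suc k)) y"
      by (rule poly_mapping_eqI) (simp add: y(2) lookup_cmap[OF additive_diff_map])
    then have "bar_diff act_vec w' = cmap (diff_map F (Suc k)) (bar_diff act_vec y)"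
      by (simp only:) (rule bar_diff_cmap[OF vec.bar_axioms vec.bar_axioms additive_diff_map],
        simp add: act_vec_def diff_map_vsmult)
    also have "\<dots> = single [] (diff_map F (Suc k) u)"
      by (simp add: dy cmap_single[OF additive_diff_map])
    finally have "diff_map F (Suc k) u = diff_map F (Suc k) v"
      using w(2) w'(2) by (metis lookup_single_eq)
    then have "v - u \<in> syz (Suc k) e"
      using vF uF Suc by (simp add: additive.diff[OF additive_diff_map] free_diff)
    then show ?thesis using irr Suc by blast
  qed
  then obtain u where u: "u \<in> irr_comp S_ver F i e" "v - u \<in> syz i e" by blast
  then obtain w where "w \<in> FF (Suc i) e" "v - u = diff_map F (Suc i) w"
    unfolding syz_image[symmetric] by blast
  then show "v \<in> tor_boundaries S_ver F i e"
    using u(1) unfolding tor_boundaries_def fcomp_pol_veronese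
    by (intro CollectI exI[of _ w] exI[of _ u]) (simp add: algebra_simps)
qed

end

section \<open>Resolutions of the quotient\<close>

lemma pol_set_closed:
  fixes p q :: "'k::field pol"
  assumes "p \<in> pol_set n m" "q \<in> pol_set n m"
  shows "p + q \<in> pol_set n m" "p * q \<in> pol_set n m" "- p \<in> pol_set n m"
proof -
  show "p + q \<in> pol_set n m"
    using assms Poly_Mapping.keys_add[of p q] unfolding pol_set_def by blast
  have "keys (- p) = keys p" by (auto simp: in_keys_iff)
  then show "- p \<in> pol_set n m" using assms unfolding pol_set_def by simp
  show "p * q \<in> pol_set n m"
    unfolding pol_set_def
  proof (intro CollectI ballI)
    fix \<mu> assume "\<mu> \<in> keys (p * q)"
    then obtain \<alpha> \<beta> where "\<alpha> \<in> keys p" "\<beta> \<in> keys q" "\<mu> = \<alpha> + \<beta>"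
      using keys_mult by blast
    then show "keys \<mu> \<subseteq> vars n m"
      using assms unfolding pol_set_def by (simp add: keys_add_mon)
  qed
qed

lemma zero_one_in_pol_set: "(0 :: 'k::field pol) \<in> pol_set n m" "(1 :: 'k::field pol) \<in> pol_set n m"
  by (simp_all add: pol_set_def)

lemma pol_ideal_ideal:
  fixes J :: "'k::field pol set"
  assumes "ideal J (pol_ring n m)"
  shows "pol_ideal n m J"
proof -
  interpret ideal J "pol_ring n m" by fact
  have mult: "a * x \<in> J" if "a \<in> pol_set n m" "x \<in> J" for a x
    using I_l_closed[of x a] that by (simp add: pol_ring_def)
  have add: "x + y \<in> J" if "x \<in> J" "y \<in> J" for x y
    using additive_subgroup.a_closed[OF ideal.axioms(1)[OF assms] that] by (simp add: pol_ring_def)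
  have "x - y \<in> J" if "x \<in> J" "y \<in> J" for x y
    using add[OF that(1) mult[OF pol_set_closed(3)[OF zero_one_in_pol_set(2) zero_one_in_pol_set(2)] that(2)]]
    by simp
  then show ?thesis
    unfolding pol_ideal_def using mult additive_subgroup.zero_closed[OF ideal.axioms(1)[OF assms]] by (auto simp: pol_ring_def)
qed

lemma coset_eq: "J +>\<^bsub>pol_ring n m\<^esub> p = (\<lambda>h. h + p) ` J"
  by (auto simp: a_r_coset_def' pol_ring_def)

lemma coset_eq_iff:
  assumes J: "pol_ideal n m J"
  shows "J +>\<^bsub>pol_ring n m\<^esub> p = J +>\<^bsub>pol_ring n m\<^esub> q \<longleftrightarrow> p - q \<in> J"
proof
  have 0: "0 \<in> J" and diff: "\<And>x y. x \<in> J \<Longrightarrow> y \<in> J \<Longrightarrow> x - y \<in> J"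
    using J by (auto simp: pol_ideal_def)
  have add: "x + y \<in> J" if "x \<in> J" "y \<in> J" for x y
    using diff[OF that(1) diff[OF 0 that(2)]] by simp
  {
    assume "J +>\<^bsub>pol_ring n m\<^esub> p = J +>\<^bsub>pol_ring n m\<^esub> q"
    moreover have "p \<in> J +>\<^bsub>pol_ring n m\<^esub> p" unfolding coset_eq by (rule image_eqI[of _ _ 0]) (simp_all add: 0)
    ultimately obtain h where "h \<in> J" "p = h + q" unfolding coset_eq by blast
    then show "p - q \<in> J" by simp
  next
    assume pq: "p - q \<in> J"
    have "h + p \<in> (\<lambda>h. h + q) ` J" if "h \<in> J" for h
      using add[OF that pq] by (intro image_eqI[of _ _ "h + (p - q)"]) simp_all
    moreover have "h + q \<in> (\<lambda>h. h + p) ` J" if "h \<in> J" for h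
      using diff[OF that pq] by (intro image_eqI[of _ _ "h - (p - q)"]) simp_all
    ultimately show "J +>\<^bsub>pol_ring n m\<^esub> p = J +>\<^bsub>pol_ring n m\<^esub> q" unfolding coset_eq by blast
  }
qed

lemma finsum_cosets:
  fixes J :: "'k::field pol set" and r :: nat
  assumes J: "ideal J (pol_ring n m)"
    and g: "\<And>k. k < r \<Longrightarrow> a k \<in> pol_set n m \<and> g k = J +>\<^bsub>pol_ring n m\<^esub> a k"
  shows "finsum (quot_module n m J) g {..<r} = J +>\<^bsub>pol_ring n m\<^esub> (\<Sum>k<r. a k)"
proof -
  interpret ideal J "pol_ring n m" by fact
  interpret Q: ring "pol_ring n m Quot J" by (rule quotient_is_ring)
  have "finsum (quot_module n m J) g {..<r} = finsum (pol_ring n m Quot J) g {..<r}"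
    by (simp add: finsum_def finprod_def quot_module_def Let_def)
  also have "\<dots> = J +>\<^bsub>pol_ring n m\<^esub> (\<Sum>k<r. a k)"
    using g
  proof (induction r)
    case 0
    have "finsum (pol_ring n m Quot J) g {..<0} = \<zero>\<^bsub>pol_ring n m Quot J\<^esub>" by simp
    then show ?case by (simp only: lessThan_0 sum.empty) (simp add: coset_eq FactRing_def)
  next
    case (Suc r)
    have sum: "(\<Sum>k<r. a k) \<in> pol_set n m"
    proof -
      have "(\<And>k. k < i \<Longrightarrow> a k \<in> pol_set n m) \<Longrightarrow> (\<Sum>k<i. a k) \<in> pol_set n m" for i
        by (induction i) (simp_all add: zero_one_in_pol_set pol_set_closed)
      then show ?thesis using Suc.prems by simp
    qed
    have carrier: "g k \<in> carrier (pol_ring n m Quot J)" if "k < Suc r" for k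
      using Suc.prems[OF that] by (auto simp: FactRing_def A_RCOSETS_def' pol_ring_def)
    have "finsum (pol_ring n m Quot J) g {..<Suc r} =
        g r \<oplus>\<^bsub>pol_ring n m Quot J\<^esub> finsum (pol_ring n m Quot J) g {..<r}"
      unfolding lessThan_Suc by (rule Q.finsum_insert) (use carrier in auto)
    also have "\<dots> = (J +>\<^bsub>pol_ring n m\<^esub> a r) <+>\<^bsub>pol_ring n m\<^esub> (J +>\<^bsub>pol_ring n m\<^esub> (\<Sum>k<r. a k))"
      using Suc by (simp add: FactRing_def)
    also have "\<dots> = J +>\<^bsub>pol_ring n m\<^esub> (a r \<oplus>\<^bsub>pol_ring n m\<^esub> (\<Sum>k<r. a k))"
      using Suc.prems[of r] sum by (intro a_rcos_sum) (auto simp: pol_ring_def)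
    finally show ?case by (simp add: pol_ring_def add.commute)
  qed
  finally show ?thesis .
qed

lemma smult_coset:
  fixes J :: "'k::field pol set"
  assumes J: "ideal J (pol_ring n m)" and "p \<in> pol_set n m" "q \<in> pol_set n m"
  shows "p \<odot>\<^bsub>quot_module n m J\<^esub> (J +>\<^bsub>pol_ring n m\<^esub> q) = J +>\<^bsub>pol_ring n m\<^esub> (p * q)"
proof -
  interpret ideal J "pol_ring n m" by fact
  have "p \<odot>\<^bsub>quot_module n m J\<^esub> (J +>\<^bsub>pol_ring n m\<^esub> q) = J +>\<^bsub>pol_ring n m\<^esub> (p \<otimes>\<^bsub>pol_ring n m\<^esub> q)"
    using rcoset_mult_add[of p q] assms(2,3)
    by (simp add: quot_module_def Let_def FactRing_def) (simp add: pol_ring_def)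
  then show ?thesis by (simp add: pol_ring_def)
qed

lemma ambient_quot_veronese: "ambient (quot_veronese n m J \<Delta>) = quot_module n m J"
  by (simp add: quot_veronese_def)

lemma zero_quot_module: "\<zero>\<^bsub>quot_module n m J\<^esub> = J +>\<^bsub>pol_ring n m\<^esub> 0"
  by (simp add: quot_module_def Let_def FactRing_def coset_eq)

context veronese
begin

lemma A_eq: "A c = (if 0 \<le> fst c \<and> 0 \<le> snd c then pol_comp n m (fst c * int s, snd c * int t) else {0})"
  by (subst acomp_pol_veronese[symmetric]) (cases c; simp add: pol_veronese_def veronese_comp_def)

lemma mcomp_quot_veronese:
  "mcomp (R_ver J) c = (\<lambda>p. J +>\<^bsub>pol_ring n m\<^esub> p) ` A c"
  by (cases c) (simp add: quot_veronese_def veronese_comp_def A_eq quot_comp_def zero_quot_module)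

lemma aug_map_eq:
  fixes J :: "'k::field pol set" and F :: "('k pol, 'k pol set) free_complex"
  assumes J: "ideal J (pol_ring n m)"
    and p: "\<And>k. k < rk F 0 \<Longrightarrow> p k \<in> A (dg F 0 k)" "\<And>k. k < rk F 0 \<Longrightarrow> aug F k = J +>\<^bsub>pol_ring n m\<^esub> p k"
    and v: "v \<in> free (rk F 0) (dg F 0) c"
  shows "aug_map (R_ver J) F v = J +>\<^bsub>pol_ring n m\<^esub> aug_lift (rk F 0) p v"
proof -
  have "lookup v k \<in> pol_set n m \<and> p k \<in> pol_set n m" if "k < rk F 0" for k
    using v p(1)[OF that] that A_subset_pol_set unfolding free_def by blast
  then show ?thesis
    unfolding aug_map_def aug_lift_def quot_veronese_def bg_module.simps
    by (intro finsum_cosets[OF J]) (simp add: p(2) smult_coset[OF J] pol_set_closed)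
qed

lemma one_in_A: "(1 :: 'k::field pol) \<in> A 0"
  unfolding single_one[symmetric] using zero_in_G by (intro single_in_mon_mod) (simp_all add: zero_prod_def)

text \<open>
  Representatives of the images of the basis elements are chosen in the right components; two cosets agree
  exactly if the difference of the representatives is in \<open>J\<close>.
\<close>

lemma cyclic_resolution_of_resolution:
  fixes J :: "'k::field pol set" and F :: "('k pol, 'k pol set) free_complex"
  assumes J: "ideal J (pol_ring n m)"
    and F: "bigraded_free_resolution S_ver (R_ver J) F"
  shows "\<exists>p. cyclic_resolution n m s t J F p"
proof -
  let ?M = "R_ver J"
  note F' = F[unfolded bigraded_free_resolution_def fcomp_pol_veronese]
  note F1 = F'[THEN conjunct1, rule_format]
    and F2 = F'[THEN conjunct2, THEN conjunct1, rule_format]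
    and F3 = F'[THEN conjunct2, THEN conjunct2, THEN conjunct1, THEN spec]
    and F4 = F'[THEN conjunct2, THEN conjunct2, THEN conjunct2, THEN conjunct1, THEN spec]
    and F5 = F'[THEN conjunct2, THEN conjunct2, THEN conjunct2, THEN conjunct2, THEN spec, THEN spec]
  note J' = pol_ideal_ideal[OF J]
  have "\<exists>p. p \<in> A (dg F 0 k) \<and> aug F k = J +>\<^bsub>pol_ring n m\<^esub> p" if "k < rk F 0" for k
    using F1[OF that] unfolding mcomp_quot_veronese by blast
  then have "\<exists>p. \<forall>k. k < rk F 0 \<longrightarrow> p k \<in> A (dg F 0 k) \<and> aug F k = J +>\<^bsub>pol_ring n m\<^esub> p k"
    by (intro choice) blast
  then obtain p where p0: "\<forall>k. k < rk F 0 \<longrightarrow> p k \<in> A (dg F 0 k) \<and> aug F k = J +>\<^bsub>pol_ring n m\<^esub> p k"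
    by (rule exE)
  then have p: "\<And>k. k < rk F 0 \<Longrightarrow> p k \<in> A (dg F 0 k)" "\<And>k. k < rk F 0 \<Longrightarrow> aug F k = J +>\<^bsub>pol_ring n m\<^esub> p k"
    by simp_all
  note aug = aug_map_eq[OF J p]
  have "cyclic_resolution n m s t J F p"
  proof
    show "pol_ideal n m J" by (rule J')
    show "p k \<in> A (dg F 0 k)" if "k < rk F 0" for k using that by (rule p)
    show "dif F (Suc i) k \<in> free (rk F i) (dg F i) (dg F (Suc i) k)" if "k < rk F (Suc i)" for i k
      using that by (rule F2)
    show "\<exists>v\<in>free (rk F 0) (dg F 0) c. x - aug_lift (rk F 0) p v \<in> J" if "x \<in> A c" for x c
    proof -
      have "J +>\<^bsub>pol_ring n m\<^esub> x \<in> mcomp ?M c" unfolding mcomp_quot_veronese using that by blast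
      then have "J +>\<^bsub>pol_ring n m\<^esub> x \<in> aug_map ?M F ` free (rk F 0) (dg F 0) c" unfolding F3 .
      then obtain v where v: "v \<in> free (rk F 0) (dg F 0) c" "J +>\<^bsub>pol_ring n m\<^esub> x = aug_map ?M F v" by blast
      then show ?thesis using aug[OF _ _ v(1)] coset_eq_iff[OF J'] by auto
    qed
    show "diff_map F 1 ` free (rk F 1) (dg F 1) c =
      {v \<in> free (rk F 0) (dg F 0) c. aug_lift (rk F 0) p v \<in> J}" for c
    proof -
      have "diff_map F 1 ` free (rk F 1) (dg F 1) c =
          {v \<in> free (rk F 0) (dg F 0) c. aug_map ?M F v = \<zero>\<^bsub>ambient ?M\<^esub>}" by (rule F4)
      moreover have "aug_map ?M F v = \<zero>\<^bsub>ambient ?M\<^esub> \<longleftrightarrow> aug_lift (rk F 0) p v \<in> J"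
        if "v \<in> free (rk F 0) (dg F 0) c" for v
        by (simp only: aug[OF _ _ that] ambient_quot_veronese zero_quot_module coset_eq_iff[OF J'] diff_zero)
      ultimately show ?thesis by blast
    qed
    show "diff_map F (Suc (Suc i)) ` free (rk F (Suc (Suc i))) (dg F (Suc (Suc i))) c =
      {v \<in> free (rk F (Suc i)) (dg F (Suc i)) c. diff_map F (Suc i) v = 0}" for i c
      by (rule F5)
  qed
  then show ?thesis by blast
qed

text \<open>
  The quotient is generated by its unit, so \<open>F\<^sub>0\<close> is \<open>A\<close> with kernel the Veronese module of \<open>J\<close>, and a
  chain of syzygies of this kernel continues it.
\<close>

lemma exists_bigraded_free_resolution:
  fixes J :: "'k::field pol set"
  assumes J: "ideal J (pol_ring n m)"
  shows "\<exists>F. bigraded_free_resolution S_ver (R_ver J) F"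
proof -
  let ?M = "R_ver J"
  note J' = pol_ideal_ideal[OF J]
  let ?Z = "\<lambda>c. {v \<in> free 1 (\<lambda>_. 0) c. lookup v 0 \<in> J}"
  have Z: "free_submodule 1 (\<lambda>_. 0) ?Z"
    unfolding free_submodule_def
  proof (intro conjI allI impI ballI)
    fix a :: "'k pol" and c e v assume a: "a \<in> A c" and v: "v \<in> ?Z e"
    have "a * lookup v 0 \<in> J"
      using pol_ideal_mult[OF J' subsetD[OF A_subset_pol_set a]] v by blast
    then show "vsmult a v \<in> ?Z (c + e)" using free_vsmult[OF a] v by simp
  qed (use J' in \<open>auto simp: pol_ideal_def lookup_minus intro: free_diff\<close>)
  obtain R Dg Df where RD: "R 0 = 1" "Dg 0 = (\<lambda>_. 0)"
    "\<forall>c. comb (R 1) (Df 1) ` free (R 1) (Dg 1) c = ?Z c"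
    "\<forall>i c. comb (R (Suc (Suc i))) (Df (Suc (Suc i))) ` free (R (Suc (Suc i))) (Dg (Suc (Suc i))) c =
       {v \<in> free (R (Suc i)) (Dg (Suc i)) c. comb (R (Suc i)) (Df (Suc i)) v = 0}"
    "\<forall>i. \<forall>k<R (Suc i). Df (Suc i) k \<in> free (R i) (Dg i) (Dg (Suc i) k)"
    using exists_syzygy_chain[OF Z] by (elim exE conjE)
  define F :: "('k pol, 'k pol set) free_complex" where
    "F = \<lparr>rk = R, dg = Dg, dif = Df, aug = (\<lambda>_. J +>\<^bsub>pol_ring n m\<^esub> 1)\<rparr>"
  have F: "rk F = R" "dg F = Dg" "dif F = Df" "aug F = (\<lambda>_. J +>\<^bsub>pol_ring n m\<^esub> 1)"
    by (simp_all add: F_def)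
  have aug: "aug_map ?M F v = J +>\<^bsub>pol_ring n m\<^esub> lookup v 0" if "v \<in> free 1 (\<lambda>_. 0) c" for v c
    using aug_map_eq[OF J, of F "\<lambda>_. 1" v c] that by (simp add: F RD(1,2) one_in_A aug_lift_def)
  have image: "(\<lambda>v. lookup v 0) ` free 1 (\<lambda>_. 0) c = A c" for c :: bideg
  proof
    show "(\<lambda>v. lookup v 0) ` free 1 (\<lambda>_. 0) c \<subseteq> A c" by (auto simp: free_def)
    show "A c \<subseteq> (\<lambda>v. lookup v 0) ` free 1 (\<lambda>_. 0) c"
    proof
      fix a :: "'b pol" assume "a \<in> A c"
      then have "single 0 a \<in> free 1 (\<lambda>_. 0) c" by (intro free_single) simp_all
      then show "a \<in> (\<lambda>v. lookup v 0) ` free 1 (\<lambda>_. 0) c" by (rule rev_image_eqI) simp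
    qed
  qed
  have "bigraded_free_resolution S_ver ?M F"
    unfolding bigraded_free_resolution_def fcomp_pol_veronese
  proof (intro conjI allI impI)
    show "aug F k \<in> mcomp ?M (dg F 0 k)" for k
      unfolding mcomp_quot_veronese F RD(2) using one_in_A by blast
    show "dif F (Suc i) k \<in> free (rk F i) (dg F i) (dg F (Suc i) k)" if "k < rk F (Suc i)" for i k
      using RD(5) that unfolding F by blast
    show "aug_map ?M F ` free (rk F 0) (dg F 0) e = mcomp ?M e" for e
    proof -
      have "aug_map ?M F ` free 1 (\<lambda>_. 0) e =
          (\<lambda>p. J +>\<^bsub>pol_ring n m\<^esub> p) ` (\<lambda>v. lookup v 0) ` free 1 (\<lambda>_. 0) e"
        unfolding image_image by (rule image_cong[OF refl aug])
      then show ?thesis unfolding F RD(1,2) mcomp_quot_veronese image .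
    qed
    show "diff_map F 1 ` free (rk F 1) (dg F 1) e =
        {v \<in> free (rk F 0) (dg F 0) e. aug_map ?M F v = \<zero>\<^bsub>ambient ?M\<^esub>}" for e
    proof -
      have "aug_map ?M F v = \<zero>\<^bsub>ambient ?M\<^esub> \<longleftrightarrow> lookup v 0 \<in> J" if "v \<in> free 1 (\<lambda>_. 0) e" for v
        by (simp only: aug[OF that] ambient_quot_veronese zero_quot_module coset_eq_iff[OF J'] diff_zero)
      then have "{v \<in> free 1 (\<lambda>_. 0) e. aug_map ?M F v = \<zero>\<^bsub>ambient ?M\<^esub>} = ?Z e" by blast
      then show ?thesis using RD(3)[rule_format, of e] unfolding F RD(1,2) diff_map_eq_comb by (simp only:)
    qed
    show "diff_map F (Suc (Suc i)) ` free (rk F (Suc (Suc i))) (dg F (Suc (Suc i))) e =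
        {v \<in> free (rk F (Suc i)) (dg F (Suc i)) e. diff_map F (Suc i) v = 0}" for i e
      using RD(4) unfolding F diff_map_eq_comb by blast
  qed
  then show ?thesis by blast
qed

end

section \<open>Betti numbers and regularity\<close>

lemma (in vector_space) dim_subset_finite:
  assumes "U \<subseteq> W" "W \<subseteq> span T" "finite T"
  shows "dim U \<le> dim W"
proof -
  obtain B where B: "B \<subseteq> U" "independent B" "U \<subseteq> span B" "card B = dim U" by (rule basis_exists)
  obtain C where C: "C \<subseteq> W" "independent C" "W \<subseteq> span C" "card C = dim W" by (rule basis_exists)
  have "finite C" using independent_span_bound[OF assms(3) C(2)] C(1) assms(2) by blast
  then show ?thesis using independent_span_bound[OF _ B(2), of C] B C assms(1) by auto
qed

text \<open>
  The intermediate subspace \<open>U'\<close> separates \<open>x\<close> from the span of \<open>U\<close>.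
\<close>

lemma (in vector_space) dim_psubset_finite:
  assumes "U \<subseteq> U'" "subspace U'" "U \<subseteq> W" "x \<in> W" "x \<notin> U'" "W \<subseteq> span T" "finite T"
  shows "dim U < dim W"
proof -
  obtain B where B: "B \<subseteq> U" "independent B" "U \<subseteq> span B" "card B = dim U" by (rule basis_exists)
  obtain C where C: "C \<subseteq> W" "independent C" "W \<subseteq> span C" "card C = dim W" by (rule basis_exists)
  have fin: "finite C" using independent_span_bound[OF assms(7) C(2)] C(1) assms(6) by blast
  have "span B \<subseteq> U'" using B(1) assms(1,2) by (intro span_minimal) auto
  then have x: "x \<notin> span B" using assms(5) by blast
  then have ind: "independent (insert x B)" using B(2) by (simp add: independent_insertI)
  have "insert x B \<subseteq> span C" using B(1) C(3) assms(3,4) by blast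
  from independent_span_bound[OF fin ind this]
  have "finite (insert x B)" "card (insert x B) \<le> card C" by simp_all
  moreover have "x \<notin> B" using x span_base by blast
  ultimately show ?thesis using B(4) C(4) by simp
qed

context veronese
begin

text \<open>
  The components of free modules have finite dimension: there are finitely many monomials of each
  bidegree.  This makes the differences of dimensions in the Betti numbers meaningful.
\<close>

lemma free_finite_span:
  fixes r :: nat
  shows "\<exists>T. finite T \<and> free r d e \<subseteq> module.span (kscale S_ver :: 'k::field \<Rightarrow> _) T"
proof -
  interpret V: vector_space "kscale S_ver :: 'k \<Rightarrow> _" by (rule vector_space_kscale)
  let ?b = "\<lambda>(j, u). single j (monom u) :: 'k vec"
  let ?T = "?b ` {(j, u). j < r \<and> (e - d j, u) \<in> G}"
  have "v \<in> V.span ?T" if v: "v \<in> free r d e" for v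
  proof -
    have "v = (\<Sum>j\<in>keys v. \<Sum>u\<in>keys (lookup v j).
        kscale S_ver (lookup (lookup v j) u) (?b (j, u)))"
    proof -
      have "kscale S_ver k (?b (j, u)) = single j (single u k)"
        for k j u
        by (auto intro!: poly_mapping_eqI[where 'a = nat] simp: kscale_eq lookup_single when_def mult_single)
      then have "(\<Sum>j\<in>keys v. \<Sum>u\<in>keys (lookup v j).
          kscale S_ver (lookup (lookup v j) u) (?b (j, u))) =
          (\<Sum>j\<in>keys v. single j (lin single (lookup v j)))"
        by (simp add: lin_def additive.sum[OF additive_single])
      also have "\<dots> = lin single v" by (subst lin_single_id) (simp add: lin_def)
      finally show ?thesis by (simp add: lin_single_id)
    qed
    also have "\<dots> \<in> V.span ?T"
    proof (intro V.span_sum V.span_scale V.span_base)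
      fix j u assume "j \<in> keys v" "u \<in> keys (lookup v j)"
      then have "(j, u) \<in> {(j, u). j < r \<and> (e - d j, u) \<in> G}"
        using v by (auto simp: free_def mon_mod_def)
      then show "?b (j, u) \<in> ?T" by (rule imageI)
    qed
    finally show ?thesis .
  qed
  then show ?thesis using finite_free_terms[of r e d] by blast
qed

lemma irr_comp_subset_free:
  fixes F :: "('k::field pol, 'b) free_complex"
  shows "irr_comp S_ver F i e \<subseteq> free (rk F i) (dg F i) e"
proof -
  interpret V: vector_space "kscale S_ver :: 'k \<Rightarrow> _" by (rule vector_space_kscale)
  have "vsmult a v \<in> free (rk F i) (dg F i) e" if "a \<in> A c" "v \<in> free (rk F i) (dg F i) (e - c)"
    for a c and v :: "'k vec"
    using free_vsmult[OF that] by simp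
  then show ?thesis
    unfolding irr_comp_def acomp_pol_veronese fcomp_pol_veronese
    by (intro V.span_minimal subspace_free) blast
qed

end

context cyclic_resolution
begin

lemma tor_boundaries_subset: "tor_boundaries S_ver F i e \<subseteq> FF i e"
  unfolding tor_boundaries_def fcomp_pol_veronese
  using diff_map_FF irr_comp_subset_free[of F i e] free_add by blast

lemma tor_cycles_0: "tor_cycles S_ver F 0 e = FF 0 e"
  by (simp add: tor_cycles_def fcomp_pol_veronese)

text \<open>
  The algebra and the quotient live in nonnegative bidegrees, so a product of bidegree \<open>0\<close> with a factor
  in \<open>A\<^sub>+\<close> is zero.
\<close>

lemma aug_lift_irr_0:
  assumes "u \<in> irr_comp S_ver F 0 0"
  shows "aug_lift_F u = 0"
proof -
  interpret V: vector_space "kscale S_ver :: 'k \<Rightarrow> _" by (rule vector_space_kscale)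
  have "V.subspace {u. aug_lift_F u = 0}"
    by (rule V.subspaceI)
      (simp_all add: additive.zero[OF additive_aug_lift] additive.add[OF additive_aug_lift] kscale_eq aug_lift_vsmult)
  moreover have "aug_lift_F (vsmult a v) = 0" if "c \<noteq> 0" "a \<in> A c" "v \<in> FF 0 (0 - c)" for a v c
  proof -
    have "aug_lift_F v \<in> A (- c)" using aug_lift_A[OF that(3)] by simp
    moreover have "a = 0 \<or> 0 \<le> fst c \<and> 0 \<le> snd c"
      using that(2) by (auto simp: A_eq split: if_splits)
    ultimately have "a = 0 \<or> aug_lift_F v = 0"
      using that(1) by (auto simp: A_eq prod_eq_iff split: if_splits)
    then show ?thesis by (auto simp: aug_lift_vsmult)
  qed
  ultimately have "V.span {vsmult a v |a v c. c \<noteq> 0 \<and> a \<in> A c \<and> v \<in> FF 0 (0 - c)} \<subseteq> {u. aug_lift_F u = 0}"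
    by (intro V.span_minimal) auto
  then show ?thesis
    using assms unfolding irr_comp_def acomp_pol_veronese fcomp_pol_veronese by blast
qed

text \<open>
  Boundaries in bidegree \<open>0\<close> are mapped into \<open>J\<close>, but a lift of the unit is not.
\<close>

lemma dim_tor_0:
  assumes "1 \<notin> J"
  shows "vector_space.dim (kscale S_ver) (tor_boundaries S_ver F 0 0) <
    vector_space.dim (kscale S_ver) (tor_cycles S_ver F 0 0)"
proof -
  interpret V: vector_space "kscale S_ver :: 'k \<Rightarrow> _" by (rule vector_space_kscale)
  obtain f where f: "f \<in> FF 0 0" "1 - aug_lift_F f \<in> J" using surj[OF one_in_A] by blast
  obtain T where T: "finite T" "FF 0 0 \<subseteq> V.span T" using free_finite_span by blast
  have 0: "0 \<in> J" and diff: "\<And>x y. x \<in> J \<Longrightarrow> y \<in> J \<Longrightarrow> x - y \<in> J" using J by (auto simp: pol_ideal_def)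
  have add: "x + y \<in> J" if "x \<in> J" "y \<in> J" for x y
    using diff[OF that(1) diff[OF 0 that(2)]] by simp
  have scale: "single 0 k * x \<in> J" if "x \<in> J" for k x
    by (rule pol_ideal_mult[OF J single_in_pol_set that]) simp
  show ?thesis
    unfolding tor_cycles_0
  proof (rule V.dim_psubset_finite[of _ "{v. aug_lift_F v \<in> J}" _ f T])
    show "V.subspace {v. aug_lift_F v \<in> J}"
      by (rule V.subspaceI)
        (auto simp: additive.zero[OF additive_aug_lift] additive.add[OF additive_aug_lift] kscale_eq aug_lift_vsmult
          0 add scale)
    show "tor_boundaries S_ver F 0 0 \<subseteq> {v. aug_lift_F v \<in> J}"
    proof
      fix v assume "v \<in> tor_boundaries S_ver F 0 0"
      then obtain w u where wu: "v = diff_map F 1 w + u" "w \<in> FF 1 0" "u \<in> irr_comp S_ver F 0 0"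
        unfolding tor_boundaries_def fcomp_pol_veronese One_nat_def by blast
      have "diff_map F 1 w \<in> {v \<in> FF 0 0. aug_lift_F v \<in> J}" unfolding exact_0[symmetric] using wu(2) by blast
      then show "v \<in> {v. aug_lift_F v \<in> J}"
        by (simp add: wu(1) additive.add[OF additive_aug_lift] aug_lift_irr_0[OF wu(3)])
    qed
    show "f \<notin> {v. aug_lift_F v \<in> J}"
      using add[OF f(2), of "aug_lift_F f"] assms by auto
    show "tor_boundaries S_ver F 0 0 \<subseteq> FF 0 0" by (rule tor_boundaries_subset)
  qed (fact f(1) T)+
qed

lemma dim_tor_le:
  assumes "tor_cycles S_ver F i e \<subseteq> tor_boundaries S_ver F i e"
  shows "vector_space.dim (kscale S_ver) (tor_cycles S_ver F i e) \<le>
    vector_space.dim (kscale S_ver) (tor_boundaries S_ver F i e)"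
proof -
  interpret V: vector_space "kscale S_ver :: 'k \<Rightarrow> _" by (rule vector_space_kscale)
  obtain T where T: "finite T" "FF i e \<subseteq> V.span T" using free_finite_span by blast
  show ?thesis
    by (rule V.dim_subset_finite[OF assms subset_trans[OF tor_boundaries_subset T(2)] T(1)])
qed

end

context veronese
begin

text \<open>
  The resolution in the definition of the Betti numbers is a genuine one, because one exists.
\<close>

lemma chosen_resolution:
  fixes J :: "'k::field pol set"
  assumes "ideal J (pol_ring n m)"
  shows "\<exists>p. cyclic_resolution n m s t J
    (SOME F. bigraded_free_resolution S_ver (R_ver J) F) p"
  by (rule cyclic_resolution_of_resolution[OF assms someI_ex[OF exists_bigraded_free_resolution[OF assms]]])

text \<open>
  The function \<open>\<delta>\<close> stands for one of the two coordinates of the bidegree, so that both regularities are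
  covered.
\<close>

lemma betti_eq_0:
  fixes J :: "'k::field pol set" and \<delta> :: "bideg \<Rightarrow> int"
  assumes J: "ideal J (pol_ring n m)"
    and ex: "\<And>j e. \<delta> e > int j + 1 \<Longrightarrow> bar_exact P act_pol (ideal_mod J) j e"
    and \<delta>: "\<delta> 0 = 0" "\<delta> e > int i"
  shows "betti S_ver (R_ver J) i e = 0"
proof -
  obtain p where "cyclic_resolution n m s t J
    (SOME F. bigraded_free_resolution S_ver (R_ver J) F) p"
    using chosen_resolution[OF J] by blast
  then interpret cyclic_resolution n m s t J
    "SOME F. bigraded_free_resolution S_ver (R_ver J) F" p .
  show ?thesis
    unfolding betti_def Let_def
    using dim_tor_le[OF tor_cycles_subset_boundaries[where \<delta> = \<delta>, OF ex \<delta>]] by simp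
qed

lemma betti_0_neq_0:
  fixes J :: "'k::field pol set"
  assumes J: "ideal J (pol_ring n m)" and "1 \<notin> J"
  shows "betti S_ver (R_ver J) 0 0 \<noteq> 0"
proof -
  obtain p where "cyclic_resolution n m s t J
    (SOME F. bigraded_free_resolution S_ver (R_ver J) F) p"
    using chosen_resolution[OF J] by blast
  then interpret cyclic_resolution n m s t J
    "SOME F. bigraded_free_resolution S_ver (R_ver J) F" p .
  show ?thesis
    unfolding betti_def Let_def using dim_tor_0[OF assms(2)] by simp
qed

lemma reg_x_eq_0:
  fixes J :: "'k::field pol set"
  assumes J: "ideal J (pol_ring n m)" "1 \<notin> J"
    and ex: "\<And>j e. fst e > int j + 1 \<Longrightarrow> bar_exact P act_pol (ideal_mod J) j e"
  shows "reg_x S_ver (R_ver J) = 0"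
proof (rule antisym)
  let ?b = "betti S_ver (R_ver J)"
  have "a \<le> 0" if "?b i (a + int i, b) \<noteq> 0" for a i b
  proof (rule ccontr)
    assume "\<not> a \<le> 0"
    then have "fst (a + int i, b) > int i" by simp
    from betti_eq_0[where \<delta> = fst, OF J(1) ex _ this] that show False by simp
  qed
  then show "reg_x S_ver (R_ver J) \<le> 0"
    unfolding reg_x_def by (intro Sup_least) auto
  have "?b 0 (0 + int 0, 0) \<noteq> 0" using betti_0_neq_0[OF J] by (simp add: zero_prod_def)
  then have "ereal (of_int 0) \<in> {ereal (of_int a) |a. \<exists>i b. ?b i (a + int i, b) \<noteq> 0}" by blast
  then show "0 \<le> reg_x S_ver (R_ver J)"
    unfolding reg_x_def by (intro Sup_upper) (simp add: zero_ereal_def)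
qed

lemma reg_y_eq_0:
  fixes J :: "'k::field pol set"
  assumes J: "ideal J (pol_ring n m)" "1 \<notin> J"
    and ex: "\<And>j e. snd e > int j + 1 \<Longrightarrow> bar_exact P act_pol (ideal_mod J) j e"
  shows "reg_y S_ver (R_ver J) = 0"
proof (rule antisym)
  let ?b = "betti S_ver (R_ver J)"
  have "b \<le> 0" if "?b i (a, b + int i) \<noteq> 0" for a i b
  proof (rule ccontr)
    assume "\<not> b \<le> 0"
    then have "snd (a, b + int i) > int i" by simp
    from betti_eq_0[where \<delta> = snd, OF J(1) ex _ this] that show False by simp
  qed
  then show "reg_y S_ver (R_ver J) \<le> 0"
    unfolding reg_y_def by (intro Sup_least) auto
  have "?b 0 (0, 0 + int 0) \<noteq> 0" using betti_0_neq_0[OF J] by (simp add: zero_prod_def)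
  then have "ereal (of_int 0) \<in> {ereal (of_int b) |b. \<exists>i a. ?b i (a, b + int i) \<noteq> 0}" by blast
  then show "0 \<le> reg_y S_ver (R_ver J)"
    unfolding reg_y_def by (intro Sup_upper) (simp add: zero_ereal_def)
qed

end

theorem corollary6p4:
  fixes n m :: nat and J :: "'k::field pol set"
  assumes "infinite (UNIV :: 'k set)"
    and "bigraded_ideal n m J" and "J \<noteq> carrier (pol_ring n m)"
  shows "(\<exists>s0. \<forall>s\<ge>s0. \<forall>t. (s, t) \<noteq> (0, 0) \<longrightarrow>
            reg_x (pol_veronese n m (s, t)) (quot_veronese n m J (s, t)) = 0) \<and>
         (\<exists>t0. \<forall>t\<ge>t0. \<forall>s. (s, t) \<noteq> (0, 0) \<longrightarrow>
            reg_y (pol_veronese n m (s, t)) (quot_veronese n m J (s, t)) = 0)"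
proof -
  have J: "ideal J (pol_ring n m)" using assms(2) by (simp add: bigraded_ideal_def)
  have one: "1 \<notin> J" using ideal.one_imp_carrier[OF J] assms(3) by (auto simp: pol_ring_def)
  obtain M where M: "M \<subseteq> initial_set n m J" "finite M"
    "\<forall>\<mu>\<in>initial_set n m J. \<exists>\<nu>\<in>M. \<mu> \<in> multiples \<nu>"
    using initial_set_finite_generators[of n m J] by (elim exE conjE)
  let ?d = "bidegree n m (\<Sum>M)"
  have ex: "bar_exact (veronese.P n m s t) act_pol (veronese.ideal_mod n m s t J) j e"
    if "fst ?d \<le> int s \<and> fst e > int j + 1 \<or> snd ?d \<le> int t \<and> snd e > int j + 1" for s t j e
    by (rule veronese.bar_exact_ideal_mod[OF pol_ideal_ideal[OF J] M(2,1)]) (use M(3) that in auto)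
  show ?thesis
  proof (intro conjI exI allI impI)
    show "reg_x (pol_veronese n m (s, t)) (quot_veronese n m J (s, t)) = 0" if "nat (fst ?d) \<le> s" for s t
      by (rule veronese.reg_x_eq_0[OF J one ex]) (use that in linarith)
    show "reg_y (pol_veronese n m (s, t)) (quot_veronese n m J (s, t)) = 0" if "nat (snd ?d) \<le> t" for s t
      by (rule veronese.reg_y_eq_0[OF J one ex]) (use that in linarith)
  qed
qed

end
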